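(* For every $\eta\in\mathrm{Curr}(S)$, $\delta_\eta=\delta_\eta^g$. This common value is finite if and only if $\eta$ is filling, and the map $\eta\mapsto\delta_\eta$ restricted to the set $\mathcal{F}$ of filling currents is continuous.
   Context: Let $S$ be a closed orientable surface of genus at least $2$ with a fixed hyperbolic metric, $S=\mathbb{H}^2/\Gamma_0$ with $\Gamma_0$ discrete cocompact. $\mathrm{Curr}(S)$ is the set of $\Gamma_0$-invariant locally finite Borel measures on the space of unoriented geodesics of $\mathbb{H}^2$, with the weak-* topology; $i$ is Bonahon's continuous bilinear intersection form. $\mathcal{C}$ is the set of free homotopy classes of (nontrivial) closed curves on $S$, each viewed as a current (sum of Dirac masses on the lifts of its closed geodesic). A current $\eta$ is filling if every geodesic of $\mathbb{H}^2$ meets transversally some geodesic in the support of $\eta$; $\mathcal{F}$ is the set of filling currents. For distinct $x,y\in\mathbb{H}^2$: $g_{(xy)}$ is the geodesic through $x,y$; $G(x)$ the set of geodesics through $x$; $T(x,y)$ the set of geodesics meeting the open segment $(x,y)$ transversally and not through $x$ or $y$; $T[x,y]:=(T(x,y)\cup G(x)\cup G(y))\setminus\{g_{(xy)}\}$; $d_\eta(x,y):=\eta(T[x,y])$, $d_\eta(x,x):=0$. Fix $o\in\mathbb{H}^2$. The metric critical exponent is $\delta_\eta:=\limsup_{R\to\infty}\frac1R\log\operatorname{Card}\{\gamma\in\Gamma_0: d_\eta(\gamma o,o)\le R\}$ and the geodesic critical exponent is $\delta^g_\eta:=\limsup_{R\to\infty}\frac1R\log\operatorname{Card}\{c\in\mathcal{C}: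 i(\eta,c)\le R\}$ (with value $+\infty$ if the sets are infinite). *)

theory Defs
  imports "HOL-Analysis.Analysis"
begin

section \<open>Hyperboloid model of the hyperbolic plane\<close>

text \<open>Lorentz form of signature (+,+,-) on R^3; H^2 is the upper sheet of the
  hyperboloid; orientation-preserving isometries are SO^+(2,1) acting linearly.\<close>

definition lor :: "real^3 \<Rightarrow> real^3 \<Rightarrow> real" where
  "lor x y = x$1 * y$1 + x$2 * y$2 - x$3 * y$3"

definition Hyp :: "(real^3) set" where
  "Hyp = {x. lor x x = -1 \<and> x$3 > 0}"

definition SOplus :: "(real^3^3) set" where
  "SOplus = {M. (\<forall>x y. lor (M *v x) (M *v y) = lor x y) \<and> det M = 1 \<and>
                 (\<lambda>x. M *v x) ` Hyp \<subseteq> Hyp}"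

text \<open>Gamma is the fundamental group of a closed orientable hyperbolic surface:
  a discrete, cocompact, torsion-free (freely acting) subgroup of SO^+(2,1).
  Genus at least 2 is then automatic.\<close>

definition surface_group :: "(real^3^3) set \<Rightarrow> bool" where
  "surface_group \<Gamma> \<longleftrightarrow>
     \<Gamma> \<subseteq> SOplus \<and> mat 1 \<in> \<Gamma> \<and>
     (\<forall>a\<in>\<Gamma>. \<forall>b\<in>\<Gamma>. a ** b \<in> \<Gamma>) \<and> (\<forall>a\<in>\<Gamma>. matrix_inv a \<in> \<Gamma>) \<and>
     (\<forall>a\<in>\<Gamma>. \<exists>e>0. \<forall>b\<in>\<Gamma>. dist b a < e \<longrightarrow> b = a) \<and>
     (\<exists>K. compact K \<and> K \<subseteq> Hyp \<and> Hyp \<subseteq> (\<Union>a\<in>\<Gamma>. (\<lambda>x. a *v x) ` K)) \<and>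
     (\<forall>a\<in>\<Gamma>. a \<noteq> mat 1 \<longrightarrow> (\<forall>x\<in>Hyp. a *v x \<noteq> x))"

section \<open>The space of unoriented geodesics\<close>

text \<open>A geodesic is represented by its point set {x in H. lor x n = 0}, n spacelike.\<close>

definition dS :: "(real^3) set" where
  "dS = {n. lor n n = 1}"

definition gd :: "real^3 \<Rightarrow> (real^3) set" where
  "gd n = {x\<in>Hyp. lor x n = 0}"

definition Geod :: "(real^3) set set" where
  "Geod = gd ` dS"

text \<open>Quotient topology on the space of geodesics (quotient of de Sitter space).\<close>

definition geod_top :: "(real^3) set topology" where
  "geod_top = topology_generated_by
     {U. U \<subseteq> Geod \<and> openin (top_of_set dS) {n\<in>dS. gd n \<in> U}}"

definition GeodM :: "(real^3) set measure" where
  "GeodM = sigma Geod {U. openin geod_top U}"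

definition gimg :: "real^3^3 \<Rightarrow> (real^3) set \<Rightarrow> (real^3) set" where
  "gimg a g = (\<lambda>x. a *v x) ` g"

section \<open>Geodesic currents\<close>

definition Curr :: "(real^3^3) set \<Rightarrow> (real^3) set measure set" where
  "Curr \<Gamma> = {\<eta>. sets \<eta> = sets GeodM \<and>
     (\<forall>a\<in>\<Gamma>. \<forall>A\<in>sets \<eta>. emeasure \<eta> (gimg a ` A) = emeasure \<eta> A) \<and>
     (\<forall>g\<in>Geod. \<exists>U. openin geod_top U \<and> g \<in> U \<and> emeasure \<eta> U < \<infinity>)}"

text \<open>Compactly supported continuous functions on the space of geodesics and the
  weak-* topology on currents.\<close>

definition Cc :: "((real^3) set \<Rightarrow> real) set" where
  "Cc = {f. continuous_map geod_top euclideanreal f \<and>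
            (\<exists>K. compactin geod_top K \<and> (\<forall>g\<in>Geod - K. f g = 0))}"

definition curr_top :: "(real^3^3) set \<Rightarrow> (real^3) set measure topology" where
  "curr_top \<Gamma> = topology_generated_by
     {{\<eta>\<in>Curr \<Gamma>. (\<integral>g. f g \<partial>\<eta>) \<in> U} | f U. f \<in> Cc \<and> open U}"

definition supp :: "(real^3) set measure \<Rightarrow> (real^3) set set" where
  "supp \<eta> = {g\<in>Geod. \<forall>U. openin geod_top U \<and> g \<in> U \<longrightarrow> emeasure \<eta> U > 0}"

definition transverse :: "(real^3) set \<Rightarrow> (real^3) set \<Rightarrow> bool" where
  "transverse g h \<longleftrightarrow> g \<in> Geod \<and> h \<in> Geod \<and> g \<noteq> h \<and> g \<inter> h \<noteq> {}"

definition filling :: "(real^3) set measure \<Rightarrow> bool" where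
  "filling \<eta> \<longleftrightarrow> (\<forall>g\<in>Geod. \<exists>h\<in>supp \<eta>. transverse g h)"

definition Filling :: "(real^3^3) set \<Rightarrow> (real^3) set measure set" where
  "Filling \<Gamma> = {\<eta>\<in>Curr \<Gamma>. filling \<eta>}"

section \<open>Bonahon's intersection form\<close>

definition fund_dom :: "(real^3^3) set \<Rightarrow> (real^3) set" where
  "fund_dom \<Gamma> = (SOME F. F \<in> sets borel \<and> F \<subseteq> Hyp \<and>
                     (\<forall>x\<in>Hyp. \<exists>!a. a \<in> \<Gamma> \<and> a *v x \<in> F))"

definition inter :: "(real^3^3) set \<Rightarrow> (real^3) set measure \<Rightarrow> (real^3) set measure \<Rightarrow> ennreal" where
  "inter \<Gamma> \<mu> \<nu> = emeasure (\<mu> \<Otimes>\<^sub>M \<nu>)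
     {(g,h). transverse g h \<and> (\<exists>p\<in>fund_dom \<Gamma>. g \<inter> h = {p})}"

section \<open>Closed curves as currents\<close>

definition mpow :: "real^3^3 \<Rightarrow> nat \<Rightarrow> real^3^3" where
  "mpow a n = (((**) a) ^^ n) (mat 1)"

definition cyc :: "real^3^3 \<Rightarrow> (real^3^3) set" where
  "cyc a = {mpow a n | n. True} \<union> {mpow (matrix_inv a) n | n. True}"

definition cosets :: "(real^3^3) set \<Rightarrow> real^3^3 \<Rightarrow> (real^3^3) set set" where
  "cosets \<Gamma> a = {(\<lambda>c. h ** c) ` cyc a | h. h \<in> \<Gamma>}"

text \<open>The axis of a hyperbolic element: its unique invariant geodesic.\<close>

definition axis :: "real^3^3 \<Rightarrow> (real^3) set" where
  "axis a = (THE g. g \<in> Geod \<and> gimg a g = g)"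

text \<open>Current of the closed curve represented by a: Dirac masses on the lifts
  h(axis a), one for each coset h<a> in Gamma/<a>.\<close>

definition curve_current :: "(real^3^3) set \<Rightarrow> real^3^3 \<Rightarrow> (real^3) set measure" where
  "curve_current \<Gamma> a = distr (count_space (cosets \<Gamma> a)) GeodM
      (\<lambda>C. gimg (SOME h. h \<in> C) (axis a))"

text \<open>Free homotopy classes of nontrivial closed curves = conjugacy classes of
  nontrivial elements of Gamma.\<close>

definition conjcl :: "(real^3^3) set \<Rightarrow> real^3^3 \<Rightarrow> (real^3^3) set" where
  "conjcl \<Gamma> a = {h ** a ** matrix_inv h | h. h \<in> \<Gamma>}"

definition Curves :: "(real^3^3) set \<Rightarrow> (real^3^3) set set" where
  "Curves \<Gamma> = {conjcl \<Gamma> a | a. a \<in> \<Gamma> \<and> a \<noteq> mat 1}"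

definition class_current :: "(real^3^3) set \<Rightarrow> (real^3^3) set \<Rightarrow> (real^3) set measure" where
  "class_current \<Gamma> c = curve_current \<Gamma> (SOME a. a \<in> c)"

section \<open>Critical exponents\<close>

definition crit_exp :: "(real \<Rightarrow> 'x set) \<Rightarrow> ereal" where
  "crit_exp A = Limsup at_top
     (\<lambda>R. if finite (A R) then ereal (ln (real (card (A R))) / R) else \<infinity>)"

definition seg_open :: "real^3 \<Rightarrow> real^3 \<Rightarrow> (real^3) set" where
  "seg_open x y = {z\<in>Hyp. \<exists>a b. a > 0 \<and> b > 0 \<and> z = a *\<^sub>R x + b *\<^sub>R y}"

definition geod_through :: "real^3 \<Rightarrow> real^3 \<Rightarrow> (real^3) set" where
  "geod_through x y = (THE g. g \<in> Geod \<and> x \<in> g \<and> y \<in> g)"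

definition Gx :: "real^3 \<Rightarrow> (real^3) set set" where
  "Gx x = {g\<in>Geod. x \<in> g}"

definition Topen :: "real^3 \<Rightarrow> real^3 \<Rightarrow> (real^3) set set" where
  "Topen x y = {g\<in>Geod. g \<noteq> geod_through x y \<and> g \<inter> seg_open x y \<noteq> {} \<and> x \<notin> g \<and> y \<notin> g}"

definition Tclosed :: "real^3 \<Rightarrow> real^3 \<Rightarrow> (real^3) set set" where
  "Tclosed x y = (Topen x y \<union> Gx x \<union> Gx y) - {geod_through x y}"

definition d_curr :: "(real^3) set measure \<Rightarrow> real^3 \<Rightarrow> real^3 \<Rightarrow> ennreal" where
  "d_curr \<eta> x y = (if x = y then 0 else emeasure \<eta> (Tclosed x y))"

definition metric_crit :: "(real^3^3) set \<Rightarrow> real^3 \<Rightarrow> (real^3) set measure \<Rightarrow> ereal" where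
  "metric_crit \<Gamma> x0 \<eta> = crit_exp (\<lambda>R. {a\<in>\<Gamma>. d_curr \<eta> (a *v x0) x0 \<le> ennreal R})"

definition geod_crit :: "(real^3^3) set \<Rightarrow> (real^3) set measure \<Rightarrow> ereal" where
  "geod_crit \<Gamma> \<eta> = crit_exp (\<lambda>R. {c\<in>Curves \<Gamma>. inter \<Gamma> \<eta> (class_current \<Gamma> c) \<le> ennreal R})"

end

theory Submission
  imports Defs
begin

text \<open>
  A geodesic is encoded by its two unit normals \<open>\<plusminus>n\<close>; it meets the segment \<open>[x, y]\<close> iff
  \<open>lor x n\<close> and \<open>lor y n\<close> do not have the same strict sign. Along a parametrized line, a current pushes
  forward to the measure of crossing times on the real line: the distance between two points of
  the line is the mass of an interval, and for the axis of a group element the intersection number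
  with the corresponding closed curve is the mass of one period. All geodesics meeting a unit ball
  have mass bounded by a constant, so comparisons up to an additive constant are cheap.

  An element whose axis passes near the base point moves it by the intersection number up to a
  constant, and every closed curve is represented by such an element; hence \<open>\<delta>\<^sup>g \<le> \<delta>\<close>. Conversely,
  a fixed finite set of group elements suffices to close up every orbit segment to an element with axis near
  the base point, and a conjugacy class contains at most linearly many of those in terms of its
  length. If the current is filling, compactness shows that its distance dominates the hyperbolic one
  linearly, whence \<open>\<delta> \<le> \<delta>\<^sup>g\<close> and finiteness. If it is not filling, there is a geodesic of
  zero length, and closing up its long segments gives infinitely many elements and curves of bounded length.

  For continuity, the distance between two points is within a constant of the integral of a
  compactly supported continuous function. Cutting a long segment into pieces of length \<open>L\<close> and using
  the finitely many pieces up to the group, two nearby currents have distances differing by \<open>O(1/L)\<close>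
  times the length, hence by a factor close to 1 if one of them is filling.
\<close>

section \<open>Lorentz algebra\<close>

text \<open>Distances never appear as such: \<open>- lor x y\<close> is the cosh of the distance
  between points of \<open>Hyp\<close>, and \<open>\<bar>lor x n\<bar>\<close> is the sinh of the
  distance from \<open>x\<close> to the geodesic with unit normal \<open>n\<close>. Bounded errors
  in distance thus become bounded factors in \<open>lor\<close>. Three constants carry the argument:
  \<open>M0\<close>, the cosh of a covering radius of the orbit of \<open>x0\<close>;
  \<open>e0\<close>, which bounds all displacements from below; and \<open>mass\<close>, a uniform
  bound for the measure of the geodesics near a point. A current may have atoms, so closed and
  half-open segments differ, and each cut of a line costs an error \<open>mass \<eta> 0\<close>. The
  intersection form refers to a fundamental domain given by \<open>SOME\<close>, so a Borel one has
  to be constructed before anything can be computed. Closing up is governed by traces: the trace of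
  an element determines its translation length, so an element whose trace is comparable to its
  displacement at \<open>x0\<close> has its axis near \<open>x0\<close>. Traces are also conjugation
  invariant and therefore tell closed curves apart.\<close>

lemma lor_commute: "lor x y = lor y x"
  by (simp add: lor_def mult.commute)

lemma lor_linear_left [simp]:
  "lor (x + y) z = lor x z + lor y z"
  "lor (x - y) z = lor x z - lor y z"
  "lor (c *\<^sub>R x) z = c * lor x z"
  "lor (- x) z = - lor x z"
  "lor 0 z = 0"
  by (simp_all add: lor_def algebra_simps)

lemma lor_linear_right [simp]:
  "lor z (x + y) = lor z x + lor z y"
  "lor z (x - y) = lor z x - lor z y"
  "lor z (c *\<^sub>R x) = c * lor z x"
  "lor z (- x) = - lor z x"
  "lor z 0 = 0"
  by (simp_all add: lor_def algebra_simps)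

lemma continuous_on_lor [continuous_intros]:
  "continuous_on S f \<Longrightarrow> continuous_on S g \<Longrightarrow> continuous_on S (\<lambda>x. lor (f x) (g x))"
  unfolding lor_def by (intro continuous_intros)

lemma tendsto_lor [tendsto_intros]:
  "(f \<longlongrightarrow> a) F \<Longrightarrow> (g \<longlongrightarrow> b) F \<Longrightarrow> ((\<lambda>x. lor (f x) (g x)) \<longlongrightarrow> lor a b) F"
  unfolding lor_def by (intro tendsto_intros)

lemma borel_measurable_vec3I:
  fixes f :: "'a \<Rightarrow> real^3"
  assumes "\<And>i. (\<lambda>x. f x $ i) \<in> borel_measurable M"
  shows "f \<in> borel_measurable M"
proof (rule borel_measurable_euclidean_space[THEN iffD2], rule ballI)
  fix b :: "real^3" assume "b \<in> Basis"
  then obtain i where "b = Finite_Cartesian_Product.axis i 1" by (auto simp: Basis_vec_def)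
  then show "(\<lambda>x. f x \<bullet> b) \<in> borel_measurable M"
    using assms[of i] by (simp add: inner_axis)
qed

lemma borel_measurable_vec3_nth [measurable]:
  fixes f :: "'a \<Rightarrow> real^3"
  shows "f \<in> borel_measurable M \<Longrightarrow> (\<lambda>x. f x $ i) \<in> borel_measurable M"
  by (simp add: cart_eq_inner_axis)

lemma borel_measurable_lor [measurable]:
  assumes [measurable]: "f \<in> borel_measurable M" "g \<in> borel_measurable M"
  shows "(\<lambda>x. lor (f x) (g x)) \<in> borel_measurable M"
  unfolding lor_def by measurable

lemma vec3_eqI: "x $ 1 = y $ 1 \<Longrightarrow> x $ 2 = y $ 2 \<Longrightarrow> x $ 3 = y $ 3 \<Longrightarrow> x = (y :: real^3)"
  by (simp add: vec_eq_iff forall_3)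

lemma Hyp_lor_self: "x \<in> Hyp \<Longrightarrow> lor x x = - 1"
  by (simp add: Hyp_def)

lemma Hyp_third_pos: "x \<in> Hyp \<Longrightarrow> x $ 3 > 0"
  by (simp add: Hyp_def)

lemma timelike_third_nonzero: assumes "lor x x < 0" shows "x $ 3 \<noteq> 0"
proof
  assume "x $ 3 = 0"
  then have "lor x x = x $ 1 * x $ 1 + x $ 2 * x $ 2" by (simp add: lor_def)
  then show False using assms sum_squares_ge_zero[of "x $ 1" "x $ 2"] by linarith
qed

text \<open>The orthogonal complement of a timelike vector is positive definite: Cauchy-Schwarz in
  the first two coordinates turns \<open>lor x v = 0\<close> into
  \<open>(x$3)\<^sup>2 * lor v v \<ge> (v$1)\<^sup>2 + (v$2)\<^sup>2\<close>.\<close>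

lemma orth_Hyp:
  assumes "x \<in> Hyp" "lor x v = 0"
  shows orth_Hyp_nonneg: "lor v v \<ge> 0" and orth_Hyp_null: "lor v v = 0 \<Longrightarrow> v = 0"
proof -
  let ?q = "(v$1)^2 + (v$2)^2" and ?c = "(x$3)^2"
  have x: "(x$1)^2 + (x$2)^2 = ?c - 1" "x$3 > 0"
    using assms(1) by (auto simp: Hyp_def lor_def power2_eq_square)
  have "?c * (v$3)^2 = (x$1 * v$1 + x$2 * v$2)^2"
    using assms(2) by (simp add: lor_def power_mult_distrib[symmetric])
  also have "\<dots> \<le> ((x$1)^2 + (x$2)^2) * ?q"
    using sum_squares_ge_zero[of "x$1 * v$2 - x$2 * v$1" 0]
    by (simp add: power2_eq_square algebra_simps)
  also have "\<dots> = (?c - 1) * ?q" by (simp only: x(1))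
  finally have "?c * lor v v \<ge> ?q"
    by (simp add: lor_def power2_eq_square algebra_simps)
  moreover have "?c > 0" using x by simp
  moreover have "?q \<ge> 0" by simp
  ultimately show "lor v v \<ge> 0"
    by (smt (verit) mult_nonneg_nonpos mult_pos_neg)
  assume "lor v v = 0"
  with \<open>?c * lor v v \<ge> ?q\<close> have "?q = 0"
    by (smt (verit) mult_eq_0_iff \<open>0 \<le> ?q\<close>)
  then have "v$1 = 0" "v$2 = 0"
    by (simp_all add: sum_power2_eq_zero_iff)
  with assms(2) x(2) have "v$3 = 0" by (simp add: lor_def)
  with \<open>v$1 = 0\<close> \<open>v$2 = 0\<close> show "v = 0" by (intro vec3_eqI) auto
qed

text \<open>Cauchy--Schwarz for the projections to the Euclidean plane orthogonal to \<open>x\<close>.\<close>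

lemma Hyp_Cauchy_Schwarz:
  assumes "x \<in> Hyp"
  shows "(lor a b + lor a x * lor b x)\<^sup>2 \<le> (lor a a + (lor a x)\<^sup>2) * (lor b b + (lor b x)\<^sup>2)"
proof -
  define a' b' where "a' = a + lor a x *\<^sub>R x" and "b' = b + lor b x *\<^sub>R x"
  have o: "lor x a' = 0" "lor x b' = 0"
    using assms by (simp_all add: a'_def b'_def Hyp_lor_self lor_commute)
  have e: "lor a' a' = lor a a + (lor a x)\<^sup>2" "lor b' b' = lor b b + (lor b x)\<^sup>2"
      "lor a' b' = lor a b + lor a x * lor b x"
    using assms by (simp_all add: a'_def b'_def Hyp_lor_self power2_eq_square lor_commute)
  have "(lor a' b')\<^sup>2 \<le> lor a' a' * lor b' b'"
  proof (cases "b' = 0")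
    case False
    then have pos: "lor b' b' > 0"
      using orth_Hyp_nonneg[OF assms o(2)] orth_Hyp_null[OF assms o(2)] by force
    let ?v = "lor b' b' *\<^sub>R a' - lor a' b' *\<^sub>R b'"
    have "lor ?v ?v \<ge> 0"
      by (rule orth_Hyp_nonneg[OF assms]) (simp add: o)
    also have "lor ?v ?v = lor b' b' * (lor a' a' * lor b' b' - (lor a' b')\<^sup>2)"
      by (simp add: algebra_simps power2_eq_square lor_commute)
    finally show ?thesis using pos by (simp add: zero_le_mult_iff)
  qed simp
  then show ?thesis by (simp add: e)
qed

text \<open>Reversed Cauchy-Schwarz inequality for timelike vectors on one sheet. It makes
  \<open>- lor x y\<close> a legitimate cosh of a distance.\<close>

lemma Hyp_lor_le: assumes "x \<in> Hyp" "y \<in> Hyp" shows "lor x y \<le> - 1"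
proof -
  have "(lor x y)\<^sup>2 \<ge> 1"
    using Hyp_Cauchy_Schwarz[OF assms(1), of y y] orth_Hyp_nonneg[OF assms(1), of "y + lor y x *\<^sub>R x"] assms
    by (simp add: Hyp_lor_self lor_commute power2_eq_square)
  moreover have "lor x y < 0"
  proof -
    have e: "(x$1)^2 + (x$2)^2 < (x$3)^2" "(y$1)^2 + (y$2)^2 < (y$3)^2" "x$3 > 0" "y$3 > 0"
      using assms by (auto simp: Hyp_def lor_def power2_eq_square)
    have "(x$1 * y$1 + x$2 * y$2)^2 \<le> ((x$1)^2 + (x$2)^2) * ((y$1)^2 + (y$2)^2)"
      using sum_squares_ge_zero[of "x$1 * y$2 - x$2 * y$1" 0]
      by (simp add: power2_eq_square algebra_simps)
    also have "\<dots> < (x$3)^2 * (y$3)^2"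
      using e by (intro mult_strict_mono) auto
    finally have "(x$1 * y$1 + x$2 * y$2)^2 < (x$3 * y$3)^2" by (simp add: power_mult_distrib)
    moreover have "x$3 * y$3 \<ge> 0" using e(3,4) by simp
    ultimately have "x$1 * y$1 + x$2 * y$2 < x$3 * y$3"
      by (rule power2_less_imp_less)
    then show ?thesis by (simp add: lor_def)
  qed
  ultimately show ?thesis
    using abs_square_less_1[of "lor x y"] by auto
qed

lemma Hyp_lor_eqD: assumes "x \<in> Hyp" "y \<in> Hyp" "lor x y = - 1" shows "x = y"
proof -
  have "lor x (y - x) = 0" "lor (y - x) (y - x) = 0"
    using assms by (simp_all add: Hyp_lor_self lor_commute)
  then have "y - x = 0" using orth_Hyp_null assms(1) by blast
  then show ?thesis by simp
qed

lemma HypI_lor: assumes "lor x x = - 1" "y \<in> Hyp" "lor x y < 0" shows "x \<in> Hyp"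
proof (rule ccontr)
  assume "x \<notin> Hyp"
  then have "x$3 \<le> 0" using assms by (simp add: Hyp_def)
  moreover have "x$3 \<noteq> 0" using timelike_third_nonzero assms(1) by simp
  ultimately have "- x \<in> Hyp" using assms(1) by (simp add: Hyp_def)
  from Hyp_lor_le[OF this assms(2)] assms(3) show False by simp
qed

text \<open>The second bound says that the cosine of the angle at \<open>y\<close> in the hyperbolic
  law of cosines is at most 1 in absolute value. The first is its weak form
  \<open>cosh (a + b) \<le> 2 * cosh a * cosh b\<close>, a triangle inequality with a harmless
  factor 2.\<close>

lemma lor_triangle:
  assumes "x \<in> Hyp" "y \<in> Hyp" "z \<in> Hyp"
  shows "- lor x z \<le> 2 * (lor x y * lor y z)"
    and "(lor x z + lor x y * lor y z)\<^sup>2 \<le> ((lor x y)\<^sup>2 - 1) * ((lor y z)\<^sup>2 - 1)"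
proof -
  let ?a = "lor x y" and ?b = "lor y z"
  show cs: "(lor x z + ?a * ?b)\<^sup>2 \<le> (?a\<^sup>2 - 1) * (?b\<^sup>2 - 1)"
    using Hyp_Cauchy_Schwarz[OF assms(2), of x z] assms by (simp add: Hyp_lor_self lor_commute)
  have ab: "?a \<le> - 1" "?b \<le> - 1" using Hyp_lor_le assms by auto
  have "(?a\<^sup>2 - 1) * (?b\<^sup>2 - 1) \<le> ?a\<^sup>2 * ?b\<^sup>2"
  proof (intro mult_mono)
    show "0 \<le> ?b\<^sup>2 - 1" using ab(2) abs_square_less_1[of ?b] by auto
  qed auto
  with cs have "(lor x z + ?a * ?b)\<^sup>2 \<le> (?a * ?b)\<^sup>2" by (simp add: power_mult_distrib)
  moreover have "?a * ?b \<ge> 0" using ab by (simp add: mult_nonpos_nonpos)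
  ultimately show "- lor x z \<le> 2 * (?a * ?b)"
    using abs_le_square_iff[of "lor x z + ?a * ?b" "?a * ?b"] by linarith
qed

lemma dS_lor_self: "n \<in> dS \<Longrightarrow> lor n n = 1"
  by (simp add: dS_def)

text \<open>A crude bound for the growth of the distance to a geodesic when \<open>x\<close> moves
  to \<open>y\<close>. It follows from Cauchy-Schwarz in the plane orthogonal to \<open>x\<close>,
  applied to \<open>y\<close> and \<open>n\<close>.\<close>

lemma lor_dS_compare:
  assumes "x \<in> Hyp" "y \<in> Hyp" "n \<in> dS"
  shows "\<bar>lor y n\<bar> \<le> - lor x y * (2 * \<bar>lor x n\<bar> + 1)"
proof -
  let ?c = "- lor x y" and ?t = "lor x n"
  have c: "?c \<ge> 1" using Hyp_lor_le assms(1,2) by fastforce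
  have "(lor y n + lor y x * lor n x)\<^sup>2 \<le> (?c\<^sup>2 - 1) * (1 + ?t\<^sup>2)"
    using Hyp_Cauchy_Schwarz[OF assms(1), of y n] assms
    by (simp add: Hyp_lor_self dS_lor_self lor_commute)
  also have "\<dots> \<le> ?c\<^sup>2 * (1 + \<bar>?t\<bar>)\<^sup>2"
    by (intro mult_mono) (auto simp: power2_eq_square algebra_simps)
  finally have "(lor y n + lor y x * lor n x)\<^sup>2 \<le> (?c * (1 + \<bar>?t\<bar>))\<^sup>2" by (simp add: power_mult_distrib)
  then have "\<bar>lor y n - ?c * ?t\<bar> \<le> ?c * (1 + \<bar>?t\<bar>)"
  proof -
    assume sq: "(lor y n + lor y x * lor n x)\<^sup>2 \<le> (?c * (1 + \<bar>?t\<bar>))\<^sup>2"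
    have "0 \<le> ?c * (1 + \<bar>?t\<bar>)" using c by (intro mult_nonneg_nonneg) auto
    with abs_le_square_iff[THEN iffD2, OF sq] show ?thesis by (simp add: lor_commute)
  qed
  then have "\<bar>lor y n\<bar> \<le> \<bar>?c * ?t\<bar> + ?c * (1 + \<bar>?t\<bar>)" by linarith
  also have "\<bar>?c * ?t\<bar> = ?c * \<bar>?t\<bar>" using c by (simp add: abs_mult)
  finally show ?thesis by (simp add: algebra_simps)
qed

lemma lor_dS_crossing:
  assumes "x \<in> Hyp" "y \<in> Hyp" "n \<in> dS" "lor x n * lor y n \<le> 0"
  shows "\<bar>lor x n\<bar> \<le> - lor x y"
proof -
  let ?c = "- lor x y" and ?t = "lor x n" and ?s = "lor y n"
  have c: "?c \<ge> 1" using Hyp_lor_le assms(1,2) by fastforce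
  have cs: "(?s - ?c * ?t)\<^sup>2 \<le> (?c\<^sup>2 - 1) * (1 + ?t\<^sup>2)"
    using Hyp_Cauchy_Schwarz[OF assms(1), of y n] assms
    by (simp add: Hyp_lor_self dS_lor_self lor_commute)
  have "?c\<^sup>2 * ?t\<^sup>2 \<le> (?s - ?c * ?t)\<^sup>2 - 2 * ?c * (- (?t * ?s))"
    by (simp add: power2_eq_square algebra_simps)
  also have "\<dots> \<le> (?s - ?c * ?t)\<^sup>2"
  proof -
    have "0 \<le> ?c * (- (?t * ?s))" using c assms(4) by (intro mult_nonneg_nonneg) auto
    then have "0 \<le> 2 * ?c * (- (?t * ?s))" by (simp only: mult.assoc)
    then show ?thesis by linarith
  qed
  finally have "?t\<^sup>2 \<le> ?c\<^sup>2" using cs by (simp add: algebra_simps)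
  then show ?thesis using c abs_le_square_iff[of ?t ?c] by linarith
qed

section \<open>Geodesics and their normal vectors\<close>

text \<open>The Euclidean cross product with its last coordinate negated, which makes it orthogonal
  to both factors for \<open>lor\<close>.\<close>

definition lcross :: "real^3 \<Rightarrow> real^3 \<Rightarrow> real^3" where
  "lcross a b = vector [a$2 * b$3 - a$3 * b$2, a$3 * b$1 - a$1 * b$3, - (a$1 * b$2 - a$2 * b$1)]"

lemma lcross_nth [simp]:
  "lcross a b $ 1 = a$2 * b$3 - a$3 * b$2" "lcross a b $ 2 = a$3 * b$1 - a$1 * b$3"
  "lcross a b $ 3 = - (a$1 * b$2 - a$2 * b$1)"
  by (simp_all add: lcross_def)

lemma lor_lcross [simp]: "lor a (lcross a b) = 0" "lor b (lcross a b) = 0"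
    "lor (lcross a b) a = 0" "lor (lcross a b) b = 0"
  by (simp_all add: lor_def algebra_simps)

lemma lor_lcross_lcross: "lor (lcross a b) (lcross a b) = (lor a b)\<^sup>2 - lor a a * lor b b"
  by (simp add: lor_def power2_eq_square algebra_simps)

text \<open>A parametrized line: the null vectors \<open>u\<close>, \<open>w\<close> span its two
  ends and \<open>u + w\<close> is its base point. The value \<open>- 1/2\<close> makes
  \<open>hline u w\<close> a unit speed parametrization.\<close>

definition nullpair :: "real^3 \<Rightarrow> real^3 \<Rightarrow> bool" where
  "nullpair u w \<longleftrightarrow> lor u u = 0 \<and> lor w w = 0 \<and> lor u w = - 1/2 \<and> u + w \<in> Hyp"

definition hline :: "real^3 \<Rightarrow> real^3 \<Rightarrow> real \<Rightarrow> real^3" where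
  "hline u w t = exp t *\<^sub>R u + exp (- t) *\<^sub>R w"

lemma nullpairD:
  assumes "nullpair u w"
  shows "lor u u = 0" "lor w w = 0" "lor u w = - 1/2" "lor w u = - 1/2"
  using assms lor_commute[of w u] by (auto simp: nullpair_def)

lemma lor_hline: assumes "nullpair u w" shows "lor (hline u w s) (hline u w t) = - cosh (s - t)"
  using nullpairD[OF assms] by (simp add: hline_def cosh_def exp_minus exp_diff field_simps)

lemma hline_0 [simp]: "hline u w 0 = u + w"
  by (simp add: hline_def)

lemma hline_in_Hyp: assumes "nullpair u w" shows "hline u w t \<in> Hyp"
proof (rule HypI_lor)
  show "lor (hline u w t) (hline u w t) = - 1" by (simp add: lor_hline[OF assms])
  show "u + w \<in> Hyp" using assms by (simp add: nullpair_def)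
  show "lor (hline u w t) (u + w) < 0"
    using lor_hline[OF assms, of t 0] cosh_real_pos[of t] by simp
qed

lemma lor_hline_left: "lor (hline u w t) n = exp t * lor u n + exp (- t) * lor w n"
  by (simp add: hline_def)

definition frame :: "real^3 \<Rightarrow> real^3 \<Rightarrow> real^3 \<Rightarrow> bool" where
  "frame u w v \<longleftrightarrow> nullpair u w \<and> v \<in> dS \<and> lor u v = 0 \<and> lor w v = 0"

lemma frameD:
  assumes "frame u w v"
  shows "lor u v = 0" "lor w v = 0" "lor v u = 0" "lor v w = 0" "lor v v = 1"
    "lor u u = 0" "lor w w = 0" "lor u w = - 1/2" "lor w u = - 1/2"
  using assms lor_commute[of v u] lor_commute[of v w] lor_commute[of w u] by (auto simp: frame_def nullpair_def dS_def)

lemma frame_nullpair: "frame u w v \<Longrightarrow> nullpair u w"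
  by (simp add: frame_def)

lemma frame_orth_zero:
  assumes "frame u w v" "lor y u = 0" "lor y w = 0" "lor y v = 0"
  shows "y = 0"
proof -
  let ?z = "lcross u w"
  have zz: "lor ?z ?z = 1/4" using frameD[OF assms(1)] by (simp add: lor_lcross_lcross power2_eq_square)
  have H: "u + w \<in> Hyp" using assms(1) by (simp add: frame_def nullpair_def)
  \<comment> \<open>\<open>v\<close> and \<open>y\<close> are both multiples of the cross product \<open>?z\<close>\<close>
  have par: "x = (4 * lor x ?z) *\<^sub>R ?z" if "lor x u = 0" "lor x w = 0" for x
  proof -
    let ?x = "lcross u w" and ?d = "x - (4 * lor x ?z) *\<^sub>R ?z"
    \<comment> \<open>The Gram determinant of \<open>x\<close>, \<open>u\<close>, \<open>w\<close>
      is, up to sign, the square of \<open>lor x ?z\<close>; its terms containing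
      \<open>lor x u\<close> or \<open>lor x w\<close> vanish.\<close>
    have id: "lor x x * (lor u w)^2 - lor x x * lor u u * lor w w = (lor x ?z)^2"
      if "lor x u = 0" "lor x w = 0"
    proof -
      have "(lor x ?z)^2 = - (lor x x * (lor u u * lor w w - (lor u w)^2)
        - lor x u * (lor x u * lor w w - lor u w * lor x w) + lor x w * (lor x u * lor u w - lor u u * lor x w))"
        unfolding lor_def lcross_nth by (simp add: power2_eq_square algebra_simps)
      with that show ?thesis by (simp add: algebra_simps)
    qed
    have "lor ?d ?d = lor x x - 4 * (lor x ?z)^2"
      using zz by (simp add: power2_eq_square lor_commute)
    also have "\<dots> = 0"
      using id[OF that] frameD[OF assms(1)] by (simp add: power2_eq_square)
    finally have "lor ?d ?d = 0" .
    moreover have "lor (u + w) ?d = 0" using that by (simp add: lor_commute)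
    ultimately have "?d = 0" using orth_Hyp_null[OF H] by blast
    then show ?thesis by simp
  qed
  obtain k where y: "y = k *\<^sub>R ?z" using par[OF assms(2,3)] by blast
  obtain l where v: "v = l *\<^sub>R ?z" using par[of v] frameD[OF assms(1)] by auto
  have "l \<noteq> 0" using v frameD(5)[OF assms(1)] by auto
  with assms(4) y v zz have "k = 0" by auto
  with y show ?thesis by simp
qed

lemma frame_decomp:
  assumes "frame u w v"
  shows "x = (- 2 * lor x w) *\<^sub>R u + (- 2 * lor x u) *\<^sub>R w + lor x v *\<^sub>R v"
proof -
  have "x - ((- 2 * lor x w) *\<^sub>R u + (- 2 * lor x u) *\<^sub>R w + lor x v *\<^sub>R v) = 0"
    by (rule frame_orth_zero[OF assms]) (use frameD[OF assms] in simp_all)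
  then show ?thesis by (simp only: right_minus_eq)
qed

lemma frame_lor_decomp:
  assumes "frame u w v"
  shows "lor x y = - 2 * lor x w * lor u y - 2 * lor x u * lor w y + lor x v * lor v y"
  by (subst frame_decomp[OF assms, of x]) simp

lemma frame_lor_self:
  assumes "frame u w v"
  shows "lor x x = - 4 * (lor u x * lor w x) + (lor v x)\<^sup>2"
  using frame_lor_decomp[OF assms, of x x] by (simp add: lor_commute power2_eq_square)

lemma nullpair_frame: assumes "nullpair u w" obtains v where "frame u w v"
proof
  show "frame u w (2 *\<^sub>R lcross u w)"
    using assms nullpairD[OF assms] by (simp add: frame_def dS_def lor_lcross_lcross power2_eq_square)
qed

lemma hline_orth: "frame u w v \<Longrightarrow> lor (hline u w t) v = 0"
  by (simp add: lor_hline_left frameD)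

lemma dS_frame: assumes "v \<in> dS" obtains u w where "frame u w v"
proof -
  have v: "lor v v = 1" using assms by (simp add: dS_def)
  define k where "k = (v$1)^2 + (v$2)^2"
  have "k = 1 + (v$3)^2" using v by (simp add: k_def lor_def power2_eq_square)
  then have k: "k \<ge> 1" by simp
  \<comment> \<open>The normalized projection of the point (0, 0, 1) to the plane orthogonal to
    \<open>v\<close>.\<close>
  define p where "p = (1 / sqrt k) *\<^sub>R (vector [v$1 * v$3, v$2 * v$3, k] :: real^3)"
  have p3: "p$1 = v$1 * v$3 / sqrt k" "p$2 = v$2 * v$3 / sqrt k" "p$3 = k / sqrt k"
    by (simp_all add: p_def)
  have sk: "sqrt k * sqrt k = k" "sqrt k > 0" using k by auto
  have "p$1 * p$1 = (v$1)^2 * (v$3)^2 / k" "p$2 * p$2 = (v$2)^2 * (v$3)^2 / k" "p$3 * p$3 = k^2 / k"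
    using k by (simp_all add: p3 sk power2_eq_square ac_simps)
  then have "lor p p = ((v$1)^2 * (v$3)^2 + (v$2)^2 * (v$3)^2 - k^2) / k"
    by (simp add: lor_def diff_divide_distrib add_divide_distrib)
  also have "\<dots> = (k * (v$3)^2 - k^2) / k"
    by (simp add: k_def algebra_simps)
  also have "\<dots> = - 1"
  proof -
    have "(v$3)^2 = k - 1" using \<open>k = 1 + (v$3)^2\<close> by simp
    then have "k * (v$3)^2 - k^2 = - k" by (simp only:) (simp add: power2_eq_square algebra_simps)
    then show ?thesis using k by simp
  qed
  finally have pH: "p \<in> Hyp" using k by (simp add: Hyp_def p3)
  have pv: "lor p v = 0" using sk
    by (simp add: lor_def p3 k_def power2_eq_square algebra_simps add_divide_distrib)
  \<comment> \<open>A unit tangent vector of the geodesic at \<open>p\<close>, so that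
    \<open>p + q\<close> and \<open>p - q\<close> are null.\<close>
  define q where "q = lcross p v"
  have q: "lor q q = 1" "lor p q = 0" "lor v q = 0"
    using pv v pH by (simp_all add: q_def lor_lcross_lcross Hyp_lor_self)
  have "frame ((1/2) *\<^sub>R (p + q)) ((1/2) *\<^sub>R (p - q)) v"
  proof -
    have "(1/2) *\<^sub>R (p + q) + (1/2) *\<^sub>R (p - q) = p"
      by (simp add: vec_eq_iff field_simps)
    moreover have "lor q p = 0" "lor q v = 0" "lor v p = 0"
      using q pv by (simp_all add: lor_commute)
    ultimately show ?thesis using q pv v pH
      by (simp add: frame_def nullpair_def dS_def Hyp_lor_self)
  qed
  then show ?thesis using that by blast
qed

lemma nullpair_through:
  assumes "x \<in> Hyp" "y \<in> Hyp" "x \<noteq> y"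
  obtains u w l where "nullpair u w" "l > 0" "hline u w 0 = x" "hline u w l = y" "cosh l = - lor x y"
proof -
  let ?c = "- lor x y"
  have "lor x y \<noteq> - 1" using Hyp_lor_eqD assms by blast
  then have c: "?c > 1" using Hyp_lor_le[OF assms(1,2)] by simp
  define l where "l = arcosh ?c"
  have l: "l > 0" "cosh l = ?c" using c by (auto simp: l_def)
  define s where "s = exp l - exp (- l)"
  have s: "s > 0" using l by (simp add: s_def)
  \<comment> \<open>The solution of the linear system \<open>u + w = x\<close>,
    \<open>exp l *\<^sub>R u + exp (- l) *\<^sub>R w = y\<close>, whose determinant is
    \<open>s\<close> up to sign.\<close>
  define u w where "u = (1 / s) *\<^sub>R (y - exp (- l) *\<^sub>R x)" and "w = (1 / s) *\<^sub>R (exp l *\<^sub>R x - y)"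
  have lxy: "lor x y = - (exp l + exp (- l)) / 2" "lor y x = - (exp l + exp (- l)) / 2"
    using l(2) lor_commute[of y x] by (simp_all add: cosh_def)
  have e: "exp l * exp (- l) = 1" by (simp add: exp_minus)
  have xy: "lor x x = - 1" "lor y y = - 1" using assms by (simp_all add: Hyp_lor_self)
  have "lor u u = 0" "lor w w = 0"
    by (simp_all add: u_def w_def lxy xy algebra_simps exp_minus)
  moreover have "lor u w = - 1/2"
  proof -
    have "lor (y - exp (- l) *\<^sub>R x) (exp l *\<^sub>R x - y) = - ((exp l - exp (- l))^2) / 2"
      using e by (simp add: lxy xy power2_eq_square algebra_simps diff_divide_distrib)
    then show ?thesis using s
      by (simp add: u_def w_def s_def[symmetric] power2_eq_square del: lor_linear_left(2) lor_linear_right(2))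
  qed
  moreover have uw: "u + w = x"
  proof -
    have "u + w = (1 / s) *\<^sub>R (s *\<^sub>R x)" by (simp add: u_def w_def s_def algebra_simps)
    then show ?thesis using s by simp
  qed
  ultimately have "nullpair u w" using assms by (simp add: nullpair_def)
  moreover have "hline u w l = y"
  proof -
    have "hline u w l = (1 / s) *\<^sub>R (s *\<^sub>R y)"
      using e by (simp add: hline_def u_def w_def s_def algebra_simps)
    then show ?thesis using s by simp
  qed
  ultimately show ?thesis using that l uw by simp
qed

lemma nullpair_shift:
  assumes "nullpair u w"
  shows "nullpair (exp s *\<^sub>R u) (exp (- s) *\<^sub>R w)"
  using hline_in_Hyp[OF assms, of s] nullpairD[OF assms] by (simp add: nullpair_def hline_def exp_minus)

lemma frame_orth_unit:
  assumes "frame u w v" "n \<in> dS" "lor u n = 0" "lor w n = 0"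
  shows "n = v \<or> n = - v"
proof -
  have n: "n = lor n v *\<^sub>R v" using frame_decomp[OF assms(1), of n] assms(3,4) by (simp add: lor_commute)
  then have "lor n n = (lor n v)^2" by (metis lor_linear_right(3) power2_eq_square)
  then have "lor n v = 1 \<or> lor n v = - 1" using assms(2) by (simp add: dS_def power2_eq_1_iff)
  with n show ?thesis by (metis scaleR_one scaleR_minus1_left)
qed

lemma gd_eq_iff: assumes "n \<in> dS" "m \<in> dS" shows "gd n = gd m \<longleftrightarrow> m = n \<or> m = - n"
proof
  assume eq: "gd n = gd m"
  obtain u w where f: "frame u w n" using dS_frame assms by blast
  have "lor (hline u w t) m = 0" for t
  proof -
    have "hline u w t \<in> gd n" using f hline_in_Hyp[OF frame_nullpair[OF f]] by (simp add: gd_def hline_orth)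
    then have "hline u w t \<in> gd m" using eq by simp
    then show ?thesis by (simp add: gd_def)
  qed
  from this[of 0] this[of "ln 2"] have "lor u m + lor w m = 0" "2 * lor u m + lor w m / 2 = 0"
    by (simp_all add: lor_hline_left exp_minus)
  then have "lor u m = 0" "lor w m = 0" by simp_all
  then show "m = n \<or> m = - n" using frame_orth_unit[OF f assms(2)] by blast
qed (auto simp: gd_def)

lemma gd_uminus: "gd (- n) = gd n"
  by (simp add: gd_def)

lemma dS_uminus: "n \<in> dS \<Longrightarrow> - n \<in> dS"
  by (simp add: dS_def)

text \<open>A point orthogonal to \<open>v\<close> has two null coordinates of product 1; lying on
  the upper sheet makes them positive, so the logarithm of one of them is its parameter.\<close>

lemma frame_gd: assumes "frame u w v" shows "gd v = range (hline u w)"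
proof
  show "range (hline u w) \<subseteq> gd v"
    using assms hline_in_Hyp[OF frame_nullpair] by (auto simp: gd_def hline_orth)
  show "gd v \<subseteq> range (hline u w)"
  proof
    fix x assume "x \<in> gd v"
    then have x: "x \<in> Hyp" "lor x v = 0" by (auto simp: gd_def)
    let ?A = "- 2 * lor x u" and ?B = "- 2 * lor x w"
    have d: "x = ?B *\<^sub>R u + ?A *\<^sub>R w" using frame_decomp[OF assms, of x] x by simp
    have AB: "?A * ?B = 1"
      using frame_lor_self[OF assms, of x] x by (simp add: lor_commute Hyp_lor_self)
    have "lor x (u + w) < 0"
      using Hyp_lor_le[OF x(1), of "u + w"] assms by (simp add: frame_def nullpair_def)
    then have "?A + ?B > 0" by simp
    then have B: "?B > 0" using AB by (smt (verit) mult_nonneg_nonpos mult_nonpos_nonpos mult_pos_neg)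
    have "?A = exp (- ln ?B)" using AB B by (simp add: exp_minus field_simps)
    then have "x = hline u w (ln ?B)" using d B by (simp add: hline_def)
    then show "x \<in> range (hline u w)" by blast
  qed
qed

lemma frame_foot_point:
  assumes "frame u w v" "x \<in> Hyp"
  obtains t where "- lor x (hline u w t) = sqrt (1 + (lor x v)\<^sup>2)"
proof -
  let ?A = "- lor x u" and ?B = "- lor x w"
  have AB: "4 * (?A * ?B) = 1 + (lor x v)\<^sup>2"
    using frame_lor_self[OF assms(1), of x] assms by (simp add: lor_commute Hyp_lor_self)
  then have ABp: "?A * ?B > 0" by (smt (verit) zero_le_power2)
  have "lor x (u + w) < 0"
    using Hyp_lor_le[OF assms(2), of "u + w"] assms by (simp add: frame_def nullpair_def)
  then have "?A + ?B > 0" by simp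
  with ABp have A: "?A > 0" and B: "?B > 0"
    by (smt (verit) mult_nonneg_nonpos mult_nonpos_nonpos mult_pos_neg zero_less_mult_iff)+
  \<comment> \<open>The minimum of \<open>exp t * ?A + exp (- t) * ?B\<close>, the cosh of the
    distance from \<open>x\<close> to the point of the line at \<open>t\<close>, is attained here
    and equals \<open>2 * sqrt (?A * ?B)\<close>.\<close>
  define t where "t = ln (?B / ?A) / 2"
  have e: "exp t = sqrt (?B / ?A)"
    using powr_half_sqrt[of "?B / ?A"] A B by (simp add: t_def powr_def divide_simps)
  have e': "exp (- t) = sqrt (?A / ?B)"
    unfolding exp_minus e by (simp add: real_sqrt_divide field_simps)
  have "- lor x (hline u w t) = sqrt (?B / ?A) * ?A + sqrt (?A / ?B) * ?B"
    by (simp only: hline_def e e' lor_linear_right)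
  also have "\<dots> = 2 * sqrt (?A * ?B)"
  proof -
    have "sqrt (b / a) * a = sqrt (a * b)" if "a > 0" "b > 0" for a b :: real
      using that by (simp add: real_sqrt_divide real_sqrt_mult field_simps)
    from this[of ?A ?B] this[of ?B ?A] A B show ?thesis by (simp add: mult.commute)
  qed
  also have "\<dots> = sqrt (1 + (lor x v)\<^sup>2)"
    unfolding AB[symmetric] by (simp add: real_sqrt_mult)
  finally show ?thesis using that by blast
qed

text \<open>Restricted to the line, \<open>lor _ n\<close> is \<open>t \<mapsto> e\<^sup>t lor u n + e\<^sup>-\<^sup>t lor w n\<close>, so it vanishes
  exactly at \<open>ctime u w n\<close> when the two coefficients have opposite signs.\<close>

definition crosses :: "real^3 \<Rightarrow> real^3 \<Rightarrow> real^3 \<Rightarrow> bool" where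
  "crosses u w n \<longleftrightarrow> lor u n * lor w n < 0"

definition ctime :: "real^3 \<Rightarrow> real^3 \<Rightarrow> real^3 \<Rightarrow> real" where
  "ctime u w n = ln (- lor w n / lor u n) / 2"

lemma crosses_lor_hline:
  assumes "crosses u w n"
  shows "lor (hline u w t) n = lor u n * exp (- t) * (exp (2 * t) - exp (2 * ctime u w n))"
proof -
  have "- lor w n / lor u n > 0" using assms
    by (auto simp: crosses_def mult_less_0_iff divide_less_0_iff zero_less_divide_iff)
  then have "exp (2 * ctime u w n) = - lor w n / lor u n" by (simp add: ctime_def)
  moreover have "lor u n \<noteq> 0" using assms by (auto simp: crosses_def)
  moreover have "exp (2 * t) = exp t * exp t" by (simp add: mult_exp_exp)
  ultimately show ?thesis
    by (simp add: lor_hline_left exp_minus field_simps)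
qed

lemma crosses_iff:
  assumes "\<not> (lor u n = 0 \<and> lor w n = 0)"
  shows "crosses u w n \<longleftrightarrow> (\<exists>t. lor (hline u w t) n = 0)"
proof
  show "crosses u w n \<Longrightarrow> \<exists>t. lor (hline u w t) n = 0"
    by (intro exI[of _ "ctime u w n"]) (simp add: crosses_lor_hline)
  assume "\<exists>t. lor (hline u w t) n = 0"
  then obtain t where t: "exp t * lor u n = - (exp (- t) * lor w n)"
    by (metis add_eq_0_iff2 lor_hline_left)
  then have w: "lor w n = - (exp t * exp t) * lor u n" by (simp add: exp_minus field_simps)
  with assms have "lor u n \<noteq> 0" by auto
  then have "lor u n * lor u n > 0" by (simp add: zero_less_mult_iff) linarith
  moreover have "lor u n * lor w n = - (exp t * exp t) * (lor u n * lor u n)" by (simp add: w)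
  ultimately show "crosses u w n" unfolding crosses_def by (simp add: mult_less_0_iff)
qed

lemma crosses_zero_iff: "crosses u w n \<Longrightarrow> lor (hline u w t) n = 0 \<longleftrightarrow> t = ctime u w n"
  by (auto simp: crosses_lor_hline crosses_def)

text \<open>By \<open>crosses_lor_hline\<close> the function \<open>lor (hline u w t) n\<close>
  changes sign exactly at the crossing time; conversely a change of sign yields a zero by the
  intermediate value theorem. Excluding simultaneous zeros removes the geodesic that contains the
  segment.\<close>

lemma crossing_segment_iff:
  assumes "s < t"
  shows "lor (hline u w s) n * lor (hline u w t) n \<le> 0
      \<and> \<not> (lor (hline u w s) n = 0 \<and> lor (hline u w t) n = 0)
    \<longleftrightarrow> crosses u w n \<and> ctime u w n \<in> {s..t}"
    (is "?L \<longleftrightarrow> ?R")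
proof
  assume L: ?L
  have cont: "continuous_on {s..t} (\<lambda>r. lor (hline u w r) n)"
    unfolding lor_hline_left by (intro continuous_intros)
  have "\<exists>r\<in>{s..t}. lor (hline u w r) n = 0"
  proof (cases "lor (hline u w s) n \<le> 0")
    case True
    then have "lor (hline u w s) n = 0 \<or> 0 \<le> lor (hline u w t) n"
      using L by (smt (verit) mult_neg_neg)
    with True show ?thesis using IVT'[OF _ _ _ cont, of 0] assms by force
  next
    case False
    then have "lor (hline u w t) n \<le> 0" using L by (smt (verit) mult_pos_pos)
    with False show ?thesis using IVT2'[OF _ _ _ cont, of 0] assms by force
  qed
  then obtain r where r: "r \<in> {s..t}" "lor (hline u w r) n = 0" by blast
  have "\<not> (lor u n = 0 \<and> lor w n = 0)" using L by (auto simp: lor_hline_left)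
  with r have "crosses u w n" using crosses_iff by blast
  with r show ?R using crosses_zero_iff by auto
next
  assume R: ?R
  let ?c = "ctime u w n"
  have e: "lor (hline u w s) n * lor (hline u w t) n =
     (lor u n)\<^sup>2 * (exp (- s) * exp (- t)) * ((exp (2 * s) - exp (2 * ?c)) * (exp (2 * t) - exp (2 * ?c)))"
    using R by (simp add: crosses_lor_hline power2_eq_square)
  have "(exp (2 * s) - exp (2 * ?c)) * (exp (2 * t) - exp (2 * ?c)) \<le> 0"
    using R by (intro mult_nonpos_nonneg) auto
  then have "lor (hline u w s) n * lor (hline u w t) n \<le> 0"
    unfolding e by (rule mult_nonneg_nonpos[rotated]) simp
  moreover have "\<not> (lor (hline u w s) n = 0 \<and> lor (hline u w t) n = 0)"
    using R assms by (auto simp: crosses_zero_iff)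
  ultimately show ?L by blast
qed

section \<open>The space of geodesics\<close>

lemma gd_in_Geod [simp]: "n \<in> dS \<Longrightarrow> gd n \<in> Geod"
  by (simp add: Geod_def)

lemma GeodE: assumes "g \<in> Geod" obtains n where "n \<in> dS" "g = gd n"
  using assms by (auto simp: Geod_def)

text \<open>The generating family is already closed under finite intersections and arbitrary unions,
  so generating a topology from it adds nothing.\<close>

lemma openin_geod_top:
  "openin geod_top U \<longleftrightarrow> U \<subseteq> Geod \<and> openin (top_of_set dS) {n\<in>dS. gd n \<in> U}"
proof
  assume "openin geod_top U"
  then have "generate_topology_on {U. U \<subseteq> Geod \<and> openin (top_of_set dS) {n\<in>dS. gd n \<in> U}} U"
    by (simp add: geod_top_def openin_topology_generated_by_iff)
  then show "U \<subseteq> Geod \<and> openin (top_of_set dS) {n\<in>dS. gd n \<in> U}"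
  proof induction
    case (Int a b)
    have "{n\<in>dS. gd n \<in> a \<inter> b} = {n\<in>dS. gd n \<in> a} \<inter> {n\<in>dS. gd n \<in> b}" by auto
    with Int show ?case by auto
  next
    case (UN K)
    have "{n\<in>dS. gd n \<in> \<Union>K} = (\<Union>k\<in>K. {n\<in>dS. gd n \<in> k})" by auto
    with UN show ?case by auto
  qed auto
next
  assume "U \<subseteq> Geod \<and> openin (top_of_set dS) {n\<in>dS. gd n \<in> U}"
  then show "openin geod_top U"
    by (simp add: geod_top_def openin_topology_generated_by_iff generate_topology_on.Basis)
qed

lemma topspace_geod_top [simp]: "topspace geod_top = Geod"
proof -
  have "{n \<in> dS. gd n \<in> Geod} = dS" by auto
  then have "openin geod_top Geod" by (simp add: openin_geod_top)
  moreover have "\<And>U. openin geod_top U \<Longrightarrow> U \<subseteq> Geod" by (simp add: openin_geod_top)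
  ultimately show ?thesis by (meson openin_subset openin_topspace subset_antisym)
qed

lemma openin_geod_topE:
  assumes "openin geod_top U"
  obtains O' where "open O'" "\<And>n. n \<in> dS \<Longrightarrow> gd n \<in> U \<longleftrightarrow> n \<in> O'"
proof -
  have "openin (top_of_set dS) {n\<in>dS. gd n \<in> U}" using assms by (simp add: openin_geod_top)
  then obtain O' where O': "open O'" "{n\<in>dS. gd n \<in> U} = dS \<inter> O'" by (auto simp: openin_open)
  then have "gd n \<in> U \<longleftrightarrow> n \<in> O'" if "n \<in> dS" for n using that by blast
  with O' that show ?thesis by blast
qed

lemma continuous_map_gd: "continuous_map (top_of_set dS) geod_top gd"
  by (auto simp: continuous_map_def openin_geod_top)

lemma space_GeodM [simp]: "space GeodM = Geod"
  by (auto simp: GeodM_def openin_geod_top space_measure_of_conv)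

lemma sets_GeodM_open: "openin geod_top U \<Longrightarrow> U \<in> sets GeodM"
  unfolding GeodM_def by (subst sets_measure_of) (auto simp: openin_geod_top intro: sigma_sets.Basic)

lemma continuous_map_measurable:
  assumes "continuous_map geod_top (euclidean :: 'a::topological_space topology) f"
  shows "f \<in> borel_measurable GeodM"
proof (rule borel_measurableI)
  fix S :: "'a set" assume "open S"
  then have "openin geod_top {x \<in> topspace geod_top. f x \<in> S}"
    using assms by (simp add: continuous_map_def)
  then have "{x \<in> Geod. f x \<in> S} \<in> sets GeodM" by (simp add: sets_GeodM_open)
  moreover have "f -` S \<inter> space GeodM = {x \<in> Geod. f x \<in> S}" by auto
  ultimately show "f -` S \<inter> space GeodM \<in> sets GeodM" by simp
qed

text \<open>A Borel choice of one of the two normals, by the sign of the first nonzero coordinate;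
  the first two coordinates of an element of \<open>dS\<close> cannot both vanish. The choice is not
  continuous, so continuity is only claimed for even functions of it.\<close>

definition sect :: "(real^3) set \<Rightarrow> real^3" where
  "sect g = (SOME n. n \<in> dS \<and> gd n = g \<and> (n$1 > 0 \<or> n$1 = 0 \<and> n$2 > 0))"

lemma sect_props:
  assumes "g \<in> Geod"
  shows "sect g \<in> dS \<and> gd (sect g) = g \<and> (sect g$1 > 0 \<or> sect g$1 = 0 \<and> sect g$2 > 0)"
proof -
  obtain n where n: "n \<in> dS" "g = gd n" using assms by (rule GeodE)
  have "\<not> (n$1 = 0 \<and> n$2 = 0)"
  proof
    assume "n$1 = 0 \<and> n$2 = 0"
    then have "- (n$3 * n$3) = 1" using n by (simp add: dS_def lor_def)
    then show False using zero_le_square[of "n$3"] by linarith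
  qed
  then have "(n$1 > 0 \<or> n$1 = 0 \<and> n$2 > 0) \<or> ((-n)$1 > 0 \<or> (-n)$1 = 0 \<and> (-n)$2 > 0)"
    by auto
  then have "\<exists>m. m \<in> dS \<and> gd m = g \<and> (m$1 > 0 \<or> m$1 = 0 \<and> m$2 > 0)"
    using n gd_uminus[of n] dS_uminus[of n] by metis
  then show ?thesis unfolding sect_def by (rule someI_ex)
qed

lemma sect_in_dS [simp]: "g \<in> Geod \<Longrightarrow> sect g \<in> dS"
  and gd_sect [simp]: "g \<in> Geod \<Longrightarrow> gd (sect g) = g"
  using sect_props by blast+

lemma sect_gd: "n \<in> dS \<Longrightarrow> sect (gd n) = n \<or> sect (gd n) = - n"
  using gd_eq_iff[of n "sect (gd n)"] by (metis gd_in_Geod gd_sect sect_in_dS)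

lemma continuous_map_even:
  fixes f :: "real^3 \<Rightarrow> 'a::topological_space"
  assumes "continuous_on dS f" "\<And>n. n \<in> dS \<Longrightarrow> f (- n) = f n"
  shows "continuous_map geod_top euclidean (\<lambda>g. f (sect g))"
    and "\<And>n. n \<in> dS \<Longrightarrow> f (sect (gd n)) = f n"
proof -
  show e: "f (sect (gd n)) = f n" if "n \<in> dS" for n
    using sect_gd[OF that] assms(2)[OF that] by auto
  show "continuous_map geod_top euclidean (\<lambda>g. f (sect g))"
    unfolding continuous_map_def
  proof (intro conjI allI impI)
    fix U :: "'a set" assume "openin euclidean U"
    have "{n \<in> dS. gd n \<in> {x \<in> topspace geod_top. f (sect x) \<in> U}} = dS \<inter> f -` U"
      using e by auto
    moreover have "openin (top_of_set dS) (dS \<inter> f -` U)"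
      using assms(1) \<open>openin euclidean U\<close> continuous_openin_preimage_gen open_openin by blast
    ultimately show "openin geod_top {x \<in> topspace geod_top. f (sect x) \<in> U}"
      by (auto simp: openin_geod_top)
  qed auto
qed

lemma measurable_sect [measurable]: "sect \<in> borel_measurable GeodM"
proof -
  \<comment> \<open>Products of two coordinates are even, hence continuous on the space of
    geodesics; with the sign convention of \<open>sect\<close> they determine every
    coordinate.\<close>
  define q where "q i j g = sect g $ i * sect g $ j" for i j :: 3 and g
  have [measurable]: "q i j \<in> borel_measurable GeodM" for i j
    unfolding q_def
    by (rule continuous_map_measurable, rule continuous_map_even(1)[where f = "\<lambda>n. n $ i * n $ j"])
      (auto intro!: continuous_intros)
  have eq: "sect g $ i = (if q 1 1 g > 0 then q 1 i g / sqrt (q 1 1 g) else q 2 i g / sqrt (q 2 2 g))"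
    if "g \<in> space GeodM" for g i
  proof -
    have s: "sect g$1 > 0 \<or> sect g$1 = 0 \<and> sect g$2 > 0" using that sect_props by simp
    show ?thesis
      using s by (auto simp: q_def real_sqrt_mult zero_less_mult_iff)
  qed
  have m: "(\<lambda>g. sect g $ i) \<in> borel_measurable GeodM" for i
    by (subst measurable_cong[OF eq]) measurable
  then show ?thesis by (rule borel_measurable_vec3I)
qed

text \<open>Predicates on normals stand for sets of geodesics. For even predicates the choice of the
  normal does not matter, see \<open>gd_in_gset\<close>.\<close>

definition gset :: "(real^3 \<Rightarrow> bool) \<Rightarrow> (real^3) set set" where
  "gset P = {g\<in>Geod. P (sect g)}"

definition evenp :: "(real^3 \<Rightarrow> bool) \<Rightarrow> bool" where
  "evenp P \<longleftrightarrow> (\<forall>n. P (- n) \<longleftrightarrow> P n)"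

lemma gset_sets: assumes [measurable]: "Measurable.pred borel P" shows "gset P \<in> sets GeodM"
proof -
  have "{g \<in> space GeodM. P (sect g)} \<in> sets GeodM" by measurable
  then show ?thesis by (simp add: gset_def)
qed

lemma gd_in_gset: "evenp P \<Longrightarrow> n \<in> dS \<Longrightarrow> gd n \<in> gset P \<longleftrightarrow> P n"
  unfolding gset_def evenp_def by (metis (mono_tags, lifting) gd_in_Geod mem_Collect_eq sect_gd)

lemma gset_mono: "(\<And>n. n \<in> dS \<Longrightarrow> P n \<Longrightarrow> Q n) \<Longrightarrow> gset P \<subseteq> gset Q"
  by (auto simp: gset_def)

lemma gset_cong: "(\<And>n. n \<in> dS \<Longrightarrow> P n \<longleftrightarrow> Q n) \<Longrightarrow> gset P = gset Q"
  by (auto simp: gset_def)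

lemma crosses_uminus [simp]: "crosses u w (- n) = crosses u w n"
  by (simp add: crosses_def)

lemma ctime_uminus [simp]: "ctime u w (- n) = ctime u w n"
  by (simp add: ctime_def)

lemma measurable_crosses [measurable]: "Measurable.pred borel (crosses u w)"
  unfolding crosses_def by measurable

lemma measurable_ctime [measurable]: "ctime u w \<in> borel_measurable borel"
  unfolding ctime_def by measurable

section \<open>Isometries\<close>

lemma SOplus_lor: "a \<in> SOplus \<Longrightarrow> lor (a *v x) (a *v y) = lor x y"
  and SOplus_Hyp: "a \<in> SOplus \<Longrightarrow> x \<in> Hyp \<Longrightarrow> a *v x \<in> Hyp"
  by (auto simp: SOplus_def)

lemma SOplus_matrix_inv:
  assumes "a \<in> SOplus"
  shows "a ** matrix_inv a = mat 1" "matrix_inv a ** a = mat 1"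
proof -
  have "invertible a" using assms by (simp add: SOplus_def invertible_det_nz)
  then show "a ** matrix_inv a = mat 1" "matrix_inv a ** a = mat 1"
    unfolding atomize_conj invertible_def matrix_inv_def by (rule someI_ex)
qed

lemma SOplus_inv_mult [simp]:
  assumes "a \<in> SOplus"
  shows "a *v (matrix_inv a *v x) = x" "matrix_inv a *v (a *v x) = x"
  using SOplus_matrix_inv[OF assms] by (simp_all add: matrix_vector_mul_assoc)

lemma SOplus_lor_inv: "a \<in> SOplus \<Longrightarrow> lor (a *v x) y = lor x (matrix_inv a *v y)"
  using SOplus_lor[of a x "matrix_inv a *v y"] by simp

lemma SOplus_lor_inv': "a \<in> SOplus \<Longrightarrow> lor x (a *v y) = lor (matrix_inv a *v x) y"
  using SOplus_lor_inv[of a y x] by (simp add: lor_commute)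

text \<open>The sheet is the only difficulty. If the inverse sent a point of \<open>Hyp\<close> to
  the lower sheet, the negative of its image would be a point of \<open>Hyp\<close> that
  \<open>a\<close> sends to the lower sheet.\<close>

lemma SOplus_inv: assumes "a \<in> SOplus" shows "matrix_inv a \<in> SOplus"
proof -
  have l: "lor (matrix_inv a *v x) (matrix_inv a *v y) = lor x y" for x y
    using SOplus_lor[OF assms, of "matrix_inv a *v x" "matrix_inv a *v y"] assms by simp
  moreover have "matrix_inv a *v y \<in> Hyp" if y: "y \<in> Hyp" for y
  proof (rule ccontr)
    let ?x = "matrix_inv a *v y"
    assume "?x \<notin> Hyp"
    moreover have xx: "lor ?x ?x = - 1" using l y by (simp add: Hyp_lor_self)
    ultimately have "?x$3 \<le> 0" by (simp add: Hyp_def)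
    moreover have "?x$3 \<noteq> 0" using timelike_third_nonzero xx by simp
    ultimately have "- ?x \<in> Hyp" using xx by (simp add: Hyp_def)
    then have "a *v (- ?x) \<in> Hyp" by (rule SOplus_Hyp[OF assms])
    moreover have "a *v (- ?x) = - y" using assms by (metis SOplus_inv_mult(1) vec.neg)
    ultimately show False using y by (simp add: Hyp_def)
  qed
  moreover have "det (matrix_inv a) = 1"
  proof -
    have "det a = 1" using assms by (simp add: SOplus_def)
    then show ?thesis using arg_cong[OF SOplus_matrix_inv(1)[OF assms], of det] by (simp add: det_mul)
  qed
  ultimately show ?thesis by (auto simp: SOplus_def)
qed

lemma SOplus_dS: "a \<in> SOplus \<Longrightarrow> n \<in> dS \<Longrightarrow> a *v n \<in> dS"
  by (simp add: dS_def SOplus_lor)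

lemma gimg_gd: assumes "a \<in> SOplus" shows "gimg a (gd n) = gd (a *v n)"
proof
  show "gimg a (gd n) \<subseteq> gd (a *v n)"
    using assms by (auto simp: gimg_def gd_def SOplus_lor SOplus_Hyp)
  show "gd (a *v n) \<subseteq> gimg a (gd n)"
  proof
    fix x assume "x \<in> gd (a *v n)"
    then have "matrix_inv a *v x \<in> gd n"
      using assms SOplus_Hyp[OF SOplus_inv[OF assms]] by (auto simp: gd_def SOplus_lor_inv')
    then show "x \<in> gimg a (gd n)"
      unfolding gimg_def using assms by (metis SOplus_inv_mult(1) imageI)
  qed
qed

lemma evenp_mult: "evenp P \<Longrightarrow> evenp (\<lambda>n. P (a *v n))"
  unfolding evenp_def by (simp add: vec.neg)

lemma gimg_gset: assumes "a \<in> SOplus" "evenp P" shows "gimg a ` gset (\<lambda>n. P (a *v n)) = gset P"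
proof
  show "gimg a ` gset (\<lambda>n. P (a *v n)) \<subseteq> gset P"
  proof
    fix g assume "g \<in> gimg a ` gset (\<lambda>n. P (a *v n))"
    then obtain h where h: "h \<in> Geod" "P (a *v sect h)" "g = gimg a h" by (auto simp: gset_def)
    have "g = gd (a *v sect h)" using h gimg_gd[OF assms(1), of "sect h"] by simp
    then show "g \<in> gset P" using h assms by (simp add: gd_in_gset SOplus_dS)
  qed
  show "gset P \<subseteq> gimg a ` gset (\<lambda>n. P (a *v n))"
  proof
    fix g assume g: "g \<in> gset P"
    let ?n = "matrix_inv a *v sect g"
    have "?n \<in> dS" using g SOplus_dS SOplus_inv assms by (auto simp: gset_def)
    moreover have "P (a *v ?n)" using g assms by (simp add: gset_def)
    ultimately have "gd ?n \<in> gset (\<lambda>n. P (a *v n))" using assms by (simp add: gd_in_gset evenp_mult)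
    moreover have "gimg a (gd ?n) = g" using assms g by (simp add: gimg_gd gset_def)
    ultimately show "g \<in> gimg a ` gset (\<lambda>n. P (a *v n))" by blast
  qed
qed

lemma nullpair_image: "a \<in> SOplus \<Longrightarrow> nullpair u w \<Longrightarrow> nullpair (a *v u) (a *v w)"
  using SOplus_Hyp[of a "u + w"] by (simp add: nullpair_def SOplus_lor vec.add)

lemma frame_image: "a \<in> SOplus \<Longrightarrow> frame u w v \<Longrightarrow> frame (a *v u) (a *v w) (a *v v)"
  by (simp add: frame_def SOplus_lor nullpair_image SOplus_dS)

lemma hline_image: "a *v hline u w t = hline (a *v u) (a *v w) t"
  by (simp add: hline_def vec.add matrix_vector_mult_scaleR)

lemma crosses_image: "a \<in> SOplus \<Longrightarrow> crosses (a *v u) (a *v w) (a *v n) = crosses u w n"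
  and ctime_image: "a \<in> SOplus \<Longrightarrow> ctime (a *v u) (a *v w) (a *v n) = ctime u w n"
  by (simp_all add: crosses_def ctime_def SOplus_lor)

section \<open>Compact families of geodesics near a point, geodesics meeting a segment\<close>

definition orig :: "real^3" where "orig = vector [0, 0, 1]"

lemma orig_nth [simp]: "orig$1 = 0" "orig$2 = 0" "orig$3 = 1"
  by (simp_all add: orig_def)

lemma orig_in_Hyp: "orig \<in> Hyp"
  by (simp add: Hyp_def lor_def)

lemma lor_orig: "lor orig x = - (x$3)" "lor x orig = - (x$3)"
  by (simp_all add: lor_def)

lemma norm_real3: "(norm (x :: real^3))\<^sup>2 = (x$1)\<^sup>2 + (x$2)\<^sup>2 + (x$3)\<^sup>2"
  by (simp add: norm_eq_sqrt_inner inner_vec_def sum_3 power2_eq_square)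

lemma closed_dS: "closed dS"
  unfolding dS_def by (intro closed_Collect_eq continuous_intros)

text \<open>On \<open>dS\<close> the Euclidean norm is controlled by the third coordinate, which up
  to sign is \<open>lor orig n\<close>; \<open>lor_dS_compare\<close> moves the base point from
  \<open>x\<close> to \<open>orig\<close>.\<close>

lemma compact_dS_near:
  assumes "x \<in> Hyp"
  shows "compact {n\<in>dS. \<bar>lor x n\<bar> \<le> r}"
proof -
  have "closed (dS \<inter> {n. \<bar>lor x n\<bar> \<le> r})"
    by (intro closed_Int closed_dS closed_Collect_le continuous_intros)
  moreover have "bounded (dS \<inter> {n. \<bar>lor x n\<bar> \<le> r})"
  proof -
    let ?M = "- lor x orig * (2 * r + 1)"
    have "norm n \<le> sqrt (1 + 2 * ?M\<^sup>2)" if "n \<in> dS" "\<bar>lor x n\<bar> \<le> r" for n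
    proof -
      have "\<bar>n$3\<bar> \<le> - lor x orig * (2 * \<bar>lor x n\<bar> + 1)"
        using lor_dS_compare[OF assms orig_in_Hyp that(1)] by (simp add: lor_orig)
      also have "\<dots> \<le> ?M" using Hyp_lor_le[OF assms orig_in_Hyp] that by (intro mult_left_mono) auto
      finally have "(n$3)\<^sup>2 \<le> ?M\<^sup>2" by (simp add: abs_le_square_iff[symmetric])
      moreover have "(norm n)\<^sup>2 = 1 + 2 * (n$3)\<^sup>2"
        using that(1) unfolding norm_real3 by (simp add: dS_def lor_def power2_eq_square)
      ultimately show ?thesis by (intro real_le_rsqrt) simp
    qed
    then show ?thesis unfolding bounded_iff by blast
  qed
  moreover have "{n\<in>dS. \<bar>lor x n\<bar> \<le> r} = dS \<inter> {n. \<bar>lor x n\<bar> \<le> r}" by auto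
  ultimately show ?thesis by (simp add: compact_eq_bounded_closed)
qed

definition near :: "real^3 \<Rightarrow> real \<Rightarrow> (real^3) set set" where
  "near x r = gset (\<lambda>n. \<bar>lor x n\<bar> \<le> r)"

lemma near_eq: "near x r = gd ` {n\<in>dS. \<bar>lor x n\<bar> \<le> r}"
proof -
  have "evenp (\<lambda>n. \<bar>lor x n\<bar> \<le> r)" by (simp add: evenp_def)
  then have e: "n \<in> dS \<Longrightarrow> gd n \<in> near x r \<longleftrightarrow> \<bar>lor x n\<bar> \<le> r" for n
    unfolding near_def by (rule gd_in_gset)
  have "near x r \<subseteq> Geod" by (auto simp: near_def gset_def)
  then show ?thesis using e by (auto elim!: GeodE)
qed

lemma near_sets: "near x r \<in> sets GeodM"
  unfolding near_def by (rule gset_sets) measurable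

lemma compactin_near: "x \<in> Hyp \<Longrightarrow> compactin geod_top (near x r)"
  unfolding near_eq
  by (rule image_compactin[OF _ continuous_map_gd]) (auto simp: compactin_subtopology compact_dS_near)

lemma near_compare:
  assumes "x \<in> Hyp" "y \<in> Hyp" "- lor x y * (2 * r + 1) \<le> s"
  shows "near x r \<subseteq> near y s"
  unfolding near_def
proof (rule gset_mono)
  fix n assume n: "n \<in> dS" "\<bar>lor x n\<bar> \<le> r"
  have "\<bar>lor y n\<bar> \<le> - lor x y * (2 * \<bar>lor x n\<bar> + 1)" by (rule lor_dS_compare[OF assms(1,2) n(1)])
  also have "\<dots> \<le> - lor x y * (2 * r + 1)"
    using Hyp_lor_le[OF assms(1,2)] n by (intro mult_left_mono) auto
  finally show "\<bar>lor y n\<bar> \<le> s" using assms(3) by simp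
qed

text \<open>The geodesics that meet the segment from \<open>x\<close> to \<open>y\<close> without containing it.\<close>

definition segset :: "real^3 \<Rightarrow> real^3 \<Rightarrow> (real^3) set set" where
  "segset x y = gset (\<lambda>n. lor x n * lor y n \<le> 0 \<and> \<not> (lor x n = 0 \<and> lor y n = 0))"

lemma geod_through_eq:
  assumes "x \<in> Hyp" "y \<in> Hyp" "x \<noteq> y"
  obtains v where "v \<in> dS" "geod_through x y = gd v" "lor x v = 0" "lor y v = 0"
    "\<And>n. n \<in> dS \<Longrightarrow> lor x n = 0 \<Longrightarrow> lor y n = 0 \<Longrightarrow> gd n = gd v"
proof -
  obtain u w l where l: "nullpair u w" "l > 0" "hline u w 0 = x" "hline u w l = y"
    using nullpair_through[OF assms] by metis
  obtain v where f: "frame u w v" using nullpair_frame l by blast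
  have v: "v \<in> dS" "lor x v = 0" "lor y v = 0"
    using f hline_orth[OF f, of 0] hline_orth[OF f, of l] l by (auto simp: frame_def)
  have uniq: "gd n = gd v" if n: "n \<in> dS" "lor x n = 0" "lor y n = 0" for n
  proof -
    have "lor u n + lor w n = 0" "exp l * lor u n + exp (- l) * lor w n = 0"
      using n l lor_hline_left[of u w 0 n] lor_hline_left[of u w l n] by auto
    then have w: "lor w n = - lor u n" and "(exp l - exp (- l)) * lor u n = 0"
      by (auto simp: algebra_simps add_eq_0_iff)
    then have "lor u n = 0" using \<open>l > 0\<close> by auto
    with w have "n = v \<or> n = - v" using frame_orth_unit[OF f n(1)] by simp
    then show ?thesis by (auto simp: gd_uminus)
  qed
  have "geod_through x y = gd v"
    unfolding geod_through_def
  proof (rule the_equality)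
    show "gd v \<in> Geod \<and> x \<in> gd v \<and> y \<in> gd v" using v(2,3) assms gd_in_Geod[OF v(1)] by (simp add: gd_def)
    fix g assume "g \<in> Geod \<and> x \<in> g \<and> y \<in> g"
    then show "g = gd v" by (metis (mono_tags, lifting) GeodE gd_def mem_Collect_eq uniq)
  qed
  with v uniq that show ?thesis by blast
qed

lemma seg_open_meets:
  assumes "x \<in> Hyp" "y \<in> Hyp" "lor x n \<noteq> 0" "lor y n \<noteq> 0"
  shows "gd n \<inter> seg_open x y \<noteq> {} \<longleftrightarrow> lor x n * lor y n < 0"
proof
  assume "gd n \<inter> seg_open x y \<noteq> {}"
  then obtain a b where ab: "a > 0" "b > 0" "a * lor x n + b * lor y n = 0"
    by (auto simp: gd_def seg_open_def)
  then have "a * lor x n = - (b * lor y n)" by simp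
  show "lor x n * lor y n < 0"
  proof (rule ccontr)
    assume "\<not> lor x n * lor y n < 0"
    then have "lor x n * lor y n > 0" using assms(3,4) by (simp add: less_le)
    then have "a * lor x n * (b * lor y n) > 0"
      using ab by (smt (verit) mult.assoc mult.left_commute mult_pos_pos)
    then show False using \<open>a * lor x n = - (b * lor y n)\<close> by (simp add: mult_less_0_iff)
  qed
next
  assume neg: "lor x n * lor y n < 0"
  \<comment> \<open>The weights solve \<open>a * lor x n + b * lor y n = 0\<close>; the resulting
    vector is timelike, and scaling by \<open>k\<close> puts it on \<open>Hyp\<close>.\<close>
  define a b where "a = \<bar>lor y n\<bar>" and "b = \<bar>lor x n\<bar>"
  have ab: "a > 0" "b > 0" using assms by (auto simp: a_def b_def)
  have z0: "a * lor x n + b * lor y n = 0"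
    using neg by (auto simp: a_def b_def abs_if mult_less_0_iff)
  let ?z = "a *\<^sub>R x + b *\<^sub>R y"
  have lxy: "lor x y \<le> - 1" "lor y x \<le> - 1" using Hyp_lor_le assms by auto
  have zz: "lor ?z ?z = - (a^2 + b^2 - 2 * a * b * lor x y)"
    using assms by (simp add: Hyp_lor_self power2_eq_square lor_commute algebra_simps)
  have "a * b * lor x y \<le> 0" using ab lxy by (intro mult_nonneg_nonpos) auto
  moreover have "a^2 > 0" "b^2 > 0" using ab by auto
  ultimately have pos: "- lor ?z ?z > 0" unfolding zz by linarith
  define k where "k = 1 / sqrt (- lor ?z ?z)"
  have k: "k > 0" "k * k * lor ?z ?z = - 1"
    using pos by (auto simp: k_def simp del: lor_linear_left lor_linear_right)
  let ?p = "(k * a) *\<^sub>R x + (k * b) *\<^sub>R y"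
  have pz: "?p = k *\<^sub>R ?z" by (simp add: scaleR_right_distrib)
  have "lor ?p ?p = - 1" unfolding pz using k(2) by (simp only: lor_linear_left(3) lor_linear_right(3) mult.assoc)
  moreover have "?p$3 > 0" using k ab assms by (auto simp: Hyp_def intro!: add_pos_pos mult_pos_pos)
  ultimately have "?p \<in> Hyp" by (simp only: Hyp_def mem_Collect_eq)
  moreover have "lor ?p n = 0" unfolding pz using z0 by simp
  moreover have "\<exists>a b. a > 0 \<and> b > 0 \<and> ?p = a *\<^sub>R x + b *\<^sub>R y"
    using k(1) ab mult_pos_pos by blast
  ultimately have "?p \<in> gd n \<inter> seg_open x y"
    unfolding gd_def seg_open_def by blast
  then show "gd n \<inter> seg_open x y \<noteq> {}" by blast
qed

lemma gd_mem_iff: "x \<in> Hyp \<Longrightarrow> x \<in> gd n \<longleftrightarrow> lor x n = 0"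
  by (simp add: gd_def)

text \<open>One sign condition unifies the parts of \<open>Tclosed\<close>: strictly opposite signs
  are \<open>Topen\<close>, a single zero is \<open>Gx x\<close> or \<open>Gx y\<close>, and two
  zeros are the removed geodesic through both points.\<close>

lemma Tclosed_eq_segset:
  assumes "x \<in> Hyp" "y \<in> Hyp" "x \<noteq> y"
  shows "Tclosed x y = segset x y"
proof -
  obtain v where v: "v \<in> dS" "geod_through x y = gd v" "lor x v = 0" "lor y v = 0"
    "\<And>n. n \<in> dS \<Longrightarrow> lor x n = 0 \<Longrightarrow> lor y n = 0 \<Longrightarrow> gd n = gd v"
    using geod_through_eq[OF assms] by metis
  have ev: "evenp (\<lambda>n. lor x n * lor y n \<le> 0 \<and> \<not> (lor x n = 0 \<and> lor y n = 0))"
    by (simp add: evenp_def)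
  have "gd n \<in> Tclosed x y \<longleftrightarrow> gd n \<in> segset x y" if n: "n \<in> dS" for n
  proof -
    have through: "gd n = gd v \<longleftrightarrow> lor x n = 0 \<and> lor y n = 0"
      using v n gd_eq_iff[of v n] by (metis dS_uminus gd_mem_iff assms(1,2))
    show ?thesis
      unfolding segset_def gd_in_gset[OF ev n]
      using n assms through seg_open_meets[OF assms(1,2), of n]
      by (auto simp: Tclosed_def Topen_def Gx_def v(2) gd_mem_iff less_le)
  qed
  moreover have "Tclosed x y \<subseteq> Geod" "segset x y \<subseteq> Geod"
    by (auto simp: Tclosed_def Topen_def Gx_def segset_def gset_def)
  ultimately show ?thesis by (auto elim!: GeodE)
qed

lemma segset_sets: "segset x y \<in> sets GeodM"
  unfolding segset_def by (rule gset_sets) measurable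

lemma segset_self: "segset x x = {}"
  by (auto simp: segset_def gset_def mult_le_0_iff)

lemma segset_commute: "segset x y = segset y x"
  unfolding segset_def by (rule gset_cong) (auto simp: mult.commute)

text \<open>If the middle value is nonzero, it cannot have the same strict sign as both outer ones;
  if it is 0, a nonzero outer value gives the required pair. Counting the geodesics through the
  endpoints is what makes the triangle inequality hold without error term.\<close>

lemma segset_triangle: "segset x z \<subseteq> segset x y \<union> segset y z"
proof -
  have "segset x y \<union> segset y z = gset (\<lambda>n. lor x n * lor y n \<le> 0 \<and> \<not> (lor x n = 0 \<and> lor y n = 0)
      \<or> lor y n * lor z n \<le> 0 \<and> \<not> (lor y n = 0 \<and> lor z n = 0))"
    by (auto simp: segset_def gset_def)
  then show ?thesis
    unfolding segset_def by (simp only:) (rule gset_mono, auto simp: mult_le_0_iff)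
qed

lemma segset_near: "x \<in> Hyp \<Longrightarrow> y \<in> Hyp \<Longrightarrow> segset x y \<subseteq> near x (- lor x y)"
  unfolding segset_def near_def by (rule gset_mono) (use lor_dS_crossing in blast)

lemma d_curr_eq: "x \<in> Hyp \<Longrightarrow> y \<in> Hyp \<Longrightarrow> d_curr \<eta> x y = emeasure \<eta> (segset x y)"
  by (simp add: d_curr_def Tclosed_eq_segset segset_self)

lemma segset_hline:
  assumes "s < t"
  shows "segset (hline u w s) (hline u w t) = gset (\<lambda>n. crosses u w n \<and> ctime u w n \<in> {s..t})"
  unfolding segset_def crossing_segment_iff[OF assms] ..

section \<open>The surface group\<close>

lemma closed_Hyp: "closed Hyp"
proof -
  have "x$3 \<noteq> 0" if "lor x x = - 1" for x using timelike_third_nonzero that by simp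
  then have "Hyp = {x. lor x x = - 1} \<inter> {x. x$3 \<ge> 0}" by (fastforce simp: Hyp_def)
  moreover have "closed ({x. lor x x = - 1} \<inter> {x. x$3 \<ge> 0})"
    by (intro closed_Int closed_Collect_eq closed_Collect_le continuous_intros)
  ultimately show ?thesis by simp
qed

lemma compact_Hyp_near:
  assumes "x \<in> Hyp"
  shows "compact {k\<in>Hyp. - lor x k \<le> M}"
proof -
  have "closed (Hyp \<inter> {k. - lor x k \<le> M})"
    by (intro closed_Int closed_Hyp closed_Collect_le continuous_intros)
  moreover have "norm k \<le> sqrt (2 * (2 * (lor orig x * - M))\<^sup>2)" if k: "k \<in> Hyp" "- lor x k \<le> M" for k
  proof -
    have "k$3 \<le> 2 * (lor orig x * lor x k)"
      using lor_triangle(1)[OF orig_in_Hyp assms k(1)] by (simp add: lor_orig)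
    also have "\<dots> = 2 * (- lor orig x * - lor x k)" by simp
    also have "\<dots> \<le> 2 * (- lor orig x * M)"
      using Hyp_lor_le[OF orig_in_Hyp assms] k by (intro mult_left_mono) auto
    finally have "(k$3)\<^sup>2 \<le> (2 * (lor orig x * - M))\<^sup>2"
      using Hyp_third_pos[OF k(1)] by (intro power_mono) auto
    moreover have "(norm k)\<^sup>2 \<le> 2 * (k$3)\<^sup>2"
      using k(1) unfolding norm_real3 by (simp add: Hyp_def lor_def power2_eq_square)
    ultimately show ?thesis by (intro real_le_rsqrt) simp
  qed
  then have "bounded {k\<in>Hyp. - lor x k \<le> M}" unfolding bounded_iff by blast
  moreover have "{k\<in>Hyp. - lor x k \<le> M} = Hyp \<inter> {k. - lor x k \<le> M}" by auto
  ultimately show ?thesis by (simp add: compact_eq_bounded_closed)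
qed

text \<open>The columns are images of basis vectors: the third is a point of \<open>Hyp\<close>, the
  others are spacelike unit vectors. In either case the third coordinate controls the norm; for the
  spacelike ones it is bounded by \<open>lor_dS_compare\<close>, applied after passing to the
  inverse.\<close>

lemma norm_SOplus_column:
  assumes "a \<in> SOplus"
  shows "norm (column j a) \<le> 2 * - lor orig (a *v orig)"
proof -
  let ?e = "Finite_Cartesian_Product.axis j 1 :: real^3" and ?c = "- lor orig (a *v orig)"
  have c: "?c \<ge> 1" using Hyp_lor_le[OF orig_in_Hyp SOplus_Hyp[OF assms orig_in_Hyp]] by linarith
  have col: "column j a = a *v ?e" by (simp add: matrix_vector_mult_basis)
  have "(norm (a *v ?e))\<^sup>2 \<le> 1 + 2 * ?c\<^sup>2"
  proof (cases "j = 3")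
    case True
    then have "?e = orig" by (intro vec3_eqI) (auto simp: Finite_Cartesian_Product.axis_def)
    moreover have "(norm (a *v orig))\<^sup>2 \<le> 2 * ((a *v orig)$3)\<^sup>2"
      using SOplus_Hyp[OF assms orig_in_Hyp] unfolding norm_real3 by (simp add: Hyp_def lor_def power2_eq_square)
    ultimately show ?thesis by (simp add: lor_orig)
  next
    case False
    then have e: "?e \<in> dS" "lor orig ?e = 0"
      using exhaust_3[of j] by (auto simp: dS_def lor_def Finite_Cartesian_Product.axis_def)
    have "\<bar>lor (matrix_inv a *v orig) ?e\<bar> \<le> - lor orig (matrix_inv a *v orig) * (2 * \<bar>lor orig ?e\<bar> + 1)"
      by (rule lor_dS_compare[OF orig_in_Hyp _ e(1)]) (simp add: SOplus_Hyp SOplus_inv assms orig_in_Hyp)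
    also have "\<dots> = ?c"
      using e SOplus_lor_inv[OF assms, of orig orig] lor_commute[of orig "a *v orig"] by simp
    finally have "\<bar>(a *v ?e)$3\<bar> \<le> ?c" using assms by (simp add: SOplus_lor_inv'[symmetric] lor_orig)
    then have "((a *v ?e)$3)\<^sup>2 \<le> ?c\<^sup>2" using c abs_le_square_iff[of "(a *v ?e)$3" ?c] by linarith
    moreover have "(norm (a *v ?e))\<^sup>2 = 1 + 2 * ((a *v ?e)$3)\<^sup>2"
      using SOplus_dS[OF assms e(1)] unfolding norm_real3 by (simp add: dS_def lor_def power2_eq_square)
    ultimately show ?thesis by linarith
  qed
  also have "\<dots> \<le> (2 * ?c)\<^sup>2"
  proof -
    have "1 \<le> ?c\<^sup>2" using c by (rule one_le_power)
    then show ?thesis by (simp only: power_mult_distrib) simp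
  qed
  finally have "norm (a *v ?e) \<le> 2 * ?c" by (rule power2_le_imp_le) (use c in linarith)
  then show ?thesis by (simp only: col)
qed

lemma norm_SOplus_le:
  assumes "x \<in> Hyp"
  shows "\<exists>K\<ge>0. \<forall>a\<in>SOplus. norm a \<le> K * - lor x (a *v x)"
\<comment> \<open>Nine entries of size at most twice the displacement of \<open>orig\<close> give
  18; two uses of \<open>lor_triangle\<close> replace \<open>orig\<close> by \<open>x\<close> at the
  cost of the other factor.\<close>
proof (intro exI[of _ "18 * (4 * (lor orig x)\<^sup>2)"] conjI ballI)
  fix a assume a: "a \<in> SOplus"
  note H = orig_in_Hyp assms SOplus_Hyp[OF a orig_in_Hyp] SOplus_Hyp[OF a assms]
  have "- lor x (a *v orig) \<le> 2 * (lor x (a *v x) * lor (a *v x) (a *v orig))"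
    by (rule lor_triangle(1)[OF H(2,4,3)])
  then have 1: "- lor x (a *v orig) \<le> 2 * (- lor x (a *v x) * - lor orig x)"
    using a by (simp add: SOplus_lor lor_commute)
  have "- lor orig (a *v orig) \<le> 2 * (- lor orig x * - lor x (a *v orig))"
    using lor_triangle(1)[OF H(1,2,3)] by simp
  also have "\<dots> \<le> 2 * (- lor orig x * (2 * (- lor x (a *v x) * - lor orig x)))"
    using Hyp_lor_le[OF H(1,2)] 1 by (intro mult_left_mono) auto
  finally have 2: "- lor orig (a *v orig) \<le> 4 * (lor orig x)\<^sup>2 * - lor x (a *v x)"
    by (simp add: power2_eq_square algebra_simps)
  have "norm a \<le> (\<Sum>i\<in>(UNIV :: 3 set). norm (a$i))" unfolding norm_vec_def by (rule L2_set_le_sum) simp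
  also have "\<dots> \<le> (\<Sum>i\<in>(UNIV :: 3 set). \<Sum>j\<in>(UNIV :: 3 set). norm (a$i$j))"
    unfolding norm_vec_def[of "a$_"] by (intro sum_mono L2_set_le_sum) simp
  also have "\<dots> \<le> (\<Sum>i\<in>(UNIV :: 3 set). \<Sum>j\<in>(UNIV :: 3 set). 2 * - lor orig (a *v orig))"
  proof (intro sum_mono)
    fix i j
    have "norm (a$i$j) = \<bar>column j a $ i\<bar>" by (simp add: column_def)
    also have "\<dots> \<le> norm (column j a)" by (rule component_le_norm_cart)
    finally show "norm (a$i$j) \<le> 2 * - lor orig (a *v orig)" using norm_SOplus_column[OF a, of j] by simp
  qed
  also have "\<dots> = 18 * - lor orig (a *v orig)" by simp
  finally show "norm a \<le> 18 * (4 * (lor orig x)\<^sup>2) * - lor x (a *v x)" using 2 by simp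
qed simp

lemma bounded_SOplus:
  assumes "x \<in> Hyp"
  shows "bounded {a\<in>SOplus. - lor x (a *v x) \<le> M}"
proof -
  obtain K where K: "K \<ge> 0" "\<And>a. a \<in> SOplus \<Longrightarrow> norm a \<le> K * - lor x (a *v x)"
    using norm_SOplus_le[OF assms] by blast
  have "norm a \<le> K * M" if "a \<in> SOplus" "- lor x (a *v x) \<le> M" for a
    using K(2)[OF that(1)] mult_left_mono[OF that(2) K(1)] by linarith
  then show ?thesis unfolding bounded_iff by blast
qed

lemma continuous_on_matrix_vector_mult [continuous_intros]:
  fixes a :: "real^3^3"
  shows "continuous_on S f \<Longrightarrow> continuous_on S (\<lambda>x. a *v f x)"
  by (rule continuous_on_compose2[OF linear_continuous_on[OF matrix_vector_mul_bounded_linear]]) auto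

lemma tendsto_matrix_mult [tendsto_intros]:
  fixes a b :: "real^3^3"
  assumes "(f \<longlongrightarrow> a) F" "(g \<longlongrightarrow> b) F"
  shows "((\<lambda>x. f x ** g x) \<longlongrightarrow> a ** b) F"
  unfolding matrix_matrix_mult_def by (intro tendsto_intros assms)

lemma tendsto_matrix_vector_mult [tendsto_intros]:
  fixes a :: "real^3^3" and b :: "real^3"
  assumes "(f \<longlongrightarrow> a) F" "(g \<longlongrightarrow> b) F"
  shows "((\<lambda>x. f x *v g x) \<longlongrightarrow> a *v b) F"
  unfolding matrix_vector_mult_def by (intro tendsto_intros assms)

section \<open>Quantitative discreteness, cocompactness and freeness\<close>

locale surface =
  fixes \<Gamma> :: "(real^3^3) set" and x0 :: "real^3"
  assumes surface_group: "surface_group \<Gamma>" and x0_Hyp [simp]: "x0 \<in> Hyp"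
begin

lemma G_SOplus: "a \<in> \<Gamma> \<Longrightarrow> a \<in> SOplus"
  and G_one [simp]: "mat 1 \<in> \<Gamma>"
  and G_mult [intro, simp]: "a \<in> \<Gamma> \<Longrightarrow> b \<in> \<Gamma> \<Longrightarrow> a ** b \<in> \<Gamma>"
  and G_inv [intro, simp]: "a \<in> \<Gamma> \<Longrightarrow> matrix_inv a \<in> \<Gamma>"
  and G_free: "a \<in> \<Gamma> \<Longrightarrow> a \<noteq> mat 1 \<Longrightarrow> x \<in> Hyp \<Longrightarrow> a *v x \<noteq> x"
  using surface_group by (auto simp: surface_group_def)

lemma G_inv_right: "a \<in> \<Gamma> \<Longrightarrow> a ** matrix_inv a = mat 1"
  and G_inv_left: "a \<in> \<Gamma> \<Longrightarrow> matrix_inv a ** a = mat 1"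
  and G_inv_vec [simp]: "a \<in> \<Gamma> \<Longrightarrow> a *v (matrix_inv a *v x) = x" "a \<in> \<Gamma> \<Longrightarrow> matrix_inv a *v (a *v x) = x"
  and G_lor: "a \<in> \<Gamma> \<Longrightarrow> lor (a *v x) (a *v y) = lor x y"
  and G_Hyp [simp]: "a \<in> \<Gamma> \<Longrightarrow> x \<in> Hyp \<Longrightarrow> a *v x \<in> Hyp"
  using SOplus_matrix_inv SOplus_lor SOplus_Hyp SOplus_inv_mult G_SOplus by blast+

lemma G_lor_inv: "a \<in> \<Gamma> \<Longrightarrow> lor (a *v x) y = lor x (matrix_inv a *v y)"
  and G_lor_inv': "a \<in> \<Gamma> \<Longrightarrow> lor x (a *v y) = lor (matrix_inv a *v x) y"
  using SOplus_lor_inv SOplus_lor_inv' G_SOplus by blast+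

lemma G_eqI: assumes "a \<in> \<Gamma>" "b \<in> \<Gamma>" "x \<in> Hyp" "a *v x = b *v x" shows "a = b"
proof -
  have "(matrix_inv a ** b) *v x = x"
    using assms by (metis G_inv_vec(2) matrix_vector_mul_assoc)
  then have "matrix_inv a ** b = mat 1" using G_free[of "matrix_inv a ** b" x] assms by auto
  then have "a ** (matrix_inv a ** b) = a" by simp
  then show ?thesis using G_inv_right[OF assms(1)] by (simp add: matrix_mul_assoc)
qed

lemma cocompact: "\<exists>M\<ge>1. \<forall>x\<in>Hyp. \<exists>a\<in>\<Gamma>. - lor x (a *v x0) \<le> M"
proof -
  obtain K where K: "compact K" "K \<subseteq> Hyp" "Hyp \<subseteq> (\<Union>a\<in>\<Gamma>. (\<lambda>x. a *v x) ` K)"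
    using surface_group by (auto simp: surface_group_def)
  have "compact ((\<lambda>k. - lor k x0) ` K)"
    by (intro compact_continuous_image K continuous_intros)
  then have "bounded ((\<lambda>k. - lor k x0) ` K)" by (rule compact_imp_bounded)
  then obtain M where M: "\<And>k. k \<in> K \<Longrightarrow> \<bar>- lor k x0\<bar> \<le> M" unfolding bounded_iff by auto
  show ?thesis
  proof (intro exI[of _ "max 1 M"] conjI ballI)
    fix x assume "x \<in> Hyp"
    then obtain a k where a: "a \<in> \<Gamma>" "k \<in> K" "x = a *v k" using K(3) by blast
    then have "- lor x (a *v x0) \<le> max 1 M" using M[of k] by (simp add: G_lor)
    with a show "\<exists>a\<in>\<Gamma>. - lor x (a *v x0) \<le> max 1 M" by blast
  qed simp
qed

text \<open>The cosh of a covering radius for the orbit of \<open>x0\<close>.\<close>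

definition M0 :: real where "M0 = (SOME M. M \<ge> 1 \<and> (\<forall>x\<in>Hyp. \<exists>a\<in>\<Gamma>. - lor x (a *v x0) \<le> M))"

lemma M0: "M0 \<ge> 1" "x \<in> Hyp \<Longrightarrow> \<exists>a\<in>\<Gamma>. - lor x (a *v x0) \<le> M0"
proof -
  have "M0 \<ge> 1 \<and> (\<forall>x\<in>Hyp. \<exists>a\<in>\<Gamma>. - lor x (a *v x0) \<le> M0)"
    unfolding M0_def by (rule someI_ex[OF cocompact])
  then show "M0 \<ge> 1" "x \<in> Hyp \<Longrightarrow> \<exists>a\<in>\<Gamma>. - lor x (a *v x0) \<le> M0" by blast+
qed

text \<open>Discreteness is given as isolation of each element inside the group. An infinite bounded
  family has a subsequence converging together with its inverses, so quotients of consecutive terms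
  tend to the identity and one of them equals it, against injectivity.\<close>

lemma finite_displacement: "finite {a\<in>\<Gamma>. - lor x0 (a *v x0) \<le> M}" (is "finite ?S")
proof (rule ccontr)
  assume "infinite ?S"
  then obtain f :: "nat \<Rightarrow> real^3^3" where f: "inj f" "range f \<subseteq> ?S"
    using infinite_countable_subset by blast
  have fG: "f n \<in> \<Gamma>" "- lor x0 (f n *v x0) \<le> M" for n using f(2) by auto
  let ?B = "{a\<in>SOplus. - lor x0 (a *v x0) \<le> M}"
  have b: "bounded ?B" by (rule bounded_SOplus) simp
  have 1: "f n \<in> ?B" for n using fG G_SOplus by blast
  have 2: "matrix_inv (f n) \<in> ?B" for n
  proof -
    have "lor x0 (matrix_inv (f n) *v x0) = lor x0 (f n *v x0)"
      using G_lor_inv[OF fG(1), of n x0 x0] by (simp add: lor_commute)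
    then show ?thesis using fG[of n] SOplus_inv[OF G_SOplus] by simp
  qed
  have "bounded (range (\<lambda>n. (f n, matrix_inv (f n))))"
    by (rule bounded_subset[OF bounded_Times[OF b b]]) (use 1 2 in auto)
  then obtain l r where r: "strict_mono r" "((\<lambda>n. (f n, matrix_inv (f n))) \<circ> r) \<longlonglongrightarrow> l"
    using bounded_imp_convergent_subsequence by blast
  have A: "(\<lambda>n. f (r n)) \<longlonglongrightarrow> fst l" and B: "(\<lambda>n. matrix_inv (f (r n))) \<longlonglongrightarrow> snd l"
    using tendsto_fst[OF r(2)] tendsto_snd[OF r(2)] by (simp_all add: o_def)
  have "(\<lambda>n. matrix_inv (f (r n)) ** f (r n)) \<longlonglongrightarrow> snd l ** fst l"
    by (intro tendsto_intros A B)
  then have "snd l ** fst l = mat 1"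
    using G_inv_left[OF fG(1)] by (simp add: LIMSEQ_const_iff)
  moreover have "(\<lambda>n. matrix_inv (f (r n)) ** f (r (Suc n))) \<longlonglongrightarrow> snd l ** fst l"
    by (intro tendsto_intros B LIMSEQ_Suc[OF A])
  ultimately have lim: "(\<lambda>n. matrix_inv (f (r n)) ** f (r (Suc n))) \<longlonglongrightarrow> mat 1" by simp
  obtain e where e: "e > 0" "\<And>b. b \<in> \<Gamma> \<Longrightarrow> dist b (mat 1) < e \<Longrightarrow> b = mat 1"
    using surface_group G_one unfolding surface_group_def by metis
  obtain n where "dist (matrix_inv (f (r n)) ** f (r (Suc n))) (mat 1) < e"
    using metric_LIMSEQ_D[OF lim e(1)] by blast
  then have "matrix_inv (f (r n)) ** f (r (Suc n)) = mat 1" using e fG by blast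
  then have "f (r n) ** (matrix_inv (f (r n)) ** f (r (Suc n))) = f (r n)" by simp
  then have "f (r (Suc n)) = f (r n)" using G_inv_right[OF fG(1)] by (simp add: matrix_mul_assoc)
  then have "r (Suc n) = r n" using f(1) by (simp add: inj_eq)
  then show False using r(1) by (metis lessI less_irrefl strict_mono_def)
qed

lemma countable_G: "countable \<Gamma>"
proof -
  have "\<Gamma> = (\<Union>n. {a\<in>\<Gamma>. - lor x0 (a *v x0) \<le> real n})"
    using real_arch_simple by blast
  moreover have "countable (\<Union>n. {a\<in>\<Gamma>. - lor x0 (a *v x0) \<le> real n})"
    by (rule countable_UN[OF countableI_type countable_finite[OF finite_displacement]])
  ultimately show ?thesis by simp
qed

lemma displacement_compare:
  assumes "a \<in> \<Gamma>" "b \<in> \<Gamma>" "x \<in> Hyp" "y \<in> Hyp" "- lor x (a *v x0) \<le> r" "- lor y (b *v x0) \<le> s"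
  shows "- lor (a *v x0) (b *v x0) \<le> 4 * r * s * - lor x y"
proof -
  have l: "lor x (a *v x0) \<le> - 1" "lor y (b *v x0) \<le> - 1" "lor x y \<le> - 1"
    using assms by (auto intro: Hyp_lor_le)
  have "- lor x (b *v x0) \<le> 2 * (- lor x y * - lor y (b *v x0))"
    using lor_triangle(1)[of x y "b *v x0"] assms by simp
  also have "\<dots> \<le> 2 * (- lor x y * s)" using l assms by (intro mult_left_mono) auto
  finally have 1: "- lor x (b *v x0) \<le> 2 * (- lor x y * s)" .
  have "- lor (a *v x0) (b *v x0) \<le> 2 * (- lor x (a *v x0) * - lor x (b *v x0))"
    using lor_triangle(1)[of "a *v x0" x "b *v x0"] assms by (simp add: lor_commute)
  also have "\<dots> \<le> 2 * (r * (2 * (- lor x y * s)))"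
    using l assms 1 Hyp_lor_le[of x "b *v x0"] by (intro mult_left_mono mult_mono) auto
  finally show ?thesis by (simp add: algebra_simps)
qed

text \<open>Positive injectivity radius: once \<open>x\<close> is moved near \<open>x0\<close>, a
  short displacement leaves only finitely many elements, and each of these has a minimal
  displacement on a compact ball, positive because the action is free.\<close>

lemma uniform_displacement: "\<exists>e>0. \<forall>a\<in>\<Gamma>. a \<noteq> mat 1 \<longrightarrow> (\<forall>x\<in>Hyp. 1 + e \<le> - lor x (a *v x))"
proof -
  let ?K = "{k\<in>Hyp. - lor x0 k \<le> M0}"
  \<comment> \<open>The bound is that of \<open>displacement_compare\<close> for points within
    \<open>M0\<close> of \<open>x0\<close> and a displacement whose cosh is at most 2.\<close>
  let ?B = "{b\<in>\<Gamma>. - lor x0 (b *v x0) \<le> 8 * M0 * M0} - {mat 1}"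
  have K: "compact ?K" by (rule compact_Hyp_near) simp
  have x0K: "x0 \<in> ?K" using M0 by (simp add: Hyp_lor_self)
  have "\<forall>b\<in>?B. \<exists>m>0. \<forall>k\<in>?K. 1 + m \<le> - lor k (b *v k)"
  proof
    fix b assume b: "b \<in> ?B"
    have "continuous_on ?K (\<lambda>k. - lor k (b *v k))" by (intro continuous_intros)
    then obtain k where k: "k \<in> ?K" "\<And>k'. k' \<in> ?K \<Longrightarrow> - lor k (b *v k) \<le> - lor k' (b *v k')"
      using continuous_attains_inf[OF K] x0K by blast
    have "b *v k \<noteq> k" using b k G_free by auto
    then have "lor k (b *v k) \<noteq> - 1" using Hyp_lor_eqD[of k "b *v k"] b k by auto
    then have "- lor k (b *v k) > 1" using Hyp_lor_le[of k "b *v k"] b k by auto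
    then show "\<exists>m>0. \<forall>k\<in>?K. 1 + m \<le> - lor k (b *v k)"
      using k by (intro exI[of _ "- lor k (b *v k) - 1"]) auto
  qed
  from bchoice[OF this] obtain m where m: "\<And>b. b \<in> ?B \<Longrightarrow> m b > 0" "\<And>b k. b \<in> ?B \<Longrightarrow> k \<in> ?K \<Longrightarrow> 1 + m b \<le> - lor k (b *v k)"
    by blast
  have fin: "finite ?B" using finite_displacement by simp
  define e where "e = Min (insert 1 (m ` ?B))"
  have e: "e > 0" "e \<le> 1" "\<And>b. b \<in> ?B \<Longrightarrow> e \<le> m b"
    using fin m(1) by (auto simp: e_def)
  have "1 + e \<le> - lor x (a *v x)" if a: "a \<in> \<Gamma>" "a \<noteq> mat 1" "x \<in> Hyp" for a x
  proof (rule ccontr)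
    assume neg: "\<not> 1 + e \<le> - lor x (a *v x)"
    obtain h where h: "h \<in> \<Gamma>" "- lor x (h *v x0) \<le> M0" using M0 a by blast
    define k where "k = matrix_inv h *v x"
    define b where "b = matrix_inv h ** a ** h"
    have k: "k \<in> ?K" using h a by (auto simp: k_def G_lor_inv' lor_commute)
    have bk: "lor k (b *v k) = lor x (a *v x)"
      using h a by (simp add: k_def b_def matrix_vector_mul_assoc[symmetric] G_lor)
    have bG: "b \<in> \<Gamma>" using h a by (simp add: b_def)
    have b1: "b \<noteq> mat 1"
    proof
      assume "b = mat 1"
      then have "lor x (a *v x) = - 1" using bk k by (simp add: Hyp_lor_self)
      then have "a *v x = x" using Hyp_lor_eqD[of x "a *v x"] a by simp
      then show False using G_free a by blast
    qed
    have "- lor (mat 1 *v x0) (b *v x0) \<le> 4 * M0 * M0 * - lor k (b *v k)"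
      by (rule displacement_compare) (use k bG in \<open>auto simp: G_lor lor_commute\<close>)
    also have "\<dots> \<le> 4 * M0 * M0 * 2" using neg bk e(2) M0(1) by (intro mult_left_mono) auto
    finally have "b \<in> ?B" using bG b1 by simp
    then show False using m(2)[OF _ k] e(3) bk neg by fastforce
  qed
  with e(1) show ?thesis by blast
qed

end

section \<open>Currents\<close>

lemma Curr_sets: "\<eta> \<in> Curr \<Gamma> \<Longrightarrow> sets \<eta> = sets GeodM"
  by (simp add: Curr_def)

lemma Curr_space: "\<eta> \<in> Curr \<Gamma> \<Longrightarrow> space \<eta> = Geod"
  using sets_eq_imp_space_eq[OF Curr_sets, of \<eta> \<Gamma>] by simp

text \<open>Local finiteness plus compactness, with the finite subcover taken upstairs among the
  normals.\<close>

lemma Curr_near_finite: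
  assumes "\<eta> \<in> Curr \<Gamma>" "x \<in> Hyp"
  shows "emeasure \<eta> (near x r) < \<infinity>"
proof -
  let ?K = "{n\<in>dS. \<bar>lor x n\<bar> \<le> r}"
  have "\<forall>n\<in>?K. \<exists>UO. openin geod_top (fst UO) \<and> emeasure \<eta> (fst UO) < \<infinity> \<and> open (snd UO) \<and> n \<in> snd UO
      \<and> (\<forall>m\<in>dS. gd m \<in> fst UO \<longleftrightarrow> m \<in> snd UO)"
  proof
    fix n assume "n \<in> ?K"
    then have n: "n \<in> dS" by simp
    then have "\<exists>U. openin geod_top U \<and> gd n \<in> U \<and> emeasure \<eta> U < \<infinity>"
      using assms(1) gd_in_Geod[OF n] unfolding Curr_def by blast
    then obtain U where U: "openin geod_top U" "gd n \<in> U" "emeasure \<eta> U < \<infinity>" by blast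
    obtain O' where O': "open O'" "\<And>m. m \<in> dS \<Longrightarrow> gd m \<in> U \<longleftrightarrow> m \<in> O'"
      using openin_geod_topE[OF U(1)] by metis
    then have "n \<in> O'" using U n by blast
    with U O' show "\<exists>UO. openin geod_top (fst UO) \<and> emeasure \<eta> (fst UO) < \<infinity> \<and> open (snd UO) \<and> n \<in> snd UO
      \<and> (\<forall>m\<in>dS. gd m \<in> fst UO \<longleftrightarrow> m \<in> snd UO)"
      by (intro exI[of _ "(U, O')"]) auto
  qed
  from bchoice[OF this] obtain UO where UO': "\<forall>n\<in>?K. openin geod_top (fst (UO n)) \<and> emeasure \<eta> (fst (UO n)) < \<infinity>
      \<and> open (snd (UO n)) \<and> n \<in> snd (UO n) \<and> (\<forall>m\<in>dS. gd m \<in> fst (UO n) \<longleftrightarrow> m \<in> snd (UO n))"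
    by blast
  define U O' where "U n = fst (UO n)" and "O' n = snd (UO n)" for n
  have UO: "\<And>n. n \<in> ?K \<Longrightarrow> openin geod_top (U n)" "\<And>n. n \<in> ?K \<Longrightarrow> emeasure \<eta> (U n) < \<infinity>"
    "\<And>n. n \<in> ?K \<Longrightarrow> open (O' n)" "\<And>n. n \<in> ?K \<Longrightarrow> n \<in> O' n"
    "\<And>n m. n \<in> ?K \<Longrightarrow> m \<in> dS \<Longrightarrow> gd m \<in> U n \<longleftrightarrow> m \<in> O' n"
    using UO' unfolding U_def O'_def by blast+
  obtain D where D: "D \<subseteq> ?K" "finite D" "?K \<subseteq> (\<Union>n\<in>D. O' n)"
  proof (rule compactE_image[OF compact_dS_near[OF assms(2), of r], of ?K O'])
    show "?K \<subseteq> (\<Union>n\<in>?K. O' n)" using UO(4) by blast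
  qed (use UO(3) in blast)+
  have "near x r \<subseteq> (\<Union>n\<in>D. U n)"
  proof
    fix g assume "g \<in> near x r"
    then obtain n where n: "n \<in> ?K" "g = gd n" unfolding near_eq by blast
    then obtain m where "m \<in> D" "n \<in> O' m" using D(3) by blast
    then show "g \<in> (\<Union>n\<in>D. U n)" using UO(5)[of m n] D(1) n by auto
  qed
  moreover have s: "U n \<in> sets \<eta>" if "n \<in> D" for n
    using UO(1) D that Curr_sets[OF assms(1)] sets_GeodM_open by blast
  ultimately have "emeasure \<eta> (near x r) \<le> emeasure \<eta> (\<Union>n\<in>D. U n)"
    using D(2) by (intro emeasure_mono) auto
  also have "\<dots> \<le> (\<Sum>n\<in>D. emeasure \<eta> (U n))"
    using s D(2) by (intro emeasure_subadditive_finite) auto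
  also have "\<dots> < \<infinity>" using D UO(2) by (auto simp: less_top[symmetric] subset_iff)
  finally show ?thesis .
qed

lemma Curr_gset_sets: "\<eta> \<in> Curr \<Gamma> \<Longrightarrow> Measurable.pred borel P \<Longrightarrow> gset P \<in> sets \<eta>"
  by (simp add: Curr_sets gset_sets)

lemma measurable_matrix_mult [measurable]:
  fixes a :: "real^3^3"
  shows "(\<lambda>n. a *v n) \<in> borel_measurable borel"
  by (intro borel_measurable_continuous_onI continuous_intros)

lemma Curr_invariant:
  assumes "\<eta> \<in> Curr \<Gamma>" "a \<in> \<Gamma>" "\<Gamma> \<subseteq> SOplus" "evenp P" and P[measurable]: "Measurable.pred borel P"
  shows "emeasure \<eta> (gset (\<lambda>n. P (a *v n))) = emeasure \<eta> (gset P)"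
proof -
  have "gset (\<lambda>n. P (a *v n)) \<in> sets \<eta>"
    by (rule Curr_gset_sets[OF assms(1)]) measurable
  then have "emeasure \<eta> (gimg a ` gset (\<lambda>n. P (a *v n))) = emeasure \<eta> (gset (\<lambda>n. P (a *v n)))"
    using assms(1,2) by (simp add: Curr_def)
  then show ?thesis using gimg_gset[of a P] assms by auto
qed

text \<open>The complement of the support is a union of null open sets; describing them by open sets
  of normals in \<open>real^3\<close> gives a countable subfamily by Lindelof.\<close>

lemma Curr_null_off_supp:
  assumes "\<eta> \<in> Curr \<Gamma>" "A \<in> sets \<eta>" "A \<inter> supp \<eta> = {}"
  shows "emeasure \<eta> A = 0"
proof -
  let ?F = "{O'. open O' \<and> (\<exists>U. openin geod_top U \<and> emeasure \<eta> U = 0 \<and> (\<forall>m\<in>dS. gd m \<in> U \<longleftrightarrow> m \<in> O'))}"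
  obtain F where F: "F \<subseteq> ?F" "countable F" "\<Union>F = \<Union>?F"
    using Lindelof[of ?F] by blast
  have "\<forall>O'\<in>F. \<exists>U. openin geod_top U \<and> emeasure \<eta> U = 0 \<and> (\<forall>m\<in>dS. gd m \<in> U \<longleftrightarrow> m \<in> O')"
    using F(1) by blast
  from bchoice[OF this] obtain U where U: "\<And>O'. O' \<in> F \<Longrightarrow> openin geod_top (U O')" "\<And>O'. O' \<in> F \<Longrightarrow> emeasure \<eta> (U O') = 0"
     "\<And>O' m. O' \<in> F \<Longrightarrow> m \<in> dS \<Longrightarrow> gd m \<in> U O' \<longleftrightarrow> m \<in> O'"
    by blast
  have s: "U O' \<in> sets \<eta>" if "O' \<in> F" for O'
    using U(1)[OF that] Curr_sets[OF assms(1)] sets_GeodM_open by blast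
  have "A \<subseteq> (\<Union>O'\<in>F. U O')"
  proof
    fix g assume g: "g \<in> A"
    then have gG: "g \<in> Geod" using assms Curr_space sets.sets_into_space by blast
    then obtain n where n: "n \<in> dS" "g = gd n" by (rule GeodE)
    have "g \<notin> supp \<eta>" using g assms(3) by blast
    then obtain V where V: "openin geod_top V" "g \<in> V" "emeasure \<eta> V = 0"
      using gG by (auto simp: supp_def not_gr_zero)
    obtain O' where O': "open O'" "\<And>m. m \<in> dS \<Longrightarrow> gd m \<in> V \<longleftrightarrow> m \<in> O'"
      using openin_geod_topE[OF V(1)] by metis
    then have "O' \<in> ?F" using V by blast
    moreover have "n \<in> O'" using O'(2)[OF n(1)] V(2) n(2) by simp
    ultimately have "n \<in> \<Union>F" using F(3) by blast
    then show "g \<in> (\<Union>O'\<in>F. U O')" using U(3) n by blast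
  qed
  moreover have "(\<Union>O'\<in>F. U O') \<in> null_sets \<eta>"
    using F(2) U(2) s by (intro null_sets_UN') (auto simp: null_setsI)
  ultimately show ?thesis using assms(2) null_sets_subset null_setsD1 by blast
qed

section \<open>The pseudodistance of a current\<close>

definition ds :: "(real^3) set measure \<Rightarrow> real^3 \<Rightarrow> real^3 \<Rightarrow> real" where
  "ds \<eta> x y = measure \<eta> (segset x y)"

text \<open>Restriction comes before the pushforward because \<open>ctime\<close> has no geometric
  meaning on geodesics that do not cross the line.\<close>

definition lm :: "(real^3) set measure \<Rightarrow> real^3 \<Rightarrow> real^3 \<Rightarrow> real measure" where
  "lm \<eta> u w = distr (restrict_space \<eta> (gset (crosses u w))) borel (\<lambda>g. ctime u w (sect g))"

lemma sets_lm [simp]: "sets (lm \<eta> u w) = sets borel"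
  by (simp add: lm_def)

lemma emeasure_lm:
  assumes "\<eta> \<in> Curr \<Gamma>" "S \<in> sets borel"
  shows "emeasure (lm \<eta> u w) S = emeasure \<eta> (gset (\<lambda>n. crosses u w n \<and> ctime u w n \<in> S))"
proof -
  note [measurable_cong] = Curr_sets[OF assms(1)]
  have c: "gset (crosses u w) \<in> sets \<eta>" using assms by (simp add: Curr_gset_sets)
  have "(\<lambda>g. ctime u w (sect g)) \<in> borel_measurable \<eta>" by measurable
  then have m: "(\<lambda>g. ctime u w (sect g)) \<in> borel_measurable (restrict_space \<eta> (gset (crosses u w)))"
    by (rule measurable_restrict_space1)
  have sp: "space (restrict_space \<eta> (gset (crosses u w))) = gset (crosses u w)"
    using sets.sets_into_space[OF c] by (auto simp: space_restrict_space)
  have "emeasure (lm \<eta> u w) S = emeasure (restrict_space \<eta> (gset (crosses u w)))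
     ((\<lambda>g. ctime u w (sect g)) -` S \<inter> gset (crosses u w))"
    unfolding lm_def using emeasure_distr[OF m] assms(2) sp by simp
  also have "\<dots> = emeasure \<eta> ((\<lambda>g. ctime u w (sect g)) -` S \<inter> gset (crosses u w))"
    using c by (intro emeasure_restrict_space) auto
  also have "(\<lambda>g. ctime u w (sect g)) -` S \<inter> gset (crosses u w) = gset (\<lambda>n. crosses u w n \<and> ctime u w n \<in> S)"
    by (auto simp: gset_def)
  finally show ?thesis .
qed

lemma measure_lm:
  "\<eta> \<in> Curr \<Gamma> \<Longrightarrow> S \<in> sets borel \<Longrightarrow>
    measure (lm \<eta> u w) S = measure \<eta> (gset (\<lambda>n. crosses u w n \<and> ctime u w n \<in> S))"
  by (simp add: measure_def emeasure_lm)

lemma crosses_shift: "crosses (exp s *\<^sub>R u) (exp (- s) *\<^sub>R w) n = crosses u w n"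
  by (simp add: crosses_def exp_minus field_simps)

lemma ctime_shift: assumes "crosses u w n" shows "ctime (exp s *\<^sub>R u) (exp (- s) *\<^sub>R w) n = ctime u w n - s"
proof -
  have p: "- lor w n / lor u n > 0" using assms
    by (auto simp: crosses_def mult_less_0_iff divide_less_0_iff zero_less_divide_iff)
  have "- lor (exp (- s) *\<^sub>R w) n / lor (exp s *\<^sub>R u) n = exp (- (2 * s)) * (- lor w n / lor u n)"
    by (simp add: exp_minus field_simps exp_add[symmetric] mult_exp_exp)
  then have "ln (- lor (exp (- s) *\<^sub>R w) n / lor (exp s *\<^sub>R u) n) = - (2 * s) + ln (- lor w n / lor u n)"
    using p by (simp only: ln_mult_pos exp_gt_zero) simp
  then show ?thesis by (simp add: ctime_def)
qed

lemma emeasure_lm_shift: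
  assumes "\<eta> \<in> Curr \<Gamma>" and S[measurable]: "S \<in> sets borel"
  shows "emeasure (lm \<eta> (exp s *\<^sub>R u) (exp (- s) *\<^sub>R w)) S = emeasure (lm \<eta> u w) {t. t - s \<in> S}"
proof -
  have "{t \<in> space borel. t - s \<in> S} \<in> sets borel" by measurable
  then have m: "{t. t - s \<in> S} \<in> sets borel" by simp
  show ?thesis
    unfolding emeasure_lm[OF assms(1) m] emeasure_lm[OF assms]
    by (intro arg_cong[where f = "emeasure \<eta>"] gset_cong) (auto simp: crosses_shift ctime_shift)
qed

context surface
begin

lemma G_subset: "\<Gamma> \<subseteq> SOplus"
  using G_SOplus by blast

text \<open>Bounds the measure of \<open>near x r\<close> uniformly in \<open>x\<close>: moving
  \<open>x\<close> to an orbit point within \<open>M0\<close> enlarges the radius as in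
  \<open>near_compare\<close>, and invariance moves that point to \<open>x0\<close>.\<close>

definition mass :: "(real^3) set measure \<Rightarrow> real \<Rightarrow> real" where
  "mass \<eta> r = measure \<eta> (near x0 (M0 * (2 * r + 1)))"

lemma near_fmeasurable: "\<eta> \<in> Curr \<Gamma> \<Longrightarrow> x \<in> Hyp \<Longrightarrow> near x r \<in> fmeasurable \<eta>"
  using Curr_near_finite[of \<eta> \<Gamma> x r] by (simp add: fmeasurable_def Curr_sets near_sets)

lemma emeasure_near_image:
  assumes "\<eta> \<in> Curr \<Gamma>" "a \<in> \<Gamma>"
  shows "emeasure \<eta> (near (a *v x) r) = emeasure \<eta> (near x r)"
proof -
  have "emeasure \<eta> (gset (\<lambda>n. \<bar>lor (a *v x) (a *v n)\<bar> \<le> r)) = emeasure \<eta> (gset (\<lambda>n. \<bar>lor (a *v x) n\<bar> \<le> r))"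
    by (rule Curr_invariant[OF assms G_subset]) (simp_all add: evenp_def)
  then show ?thesis using assms by (simp add: near_def G_lor)
qed

lemma measure_near_le:
  assumes "\<eta> \<in> Curr \<Gamma>" "x \<in> Hyp" "r \<ge> 0"
  shows "measure \<eta> (near x r) \<le> mass \<eta> r"
proof -
  obtain a where a: "a \<in> \<Gamma>" "- lor x (a *v x0) \<le> M0" using M0 assms by blast
  have "near x r \<subseteq> near (a *v x0) (M0 * (2 * r + 1))"
    by (rule near_compare) (use a assms mult_right_mono[OF a(2), of "2 * r + 1"] in auto)
  then have "measure \<eta> (near x r) \<le> measure \<eta> (near (a *v x0) (M0 * (2 * r + 1)))"
    using assms a by (intro measure_mono_fmeasurable near_fmeasurable) (auto simp: Curr_sets near_sets)
  also have "\<dots> = mass \<eta> r" using emeasure_near_image[OF assms(1) a(1)] by (simp add: mass_def measure_def)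
  finally show ?thesis .
qed

lemma subset_near_fmeasurable:
  assumes "\<eta> \<in> Curr \<Gamma>" "x \<in> Hyp" "A \<subseteq> near x r" "A \<in> sets GeodM"
  shows "A \<in> fmeasurable \<eta>"
  using fmeasurableI2[OF near_fmeasurable[OF assms(1,2)] assms(3)] assms by (simp add: Curr_sets)

lemma segset_fmeasurable: "\<eta> \<in> Curr \<Gamma> \<Longrightarrow> x \<in> Hyp \<Longrightarrow> y \<in> Hyp \<Longrightarrow> segset x y \<in> fmeasurable \<eta>"
  using subset_near_fmeasurable segset_near segset_sets by blast

lemma d_curr_ds: "\<eta> \<in> Curr \<Gamma> \<Longrightarrow> x \<in> Hyp \<Longrightarrow> y \<in> Hyp \<Longrightarrow> d_curr \<eta> x y = ennreal (ds \<eta> x y)"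
  using segset_fmeasurable[of \<eta> x y] by (simp add: d_curr_eq ds_def emeasure_eq_measure2)

lemma ds_nonneg [simp]: "ds \<eta> x y \<ge> 0"
  by (simp add: ds_def)

lemma ds_commute: "ds \<eta> x y = ds \<eta> y x"
  by (simp add: ds_def segset_commute)

lemma ds_triangle:
  assumes "\<eta> \<in> Curr \<Gamma>" "x \<in> Hyp" "y \<in> Hyp" "z \<in> Hyp"
  shows "ds \<eta> x z \<le> ds \<eta> x y + ds \<eta> y z"
proof -
  have "ds \<eta> x z \<le> measure \<eta> (segset x y \<union> segset y z)"
    unfolding ds_def using segset_triangle segset_fmeasurable assms
    by (intro measure_mono_fmeasurable fmeasurable.Un) (auto simp: Curr_sets segset_sets)
  also have "\<dots> \<le> ds \<eta> x y + ds \<eta> y z"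
    unfolding ds_def using assms by (intro measure_Un_le) (auto simp: Curr_sets segset_sets)
  finally show ?thesis .
qed

lemma ds_invariant:
  assumes "\<eta> \<in> Curr \<Gamma>" "a \<in> \<Gamma>"
  shows "ds \<eta> (a *v x) (a *v y) = ds \<eta> x y"
proof -
  let ?P = "\<lambda>n. lor (a *v x) n * lor (a *v y) n \<le> 0 \<and> \<not> (lor (a *v x) n = 0 \<and> lor (a *v y) n = 0)"
  have "emeasure \<eta> (gset (\<lambda>n. ?P (a *v n))) = emeasure \<eta> (gset ?P)"
    by (rule Curr_invariant[OF assms G_subset]) (simp_all add: evenp_def)
  then show ?thesis using assms by (simp add: ds_def segset_def G_lor measure_def)
qed

lemma ds_le_mass:
  assumes "\<eta> \<in> Curr \<Gamma>" "x \<in> Hyp" "y \<in> Hyp" "- lor x y \<le> M"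
  shows "ds \<eta> x y \<le> mass \<eta> M"
proof -
  have "1 \<le> - lor x y" using Hyp_lor_le[of x y] assms by simp
  then have M: "M \<ge> 0" using assms by linarith
  have "segset x y \<subseteq> near x M"
    using segset_near[OF assms(2,3)] assms(4) unfolding near_def gset_def by force
  then have "ds \<eta> x y \<le> measure \<eta> (near x M)"
    unfolding ds_def using assms by (intro measure_mono_fmeasurable near_fmeasurable) (auto simp: Curr_sets segset_sets)
  also have "\<dots> \<le> mass \<eta> M" using measure_near_le assms M by blast
  finally show ?thesis .
qed

lemma mass_mono: "\<eta> \<in> Curr \<Gamma> \<Longrightarrow> r \<le> s \<Longrightarrow> mass \<eta> r \<le> mass \<eta> s"
  unfolding mass_def using M0(1)
  by (intro measure_mono_fmeasurable near_fmeasurable)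
    (auto simp: Curr_sets near_sets, auto simp: near_def gset_def intro: order_trans[OF _ mult_left_mono])

lemma mass_nonneg [simp]: "mass \<eta> r \<ge> 0"
  by (simp add: mass_def)

lemma ds_hline:
  assumes "\<eta> \<in> Curr \<Gamma>" "s < t"
  shows "ds \<eta> (hline u w s) (hline u w t) = measure (lm \<eta> u w) {s..t}"
  using assms by (simp add: ds_def segset_hline measure_lm)

lemma lm_fmeasurable:
  assumes "\<eta> \<in> Curr \<Gamma>" "nullpair u w" "S \<in> sets borel" "S \<subseteq> {s..t}"
  shows "S \<in> fmeasurable (lm \<eta> u w)"
proof -
  have H: "hline u w x \<in> Hyp" for x using assms(2) by (rule hline_in_Hyp)
  \<comment> \<open>The right end is enlarged so that the interval is nondegenerate, as
    \<open>segset_hline\<close> requires, whatever the order of \<open>s\<close> and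
    \<open>t\<close>.\<close>
  have "emeasure (lm \<eta> u w) {s..t+1+\<bar>s\<bar>+\<bar>t\<bar>} < \<infinity>"
    using segset_fmeasurable[OF assms(1) H H, of s "t+1+\<bar>s\<bar>+\<bar>t\<bar>"] segset_hline[of s "t+1+\<bar>s\<bar>+\<bar>t\<bar>" u w]
    by (simp add: emeasure_lm[OF assms(1)] fmeasurable_def)
  then have "{s..t+1+\<bar>s\<bar>+\<bar>t\<bar>} \<in> fmeasurable (lm \<eta> u w)" by (simp add: fmeasurable_def)
  then show ?thesis
    by (rule fmeasurableI2) (use assms in \<open>auto dest!: subsetD\<close>)
qed

lemma measure_lm_split:
  assumes "\<eta> \<in> Curr \<Gamma>" "nullpair u w" "r \<le> s" "s \<le> t"
  shows "measure (lm \<eta> u w) {r..<t} = measure (lm \<eta> u w) {r..<s} + measure (lm \<eta> u w) {s..<t}"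
proof -
  have "{r..<s} \<in> fmeasurable (lm \<eta> u w)" by (rule lm_fmeasurable[OF assms(1,2), of _ r s]) auto
  moreover have "{s..<t} \<in> fmeasurable (lm \<eta> u w)" by (rule lm_fmeasurable[OF assms(1,2), of _ s t]) auto
  ultimately have "measure (lm \<eta> u w) ({r..<s} \<union> {s..<t}) = measure (lm \<eta> u w) {r..<s} + measure (lm \<eta> u w) {s..<t}"
    by (subst measure_Un3) auto
  then show ?thesis using assms(3,4) by (simp only: ivl_disj_un_two(3))
qed

text \<open>An atom of the crossing time at \<open>t\<close> is carried by geodesics through the
  point at \<open>t\<close>. This bounds the difference between closed and half-open
  segments.\<close>

lemma lm_point:
  assumes "\<eta> \<in> Curr \<Gamma>" "nullpair u w"
  shows "measure (lm \<eta> u w) {t} \<le> mass \<eta> 0"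
proof -
  have "measure (lm \<eta> u w) {t} \<le> measure \<eta> (near (hline u w t) 0)"
    unfolding measure_lm[OF assms(1) borel_singleton[OF sets.empty_sets]]
    using assms hline_in_Hyp[OF assms(2)]
    by (intro measure_mono_fmeasurable near_fmeasurable Curr_gset_sets)
      (auto simp: near_def gset_def crosses_zero_iff)
  also have "\<dots> \<le> mass \<eta> 0" using assms hline_in_Hyp[OF assms(2)] by (intro measure_near_le) auto
  finally show ?thesis .
qed

lemma emeasure_lm_image:
  assumes "\<eta> \<in> Curr \<Gamma>" "a \<in> \<Gamma>" and S[measurable]: "S \<in> sets borel"
  shows "emeasure (lm \<eta> (a *v u) (a *v w)) S = emeasure (lm \<eta> u w) S"
proof -
  let ?P = "\<lambda>n. crosses (a *v u) (a *v w) n \<and> ctime (a *v u) (a *v w) n \<in> S"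
  have "emeasure \<eta> (gset (\<lambda>n. ?P (a *v n))) = emeasure \<eta> (gset ?P)"
    by (rule Curr_invariant[OF assms(1,2) G_subset]) (simp_all add: evenp_def)
  then show ?thesis using assms G_SOplus by (simp add: emeasure_lm crosses_image ctime_image)
qed

end

section \<open>Axes\<close>

text \<open>The adjoint for \<open>lor\<close> is the transpose conjugated by the diagonal matrix of
  the form, and both operations preserve the determinant.\<close>

lemma det_lor_adjoint:
  fixes A B :: "real^3^3"
  assumes "\<And>x y. lor (A *v x) y = lor x (B *v y)"
  shows "det A = det B"
proof -
  have e: "(C *v Finite_Cartesian_Product.axis i 1) $ k = C$k$i" for C :: "real^3^3" and i k
    by (simp add: matrix_vector_mult_basis column_def)
  have [simp]: "Finite_Cartesian_Product.axis i 1 $ k = (if k = i then 1 else (0::real))" for i k :: 3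
    by (simp add: Finite_Cartesian_Product.axis_def)
  have "lor (A *v Finite_Cartesian_Product.axis i 1) (Finite_Cartesian_Product.axis j 1)
      = lor (Finite_Cartesian_Product.axis i 1) (B *v Finite_Cartesian_Product.axis j 1)" for i j
    by (rule assms)
  note h = this[unfolded lor_def e]
  have "B$1$1 = A$1$1" "B$1$2 = A$2$1" "B$1$3 = - A$3$1" "B$2$1 = A$1$2" "B$2$2 = A$2$2" "B$2$3 = - A$3$2"
    "B$3$1 = - A$1$3" "B$3$2 = - A$2$3" "B$3$3 = A$3$3"
    using h[of 1 1] h[of 1 2] h[of 1 3] h[of 2 1] h[of 2 2] h[of 2 3] h[of 3 1] h[of 3 2] h[of 3 3]
    by simp_all
  then show ?thesis by (simp add: det_3)
qed

text \<open>The adjoint of \<open>a - mat 1\<close> is \<open>matrix_inv a ** (mat 1 - a)\<close>,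
  which in odd dimension has determinant \<open>- det (a - mat 1)\<close>. So this determinant
  vanishes.\<close>

lemma SOplus_fixed_vector: assumes "a \<in> SOplus" obtains v where "v \<noteq> 0" "a *v v = v"
proof -
  let ?A = "a - mat 1" and ?B = "matrix_inv a ** (mat 1 - a)"
  have "lor (?A *v x) y = lor x (?B *v y)" for x y
    using assms
    by (simp add: matrix_vector_mul_assoc[symmetric] matrix_vector_mult_diff_rdistrib
        matrix_vector_mult_diff_distrib SOplus_lor_inv)
  then have "det ?A = det ?B" by (rule det_lor_adjoint)
  also have "\<dots> = det (mat 1 - a)" using SOplus_inv[OF assms] by (simp add: det_mul SOplus_def)
  also have "\<dots> = - det ?A" by (simp add: det_3 algebra_simps)
  finally have "det ?A = 0" by simp
  then have "\<not> invertible ?A" by (simp add: invertible_det_nz)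
  then have "\<not> (\<forall>x. ?A *v x = 0 \<longrightarrow> x = 0)"
    by (simp add: invertible_left_inverse matrix_left_invertible_ker)
  then obtain v where "v \<noteq> 0" "?A *v v = 0" by blast
  then have "v \<noteq> 0" "a *v v = v" by (simp_all add: matrix_vector_mult_diff_rdistrib)
  then show ?thesis by (rule that)
qed

text \<open>Normal form of a hyperbolic element: translation by \<open>l\<close> along the line,
  with attracting end \<open>u\<close>. The base point on the axis remains free.\<close>

definition haxis :: "real^3^3 \<Rightarrow> real^3 \<Rightarrow> real^3 \<Rightarrow> real^3 \<Rightarrow> real \<Rightarrow> bool" where
  "haxis a u w v l \<longleftrightarrow> frame u w v \<and> l > 0 \<and> a *v u = exp l *\<^sub>R u \<and> a *v w = exp (- l) *\<^sub>R w \<and> a *v v = v"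

lemma haxis_hline: "haxis a u w v l \<Longrightarrow> a *v hline u w t = hline u w (t + l)"
  by (simp add: haxis_def hline_image) (simp add: hline_def exp_add exp_diff exp_minus field_simps)

lemma haxis_frame: "haxis a u w v l \<Longrightarrow> frame u w v"
  and haxis_pos: "haxis a u w v l \<Longrightarrow> l > 0"
  by (simp_all add: haxis_def)

text \<open>Here \<open>lor x v\<close> is the signed sinh of the distance from \<open>x\<close> to
  the axis. Read backwards, an element whose displacement at \<open>x\<close> is comparable to
  \<open>cosh l\<close> has its axis near \<open>x\<close>, provided \<open>l\<close> is bounded
  below.\<close>

lemma haxis_displacement:
  assumes "haxis a u w v l" "x \<in> Hyp"
  shows "- lor x (a *v x) = (1 + (lor x v)\<^sup>2) * cosh l - (lor x v)\<^sup>2"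
proof -
  note f = haxis_frame[OF assms(1)]
  have ax: "a *v x = (- 2 * lor x w * exp l) *\<^sub>R u + (- 2 * lor x u * exp (- l)) *\<^sub>R w + lor x v *\<^sub>R v"
    using assms(1) by (subst frame_decomp[OF f, of x])
      (simp add: haxis_def vec.add vec.diff vec.neg matrix_vector_mult_scaleR)
  have "1 + (lor x v)\<^sup>2 = 4 * (lor x u * lor x w)"
    using frame_lor_self[OF f, of x] assms by (simp add: lor_commute Hyp_lor_self)
  then show ?thesis unfolding ax
    by (simp add: cosh_def power2_eq_square algebra_simps)
qed

text \<open>The eigenvalues are \<open>exp l\<close>, \<open>exp (- l)\<close> and 1; the trace is
  evaluated by expanding the basis vectors in the frame.\<close>

lemma haxis_trace:
  assumes "haxis a u w v l"
  shows "trace a = 1 + 2 * cosh l"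
proof -
  note f = haxis_frame[OF assms]
  let ?e = "\<lambda>i. Finite_Cartesian_Product.axis i 1 :: real^3"
  have c: "a $ k $ i = - 2 * lor (?e i) w * exp l * u $ k - 2 * lor (?e i) u * exp (- l) * w $ k
      + lor (?e i) v * v $ k" for i k
  proof -
    have "a $ k $ i = (a *v ?e i) $ k" by (simp add: matrix_vector_mult_basis column_def)
    also have "a *v ?e i = (- 2 * lor (?e i) w * exp l) *\<^sub>R u + (- 2 * lor (?e i) u * exp (- l)) *\<^sub>R w
        + lor (?e i) v *\<^sub>R v"
      using assms by (subst frame_decomp[OF f, of "?e i"])
        (simp add: haxis_def vec.add vec.diff vec.neg matrix_vector_mult_scaleR)
    finally show ?thesis by simp
  qed
  have s: "lor (?e 1) x * y $ 1 + lor (?e 2) x * y $ 2 + lor (?e 3) x * y $ 3 = lor x y" for x y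
    by (simp add: lor_def Finite_Cartesian_Product.axis_def)
  have "trace a = - 2 * exp l * (lor (?e 1) w * u $ 1 + lor (?e 2) w * u $ 2 + lor (?e 3) w * u $ 3)
     - 2 * exp (- l) * (lor (?e 1) u * w $ 1 + lor (?e 2) u * w $ 2 + lor (?e 3) u * w $ 3)
     + (lor (?e 1) v * v $ 1 + lor (?e 2) v * v $ 2 + lor (?e 3) v * v $ 3)"
    unfolding trace_def sum_3 c by (simp add: algebra_simps)
  then show ?thesis unfolding s using frameD[OF f] by (simp add: cosh_def)
qed

text \<open>Pairing with the eigenvectors \<open>u\<close> and \<open>w\<close> shows that a vector
  fixed up to sign is orthogonal to both ends. This is the uniqueness behind the \<open>THE\<close>
  in \<open>axis\<close>.\<close>

lemma haxis_fixed_normal: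
  assumes "haxis a u w v l" "a \<in> SOplus" "m \<in> dS" "a *v m = m \<or> a *v m = - m"
  shows "gd m = gd v"
proof -
  note f = haxis_frame[OF assms(1)]
  have e: "exp (- l) < 1" "exp l > 1" using haxis_pos[OF assms(1)] by auto
  have "lor (a *v m) (a *v w) = lor m w" "lor (a *v m) (a *v u) = lor m u"
    using assms(2) by (simp_all add: SOplus_lor)
  then have "exp (- l) * lor (a *v m) w = lor m w" "exp l * lor (a *v m) u = lor m u"
    using assms(1) by (simp_all add: haxis_def)
  moreover have "z = 0" if "c * z = z \<or> c * - z = z" "c > 0" "c \<noteq> 1" for c z :: real
  proof -
    have "(c - 1) * z = 0 \<or> (c + 1) * z = 0" using that(1) by (auto simp: algebra_simps)
    then show ?thesis using that by auto
  qed
  ultimately have "lor m w = 0" "lor m u = 0"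
    using assms(4) e by (metis exp_gt_zero lor_linear_left(4) less_irrefl)+
  then have "m = v \<or> m = - v" using frame_orth_unit[OF f assms(3)] by (simp add: lor_commute)
  then show ?thesis by (auto simp: gd_uminus)
qed

lemma axis_haxis:
  assumes "haxis a u w v l" "a \<in> SOplus"
  shows "axis a = gd v"
  unfolding axis_def
proof (rule the_equality)
  have v: "v \<in> dS" "a *v v = v" using assms(1) by (auto simp: haxis_def frame_def)
  then show "gd v \<in> Geod \<and> gimg a (gd v) = gd v" using assms by (simp add: gimg_gd)
  fix g assume g: "g \<in> Geod \<and> gimg a g = g"
  then obtain m where m: "m \<in> dS" "g = gd m" by (auto elim: GeodE)
  then have "gd (a *v m) = gd m" using g assms by (simp add: gimg_gd)
  then have "a *v m = m \<or> a *v m = - m" using m assms SOplus_dS gd_eq_iff[of m "a *v m"] by auto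
  then show "g = gd v" using haxis_fixed_normal[OF assms m(1)] m by simp
qed

context surface
begin

definition e0 :: real where
  "e0 = (SOME e. e > 0 \<and> (\<forall>a\<in>\<Gamma>. a \<noteq> mat 1 \<longrightarrow> (\<forall>x\<in>Hyp. 1 + e \<le> - lor x (a *v x))))"

lemma e0: "e0 > 0" "a \<in> \<Gamma> \<Longrightarrow> a \<noteq> mat 1 \<Longrightarrow> x \<in> Hyp \<Longrightarrow> 1 + e0 \<le> - lor x (a *v x)"
proof -
  have "e0 > 0 \<and> (\<forall>a\<in>\<Gamma>. a \<noteq> mat 1 \<longrightarrow> (\<forall>x\<in>Hyp. 1 + e0 \<le> - lor x (a *v x)))"
    unfolding e0_def by (rule someI_ex) (rule uniform_displacement)
  then show "e0 > 0" "a \<in> \<Gamma> \<Longrightarrow> a \<noteq> mat 1 \<Longrightarrow> x \<in> Hyp \<Longrightarrow> 1 + e0 \<le> - lor x (a *v x)" by blast+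
qed

text \<open>Moving \<open>x0\<close> towards a fixed null direction makes the displacement arbitrarily small, so
  a cocompact group contains no parabolic element.\<close>

lemma no_null_fixed:
  assumes "a \<in> \<Gamma>" "a \<noteq> mat 1" "lor v v = 0" "v \<noteq> 0" "a *v v = v"
  shows False
proof -
  have main: False if v: "lor v v = 0" "a *v v = v" "lor x0 v < 0" for v
  proof -
    define A c where "A = - lor x0 (a *v x0)" and "c = lor x0 v"
    have A: "A \<ge> 1" using Hyp_lor_le[of x0 "a *v x0"] assms by (simp add: A_def)
    have c: "c < 0" using v by (simp add: c_def)
    \<comment> \<open>After normalization, the displacement of \<open>x0 + t *\<^sub>R v\<close> has
      cosh \<open>(A + s) / (1 + s)\<close>, which tends to 1 as \<open>s\<close> grows;
      \<open>s = A / e0\<close> already contradicts the lower bound \<open>1 + e0\<close>.\<close>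
    define s where "s = A / e0"
    have s: "s > 0" using A e0 by (simp add: s_def)
    define t where "t = - s / (2 * c)"
    have t: "t > 0" "2 * t * c = - s" using s c by (simp_all add: t_def divide_pos_neg)
    define k where "k = 1 / sqrt (1 + s)"
    have k: "k > 0" "k * k = 1 / (1 + s)" using s by (simp_all add: k_def)
    let ?z = "x0 + t *\<^sub>R v"
    let ?y = "k *\<^sub>R ?z"
    have vc: "lor v x0 = c" "lor x0 v = c" by (simp_all add: c_def lor_commute)
    have avc: "lor v (a *v x0) = c" using SOplus_lor[OF G_SOplus[OF assms(1)], of v x0] v vc by simp
    have zz: "lor ?z ?z = - (1 + s)" using v vc t by (simp add: Hyp_lor_self mult.commute)
    have yy: "lor ?y ?y = - 1"
    proof -
      have "lor ?y ?y = k * k * lor ?z ?z" by (simp only: lor_linear_left(3) lor_linear_right(3) mult.assoc)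
      also have "\<dots> = - (1 / (1 + s) * (1 + s))" unfolding zz k by (simp only: mult_minus_right)
      also have "\<dots> = - 1" using s by simp
      finally show ?thesis .
    qed
    have "lor ?y x0 = k * (- 1 + t * c)" using vc by (simp add: Hyp_lor_self)
    moreover have "t * c < 0" using t c by (simp add: mult_pos_neg)
    ultimately have "lor ?y x0 < 0" using k by (simp add: mult_pos_neg)
    then have "?y \<in> Hyp" using yy HypI_lor[of ?y x0] by simp
    then have "1 + e0 \<le> - lor ?y (a *v ?y)" using e0 assms by blast
    also have "lor ?y (a *v ?y) = k * k * lor ?z (a *v ?z)"
      by (simp only: matrix_vector_mult_scaleR lor_linear_left(3) lor_linear_right(3) mult.assoc)
    also have "lor ?z (a *v ?z) = - (A + s)"
      using v t vc avc by (simp add: vec.add matrix_vector_mult_scaleR A_def algebra_simps)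
    finally have "1 + e0 \<le> - (1 / (1 + s) * - (A + s))" by (simp only: k(2))
    then have "1 + e0 \<le> (A + s) / (1 + s)" by (simp only: mult_minus_right minus_minus times_divide_eq_left mult_1)
    then have "(1 + e0) * (1 + s) \<le> A + s" using s by (simp add: pos_le_divide_eq)
    then have "e0 * s + e0 + 1 \<le> A" by (simp add: algebra_simps)
    moreover have "e0 * s = A" using e0 by (simp add: s_def)
    ultimately show False using e0 by simp
  qed
  have "lor x0 v \<noteq> 0" using orth_Hyp_null[of x0 v] assms by auto
  then consider "lor x0 v < 0" | "lor x0 (- v) < 0" by fastforce
  then show False
    using main[of v] main[of "- v"] assms by cases (simp_all add: vec.neg)
qed

text \<open>Classification by a fixed vector: a timelike one would give a fixed point, a null one is
  excluded by \<open>no_null_fixed\<close>, so it is spacelike and its geodesic is invariant. On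
  that geodesic the element translates or reverses, and a reversal fixes a midpoint.\<close>

lemma haxis_exists:
  assumes "a \<in> \<Gamma>" "a \<noteq> mat 1"
  obtains u w v l where "haxis a u w v l"
proof -
  note aS = G_SOplus[OF assms(1)]
  obtain v' where v': "v' \<noteq> 0" "a *v v' = v'" using SOplus_fixed_vector[OF aS] by blast
  have "lor v' v' > 0"
  proof (rule ccontr)
    assume "\<not> lor v' v' > 0"
    then consider "lor v' v' = 0" | "lor v' v' < 0" by linarith
    then show False
    proof cases
      case 1 then show False using no_null_fixed[OF assms _ v'] by blast
    next
      case 2
      define k where "k = 1 / sqrt (- lor v' v')"
      have k: "k \<noteq> 0" "k * k * lor v' v' = - 1" using 2 by (simp_all add: k_def)
      let ?x = "k *\<^sub>R v'"
      have xx: "lor ?x ?x = - 1" using k by simp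
      have "?x \<in> Hyp \<or> - ?x \<in> Hyp"
      proof -
        have "lor ?x x0 \<noteq> 0"
        proof
          assume "lor ?x x0 = 0"
          then have "lor x0 ?x = 0" by (simp only: lor_commute)
          from orth_Hyp_nonneg[OF x0_Hyp this] xx show False by simp
        qed
        then consider "lor ?x x0 < 0" | "lor (- ?x) x0 < 0" by (simp only: lor_linear_left(4)) linarith
        then show ?thesis
          using HypI_lor[of ?x x0] HypI_lor[of "- ?x" x0] xx by cases simp_all
      qed
      moreover have "a *v ?x = ?x" "a *v (- ?x) = - ?x"
        using v' by (simp_all add: matrix_vector_mult_scaleR vec.neg)
      ultimately show False using G_free[OF assms] by blast
    qed
  qed
  define v where "v = (1 / sqrt (lor v' v')) *\<^sub>R v'"
  have v: "v \<in> dS" "a *v v = v"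
    using v' \<open>lor v' v' > 0\<close> by (simp_all add: v_def dS_def matrix_vector_mult_scaleR)
  obtain u' w' where f': "frame u' w' v" using dS_frame[OF v(1)] by blast
  define x where "x = hline u' w' 0"
  have x: "x \<in> Hyp" "lor x v = 0"
    unfolding x_def using hline_in_Hyp[OF frame_nullpair[OF f']] hline_orth[OF f'] by blast+
  have ax: "a *v x \<in> Hyp" "a *v x \<noteq> x" "lor (a *v x) v = 0"
    using x assms G_free SOplus_lor[OF aS, of x v] v by auto
  obtain u w l where l: "nullpair u w" "l > 0" "hline u w 0 = x" "hline u w l = a *v x"
    using nullpair_through[of x "a *v x"] x ax by metis
  have "lor u v + lor w v = 0" "exp l * lor u v + exp (- l) * lor w v = 0"
    using x(2) ax(3) l lor_hline_left[of u w 0 v] lor_hline_left[of u w l v] by auto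
  then have wv: "lor w v = - lor u v" and "(exp l - exp (- l)) * lor u v = 0"
    by (auto simp: algebra_simps add_eq_0_iff)
  then have uv: "lor u v = 0" using \<open>l > 0\<close> by auto
  with wv have f: "frame u w v" using l v by (simp add: frame_def)
  \<comment> \<open>Coordinates of the images of the two ends. Both images are null, so each is a
    multiple of \<open>u\<close> or of \<open>w\<close>.\<close>
  define \<alpha> \<beta> \<alpha>' \<beta>' where "\<alpha> = - 2 * lor (a *v u) w" and "\<beta> = - 2 * lor (a *v u) u"
    and "\<alpha>' = - 2 * lor (a *v w) w" and "\<beta>' = - 2 * lor (a *v w) u"
  have "lor (a *v u) v = 0" "lor (a *v w) v = 0"
    using SOplus_lor[OF aS, of u v] SOplus_lor[OF aS, of w v] v uv wv by simp_all
  then have au: "a *v u = \<alpha> *\<^sub>R u + \<beta> *\<^sub>R w" and aw: "a *v w = \<alpha>' *\<^sub>R u + \<beta>' *\<^sub>R w"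
    using frame_decomp[OF f, of "a *v u"] frame_decomp[OF f, of "a *v w"]
    by (simp_all add: \<alpha>_def \<beta>_def \<alpha>'_def \<beta>'_def)
  have ab: "\<alpha> * \<beta> = 0" "\<alpha>' * \<beta>' = 0"
    using SOplus_lor[OF aS, of u u] SOplus_lor[OF aS, of w w] frameD[OF f] unfolding au aw by simp_all
  have "a *v u + a *v w = exp l *\<^sub>R u + exp (- l) *\<^sub>R w"
    using l by (simp add: hline_def flip: vec.add)
  then have "lor (a *v u + a *v w) w = lor (exp l *\<^sub>R u + exp (- l) *\<^sub>R w) w"
    "lor (a *v u + a *v w) u = lor (exp l *\<^sub>R u + exp (- l) *\<^sub>R w) u" by simp_all
  then have sum: "\<alpha> + \<alpha>' = exp l" "\<beta> + \<beta>' = exp (- l)"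
    using frameD[OF f] by (simp_all add: \<alpha>_def \<beta>_def \<alpha>'_def \<beta>'_def)
  have "\<beta> = 0"
  proof (rule ccontr)
    assume "\<beta> \<noteq> 0"
    then have "\<alpha> = 0" using ab by simp
    then have "\<alpha>' = exp l" using sum by simp
    then have "\<beta>' = 0" using ab by simp
    then have "\<beta> = exp (- l)" using sum by simp
    \<comment> \<open>The ends are exchanged, so the midpoint of \<open>x\<close> and
      \<open>a *v x\<close> is fixed.\<close>
    let ?y = "hline u w (l / 2)"
    have "a *v ?y = ?y"
      unfolding hline_image au aw
      using \<open>\<alpha> = 0\<close> \<open>\<alpha>' = exp l\<close> \<open>\<beta>' = 0\<close> \<open>\<beta> = exp (- l)\<close>
      by (simp add: hline_def mult_exp_exp)
    then show False using G_free[OF assms hline_in_Hyp[OF l(1)]] by blast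
  qed
  then have b': "\<beta>' = exp (- l)" using sum by simp
  then have "\<alpha>' = 0" using ab by simp
  then have "\<alpha> = exp l" using sum by simp
  then have "haxis a u w v l"
    using f l v au aw \<open>\<beta> = 0\<close> b' \<open>\<alpha>' = 0\<close> by (simp add: haxis_def)
  then show ?thesis by (rule that)
qed

lemma haxis_length: "haxis a u w v l \<Longrightarrow> a \<in> \<Gamma> \<Longrightarrow> a \<noteq> mat 1 \<Longrightarrow> cosh l \<ge> 1 + e0"
  using haxis_displacement[of a u w v l "hline u w 0"] e0(2)[of a "hline u w 0"]
    hline_in_Hyp[OF frame_nullpair, of u w v 0] hline_orth[of u w v 0]
  by (auto dest!: haxis_frame)

lemma emeasure_lm_periodic:
  assumes "\<eta> \<in> Curr \<Gamma>" "a \<in> \<Gamma>" "haxis a u w v l" "S \<in> sets borel"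
  shows "emeasure (lm \<eta> u w) {t. t - l \<in> S} = emeasure (lm \<eta> u w) S"
proof -
  have "emeasure (lm \<eta> (a *v u) (a *v w)) S = emeasure (lm \<eta> u w) S"
    by (rule emeasure_lm_image[OF assms(1,2,4)])
  then show ?thesis using assms(3) emeasure_lm_shift[OF assms(1,4), of l u w] by (simp add: haxis_def)
qed

end

section \<open>A Borel fundamental domain\<close>

context surface
begin

text \<open>Countably many balls cover the plane, each so small that an orbit meets it at most once.
  The domain takes from every orbit its point in the first ball that the orbit meets; this is Borel
  because the group is countable.\<close>

lemma fund_dom_exists:
  "\<exists>F. F \<in> sets borel \<and> F \<subseteq> Hyp \<and> (\<forall>x\<in>Hyp. \<exists>!a. a \<in> \<Gamma> \<and> a *v x \<in> F)"
proof -
  \<comment> \<open>\<open>r\<close> is the cosh of the radius of the balls and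
    \<open>2 * r\<^sup>2 - 1\<close> the cosh of twice the radius, which has to stay below the
    minimal displacement.\<close>
  define r where "r = sqrt (1 + e0 / 4)"
  have r: "r > 1" "2 * r\<^sup>2 - 1 < 1 + e0" using e0(1) by (simp_all add: r_def)
  obtain T where T: "countable T" "T \<subseteq> Hyp" "Hyp \<subseteq> closure T" using separable by blast
  have "T \<noteq> {}" using T x0_Hyp by force
  define f where "f = from_nat_into T"
  have f: "f i \<in> Hyp" for i using T \<open>T \<noteq> {}\<close> from_nat_into[of T i] by (auto simp: f_def)
  define A where "A b i = {x\<in>Hyp. - lor (b *v x) (f i) < r}" for b and i :: nat
  have cover: "\<exists>i. x \<in> A (mat 1) i" if x: "x \<in> Hyp" for x
  proof -
    have "open {y. - lor x y < r}" by (intro open_Collect_less continuous_intros)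
    moreover have "x \<in> {y. - lor x y < r}" using x r by (simp add: Hyp_lor_self)
    moreover have "x \<in> closure T" using x T by blast
    ultimately obtain y where "y \<in> T" "- lor x y < r" using closure_iff_nhds_not_empty
      by (metis (no_types, lifting) Int_emptyI mem_Collect_eq open_Int_closure_eq_empty disjoint_iff)
    moreover obtain i where "y = f i"
      using \<open>y \<in> T\<close> T(1) by (metis f_def from_nat_into_surj)
    ultimately show ?thesis using x by (auto simp: A_def)
  qed
  have uniq: "b = c" if "b \<in> \<Gamma>" "c \<in> \<Gamma>" "x \<in> A b i" "x \<in> A c i" for b c x i
  proof (rule ccontr)
    assume "b \<noteq> c"
    define d where "d = c ** matrix_inv b"
    have d: "d \<in> \<Gamma>" using that by (simp add: d_def)
    have dx: "d *v (b *v x) = c *v x" using that by (simp add: d_def matrix_vector_mul_assoc[symmetric])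
    have x: "x \<in> Hyp" using that by (simp add: A_def)
    have "d \<noteq> mat 1" using dx \<open>b \<noteq> c\<close> G_eqI[of b c x] that x by auto
    then have "1 + e0 \<le> - lor (b *v x) (c *v x)" using e0(2)[of d "b *v x"] d dx that x by simp
    moreover have "- lor (b *v x) (c *v x) \<le> 2 * r\<^sup>2 - 1"
    proof -
      let ?p = "lor (b *v x) (f i)" and ?q = "lor (f i) (c *v x)"
      have H: "b *v x \<in> Hyp" "c *v x \<in> Hyp" using that x by auto
      have pq: "?p \<le> - 1" "?q \<le> - 1" "- ?p < r" "- ?q < r"
        using that Hyp_lor_le[OF H(1) f] Hyp_lor_le[OF f H(2)] by (auto simp: A_def lor_commute)
      have p2: "?p\<^sup>2 \<le> r\<^sup>2" "?q\<^sup>2 \<le> r\<^sup>2" "1 \<le> ?p\<^sup>2" "1 \<le> ?q\<^sup>2" "?p * ?q \<le> r\<^sup>2"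
      proof -
        show "?p\<^sup>2 \<le> r\<^sup>2" "?q\<^sup>2 \<le> r\<^sup>2" using pq by (simp_all add: abs_le_square_iff[symmetric])
        show "1 \<le> ?p\<^sup>2" "1 \<le> ?q\<^sup>2" using pq by (simp_all add: abs_square_less_1 leI flip: not_less)
        have "- ?p * - ?q \<le> r * r" using pq r by (intro mult_mono) auto
        then show "?p * ?q \<le> r\<^sup>2" by (simp add: power2_eq_square)
      qed
      have "(lor (b *v x) (c *v x) + ?p * ?q)\<^sup>2 \<le> (?p\<^sup>2 - 1) * (?q\<^sup>2 - 1)"
        by (rule lor_triangle(2)[OF H(1) f H(2)])
      also have "\<dots> \<le> (r\<^sup>2 - 1) * (r\<^sup>2 - 1)" using p2 by (intro mult_mono) auto
      finally have "(lor (b *v x) (c *v x) + ?p * ?q)\<^sup>2 \<le> (r\<^sup>2 - 1)\<^sup>2" by (simp add: power2_eq_square)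
      then have "\<bar>lor (b *v x) (c *v x) + ?p * ?q\<bar> \<le> \<bar>r\<^sup>2 - 1\<bar>" by (simp add: abs_le_square_iff)
      moreover have "r\<^sup>2 \<ge> 1" using r by (simp add: power2_eq_square) (metis less_1_mult order_less_imp_le)
      ultimately show ?thesis using p2(5) by linarith
    qed
    ultimately show False using r(2) by linarith
  qed
  have A_image: "c *v x \<in> A b i \<longleftrightarrow> x \<in> A (b ** c) i" if "c \<in> \<Gamma>" "x \<in> Hyp" for b c x i
    using that by (simp add: A_def matrix_vector_mul_assoc)
  have A_meas: "A b i \<in> sets borel" for b i
  proof -
    have "open {x. - lor (b *v x) (f i) < r}" by (intro open_Collect_less continuous_intros)
    then have "Hyp \<inter> {x. - lor (b *v x) (f i) < r} \<in> sets borel"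
      using closed_Hyp by (intro sets.Int) auto
    moreover have "A b i = Hyp \<inter> {x. - lor (b *v x) (f i) < r}" by (auto simp: A_def)
    ultimately show ?thesis by simp
  qed
  \<comment> \<open>The points whose orbit meets the ball of index \<open>i\<close>.\<close>
  define V where "V i = (\<Union>b\<in>\<Gamma>. A b i)" for i
  define F where "F = (\<Union>i. A (mat 1) i - (\<Union>j<i. V j))"
  have V_meas: "V i \<in> sets borel" for i
    unfolding V_def using countable_G A_meas by (intro sets.countable_UN') auto
  have "F \<in> sets borel"
    unfolding F_def using A_meas V_meas by (intro sets.countable_UN sets.Diff sets.finite_UN) auto
  moreover have "F \<subseteq> Hyp" by (auto simp: F_def A_def)
  moreover have "\<exists>!a. a \<in> \<Gamma> \<and> a *v x \<in> F" if x: "x \<in> Hyp" for x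
  proof -
    have Vinv: "a *v x \<in> V i \<longleftrightarrow> x \<in> V i" if a: "a \<in> \<Gamma>" for a i
    proof
      assume "a *v x \<in> V i"
      then show "x \<in> V i" using A_image a x by (auto simp: V_def)
    next
      assume "x \<in> V i"
      then obtain b where b: "b \<in> \<Gamma>" "x \<in> A b i" by (auto simp: V_def)
      then have "a *v x \<in> A (b ** matrix_inv a) i"
        using A_image[OF a x, of "b ** matrix_inv a" i] G_inv_left[OF a] by (simp flip: matrix_mul_assoc)
      then show "a *v x \<in> V i" using a b by (auto simp: V_def)
    qed
    define i where "i = (LEAST i. x \<in> V i)"
    have "\<exists>i. x \<in> V i" unfolding V_def using cover[OF x] G_one by blast
    then have i: "x \<in> V i" unfolding i_def by (rule LeastI_ex)
    have i': "x \<notin> V j" if "j < i" for j using that not_less_Least unfolding i_def by blast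
    have Fi: "a *v x \<in> F \<longleftrightarrow> x \<in> A a i" if a: "a \<in> \<Gamma>" for a
    proof
      assume "a *v x \<in> F"
      then obtain k where k: "a *v x \<in> A (mat 1) k" "\<And>j. j < k \<Longrightarrow> a *v x \<notin> V j" by (auto simp: F_def)
      then have xk: "x \<in> A a k" using A_image[OF a x, of "mat 1" k] by simp
      then have "x \<in> V k" using a by (auto simp: V_def)
      moreover have "x \<notin> V j" if "j < k" for j using k(2)[OF that] Vinv[OF a] by blast
      ultimately have "k = i" using i i' by (metis linorder_neqE_nat)
      then show "x \<in> A a i" using xk by simp
    next
      assume "x \<in> A a i"
      then have "a *v x \<in> A (mat 1) i" using A_image[OF a x, of "mat 1" i] by simp
      moreover have "a *v x \<notin> V j" if "j < i" for j using i'[OF that] Vinv[OF a] by blast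
      ultimately show "a *v x \<in> F" by (auto simp: F_def)
    qed
    obtain b where "b \<in> \<Gamma>" "x \<in> A b i" using i by (auto simp: V_def)
    then have b: "b \<in> \<Gamma>" "b *v x \<in> F" "x \<in> A b i" using Fi by blast+
    show ?thesis
    proof (rule ex1I[of _ b])
      fix c assume "c \<in> \<Gamma> \<and> c *v x \<in> F"
      then have "c \<in> \<Gamma>" "x \<in> A c i" using Fi by blast+
      then show "c = b" using uniq[OF _ b(1) _ b(3)] by blast
    qed (use b in blast)
  qed
  ultimately show ?thesis by (intro exI[of _ F] conjI ballI)
qed

lemma fund_dom:
  "fund_dom \<Gamma> \<in> sets borel" "fund_dom \<Gamma> \<subseteq> Hyp" "x \<in> Hyp \<Longrightarrow> \<exists>!a. a \<in> \<Gamma> \<and> a *v x \<in> fund_dom \<Gamma>"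
  using someI_ex[OF fund_dom_exists, folded fund_dom_def] by blast+

section \<open>Cyclic subgroups and cosets\<close>

lemma mpow_0: "mpow a 0 = mat 1"
  and mpow_Suc: "mpow a (Suc n) = a ** mpow a n"
  by (simp_all add: mpow_def)

lemma mpow_in_G: "a \<in> \<Gamma> \<Longrightarrow> mpow a n \<in> \<Gamma>"
  by (induction n) (simp_all add: mpow_0 mpow_Suc)

lemma haxis_inv_hline: "haxis a u w v l \<Longrightarrow> a \<in> \<Gamma> \<Longrightarrow> matrix_inv a *v hline u w t = hline u w (t - l)"
  by (metis G_inv_vec(2) diff_add_cancel haxis_hline)

lemma mpow_hline:
  assumes "haxis a u w v l" "a \<in> \<Gamma>"
  shows "mpow a n *v hline u w t = hline u w (t + real n * l)"
    and "mpow (matrix_inv a) n *v hline u w t = hline u w (t - real n * l)"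
  by (induction n) (simp_all add: mpow_0 mpow_Suc haxis_hline[OF assms(1)] haxis_inv_hline[OF assms]
      matrix_vector_mul_assoc[symmetric] algebra_simps)

lemma cyc_G: "a \<in> \<Gamma> \<Longrightarrow> c \<in> cyc a \<Longrightarrow> c \<in> \<Gamma>"
  unfolding cyc_def using mpow_in_G by auto

lemma cyc_hline:
  assumes "haxis a u w v l" "a \<in> \<Gamma>" "c \<in> cyc a"
  obtains k :: int where "\<And>t. c *v hline u w t = hline u w (t + of_int k * l)"
proof -
  consider n where "c = mpow a n" | n where "c = mpow (matrix_inv a) n"
    using assms(3) by (auto simp: cyc_def)
  then show ?thesis
  proof cases
    case (1 n) then show ?thesis using mpow_hline(1)[OF assms(1,2)] by (intro that[of "int n"]) simp
  next
    case (2 n) then show ?thesis using mpow_hline(2)[OF assms(1,2)] by (intro that[of "- int n"]) simp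
  qed
qed

lemma cyc_exists:
  assumes "haxis a u w v l" "a \<in> \<Gamma>"
  obtains c where "c \<in> cyc a" "\<And>t. c *v hline u w t = hline u w (t + of_int k * l)"
proof (cases "k \<ge> 0")
  case True
  then show ?thesis using mpow_hline(1)[OF assms, of "nat k"]
    by (intro that[of "mpow a (nat k)"]) (auto simp: cyc_def)
next
  case False
  then show ?thesis using mpow_hline(2)[OF assms, of "nat (- k)"]
    by (intro that[of "mpow (matrix_inv a) (nat (- k))"]) (auto simp: cyc_def)
qed

text \<open>By freeness an element of the group is determined by the image of one point of the axis,
  so products in the cyclic group are recognized by adding translation amounts.\<close>

lemma cyc_mult:
  assumes "haxis a u w v l" "a \<in> \<Gamma>" "c \<in> cyc a" "d \<in> cyc a"
  shows "c ** d \<in> cyc a"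
proof -
  obtain k where k: "\<And>t. c *v hline u w t = hline u w (t + of_int k * l)" using cyc_hline[OF assms(1,2,3)] by blast
  obtain j where j: "\<And>t. d *v hline u w t = hline u w (t + of_int j * l)" using cyc_hline[OF assms(1,2,4)] by blast
  obtain e where e: "e \<in> cyc a" "\<And>t. e *v hline u w t = hline u w (t + of_int (k + j) * l)"
    using cyc_exists[OF assms(1,2)] by blast
  have "e = c ** d"
    by (rule G_eqI[where x = "hline u w 0"])
      (use e cyc_G assms hline_in_Hyp[OF frame_nullpair[OF haxis_frame[OF assms(1)]]] in
       \<open>auto simp: k j matrix_vector_mul_assoc[symmetric] algebra_simps simp del: hline_0\<close>)
  with e show ?thesis by simp
qed

lemma cyc_inv:
  assumes "haxis a u w v l" "a \<in> \<Gamma>" "c \<in> cyc a"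
  obtains d where "d \<in> cyc a" "c ** d = mat 1"
proof -
  obtain k where k: "\<And>t. c *v hline u w t = hline u w (t + of_int k * l)" using cyc_hline[OF assms(1,2,3)] by blast
  obtain e where e: "e \<in> cyc a" "\<And>t. e *v hline u w t = hline u w (t + of_int (- k) * l)"
    using cyc_exists[OF assms(1,2)] by blast
  have "c ** e = mat 1"
    by (rule G_eqI[where x = "hline u w 0"])
      (use e cyc_G assms hline_in_Hyp[OF frame_nullpair[OF haxis_frame[OF assms(1)]]] in
       \<open>auto simp: k matrix_vector_mul_assoc[symmetric] algebra_simps simp del: hline_0\<close>)
  with e that show ?thesis by blast
qed

lemma one_in_cyc: "mat 1 \<in> cyc a"
  unfolding cyc_def using mpow_0[of a, symmetric] by blast

lemma coset_eq:
  fixes b :: "real^3^3"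
  assumes "haxis a u w v l" "a \<in> \<Gamma>" "c \<in> cyc a"
  shows "(\<lambda>d. (b ** c) ** d) ` cyc a = (\<lambda>d. b ** d) ` cyc a"
proof
  show "(\<lambda>d. (b ** c) ** d) ` cyc a \<subseteq> (\<lambda>d. b ** d) ` cyc a"
    using cyc_mult[OF assms] by (auto simp: matrix_mul_assoc[symmetric])
  obtain e where e: "e \<in> cyc a" "c ** e = mat 1" using cyc_inv[OF assms] by blast
  show "(\<lambda>d. b ** d) ` cyc a \<subseteq> (\<lambda>d. (b ** c) ** d) ` cyc a"
  proof
    fix x assume "x \<in> (\<lambda>d. b ** d) ` cyc a"
    then obtain d where d: "d \<in> cyc a" "x = b ** d" by blast
    then have "x = b ** (c ** e) ** d" using e by simp
    then have "x = (b ** c) ** (e ** d)" by (simp add: matrix_mul_assoc)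
    then show "x \<in> (\<lambda>d. (b ** c) ** d) ` cyc a" using cyc_mult[OF assms(1,2) e(1) d(1)] by blast
  qed
qed

text \<open>Names the choice of representative made inside \<open>curve_current\<close>.\<close>

definition crep :: "(real^3^3) set \<Rightarrow> real^3^3" where "crep C = (SOME h. h \<in> C)"

lemma crep:
  assumes "haxis a u w v l" "a \<in> \<Gamma>" "C \<in> cosets \<Gamma> a"
  shows "crep C \<in> \<Gamma>" "C = (\<lambda>d. crep C ** d) ` cyc a"
proof -
  obtain h where h: "h \<in> \<Gamma>" "C = (\<lambda>d. h ** d) ` cyc a" using assms(3) by (auto simp: cosets_def)
  then have "C \<noteq> {}" using one_in_cyc by blast
  then have "crep C \<in> C" unfolding crep_def by (rule some_in_eq[THEN iffD2])
  then obtain c where c: "c \<in> cyc a" "crep C = h ** c" using h by blast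
  show "crep C \<in> \<Gamma>" using c h cyc_G[OF assms(2)] by simp
  show "C = (\<lambda>d. crep C ** d) ` cyc a"
    unfolding c(2) using coset_eq[OF assms(1,2) c(1)] h(2) by simp
qed

text \<open>Up to the action of \<open>cyc a\<close>, a translate of the axis of \<open>a\<close> passing near \<open>x0\<close>
  does so at one of the points at integral parameter in the fundamental segment.\<close>

lemma coset_near:
  assumes "haxis a u w v l" "a \<in> \<Gamma>" "b \<in> \<Gamma>" "\<bar>lor x0 (b *v v)\<bar> \<le> r"
  obtains c j where "c \<in> cyc a" "real j \<le> l" "- lor x0 ((b ** c) *v hline u w (real j)) \<le> 2 * sqrt (1 + r\<^sup>2) * cosh 1"
proof -
  note f = haxis_frame[OF assms(1)] and lp = haxis_pos[OF assms(1)]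
  note np = frame_nullpair[OF f]
  have fb: "frame (b *v u) (b *v w) (b *v v)" using f frame_image G_SOplus assms(3) by blast
  obtain t where t: "- lor x0 (hline (b *v u) (b *v w) t) = sqrt (1 + (lor x0 (b *v v))\<^sup>2)"
    using frame_foot_point[OF fb x0_Hyp] by blast
  \<comment> \<open>Whole periods are absorbed by an element of \<open>cyc a\<close>; rounding the
    remaining parameter down to an integer moves the point by less than 1, which accounts for the
    factor \<open>2 * cosh 1\<close>.\<close>
  define k where "k = \<lfloor>t / l\<rfloor>"
  define s where "s = t - of_int k * l"
  have s: "0 \<le> s" "s < l"
  proof -
    have "of_int k \<le> t / l" "t / l < of_int k + 1" unfolding k_def by linarith+
    then show "0 \<le> s" "s < l" using lp by (simp_all add: s_def field_simps)
  qed
  obtain c where c: "c \<in> cyc a" "\<And>t. c *v hline u w t = hline u w (t + of_int k * l)"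
    using cyc_exists[OF assms(1,2)] by blast
  have cG: "c \<in> \<Gamma>" using cyc_G assms c by blast
  define j where "j = nat \<lfloor>s\<rfloor>"
  have j: "real j \<le> s" "s - real j < 1" using s by (simp_all add: j_def) linarith+
  let ?B = "b ** c"
  have BG: "?B \<in> \<Gamma>" using cG assms by simp
  have "?B *v hline u w s = hline (b *v u) (b *v w) t"
    by (simp only: matrix_vector_mul_assoc[symmetric] c(2) s_def hline_image[of b, symmetric]) simp
  then have 1: "- lor x0 (?B *v hline u w s) \<le> sqrt (1 + r\<^sup>2)"
    using t assms(4) abs_le_square_iff[of "lor x0 (b *v v)" r] by auto
  have "- lor x0 (?B *v hline u w (real j)) \<le> 2 * (- lor x0 (?B *v hline u w s) * - lor (?B *v hline u w s) (?B *v hline u w (real j)))"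
    using lor_triangle(1)[of x0 "?B *v hline u w s" "?B *v hline u w (real j)"] BG hline_in_Hyp[OF np] by simp
  also have "- lor (?B *v hline u w s) (?B *v hline u w (real j)) = cosh (s - real j)"
    using lor_hline[OF np, of s "real j"] BG by (simp add: G_lor)
  also have "2 * (- lor x0 (?B *v hline u w s) * cosh (s - real j)) \<le> 2 * (sqrt (1 + r\<^sup>2) * cosh 1)"
  proof (intro mult_left_mono mult_mono 1)
    have "cosh (s - real j) \<le> cosh (1 :: real)" using j by (subst cosh_real_nonneg_le_iff) auto
    then show "cosh (s - real j) \<le> cosh 1" .
  qed (auto intro: less_imp_le)
  finally have "- lor x0 (?B *v hline u w (real j)) \<le> 2 * sqrt (1 + r\<^sup>2) * cosh 1" by simp
  then show ?thesis using that[OF c(1), of j] j s by linarith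
qed

lemma finite_near_point:
  assumes "y \<in> Hyp"
  shows "finite {b\<in>\<Gamma>. - lor x0 (b *v y) \<le> r}"
    and "card {b\<in>\<Gamma>. - lor x0 (b *v y) \<le> r} \<le> card {b\<in>\<Gamma>. - lor x0 (b *v x0) \<le> 2 * r * M0}"
proof -
  obtain h where h: "h \<in> \<Gamma>" "- lor y (h *v x0) \<le> M0" using M0 assms by blast
  have sub: "(\<lambda>b. b ** h) ` {b\<in>\<Gamma>. - lor x0 (b *v y) \<le> r} \<subseteq> {b\<in>\<Gamma>. - lor x0 (b *v x0) \<le> 2 * r * M0}"
  proof safe
    fix b assume b: "b \<in> \<Gamma>" "- lor x0 (b *v y) \<le> r"
    then show "b ** h \<in> \<Gamma>" using h by simp
    have "- lor x0 ((b ** h) *v x0) \<le> 2 * (- lor x0 (b *v y) * - lor (b *v y) (b *v (h *v x0)))"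
      using lor_triangle(1)[of x0 "b *v y" "b *v (h *v x0)"] b h assms by (simp add: matrix_vector_mul_assoc)
    also have "\<dots> \<le> 2 * (r * M0)"
      using b h Hyp_lor_le[of x0 "b *v y"] Hyp_lor_le[of y "h *v x0"] assms
      by (intro mult_left_mono mult_mono) (auto simp: G_lor)
    finally show "- lor x0 ((b ** h) *v x0) \<le> 2 * r * M0" by simp
  qed
  have inj: "inj_on (\<lambda>b. b ** h) {b\<in>\<Gamma>. - lor x0 (b *v y) \<le> r}"
  proof (rule inj_onI)
    fix b c assume "b ** h = c ** h"
    then have "b ** h ** matrix_inv h = c ** h ** matrix_inv h" by simp
    then show "b = c" using G_inv_right[OF h(1)] by (simp add: matrix_mul_assoc[symmetric])
  qed
  show "finite {b\<in>\<Gamma>. - lor x0 (b *v y) \<le> r}"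
    using inj_on_finite[OF inj sub finite_displacement] .
  show "card {b\<in>\<Gamma>. - lor x0 (b *v y) \<le> r} \<le> card {b\<in>\<Gamma>. - lor x0 (b *v x0) \<le> 2 * r * M0}"
    by (rule card_inj_on_le[OF inj sub finite_displacement])
qed

text \<open>Local finiteness of the lifts of a closed geodesic. It makes
  \<open>curve_current\<close> sigma-finite, so that Fubini applies to \<open>inter\<close>.\<close>

lemma finite_near_cosets:
  assumes "haxis a u w v l" "a \<in> \<Gamma>"
  shows "finite {C\<in>cosets \<Gamma> a. \<bar>lor x0 (crep C *v v)\<bar> \<le> r}"
proof -
  let ?R = "2 * sqrt (1 + r\<^sup>2) * cosh 1"
  let ?Q = "\<Union>j\<in>{..nat \<lfloor>l\<rfloor>}. {b\<in>\<Gamma>. - lor x0 (b *v hline u w (real j)) \<le> ?R}"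
  note np = frame_nullpair[OF haxis_frame[OF assms(1)]]
  have "finite ?Q" using finite_near_point(1) hline_in_Hyp[OF np] by blast
  moreover have "{C\<in>cosets \<Gamma> a. \<bar>lor x0 (crep C *v v)\<bar> \<le> r} \<subseteq> (\<lambda>b. (\<lambda>d. b ** d) ` cyc a) ` ?Q"
  proof
    fix C assume C: "C \<in> {C\<in>cosets \<Gamma> a. \<bar>lor x0 (crep C *v v)\<bar> \<le> r}"
    then have Cc: "crep C \<in> \<Gamma>" "C = (\<lambda>d. crep C ** d) ` cyc a" using crep[OF assms] by blast+
    obtain c j where c: "c \<in> cyc a" "real j \<le> l" "- lor x0 ((crep C ** c) *v hline u w (real j)) \<le> ?R"
      using coset_near[OF assms Cc(1), of r] C by auto
    have "crep C ** c \<in> ?Q" using c Cc cyc_G[OF assms(2)] by (auto simp: le_nat_floor)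
    moreover have "C = (\<lambda>d. (crep C ** c) ** d) ` cyc a" using coset_eq[OF assms c(1)] Cc(2) by simp
    ultimately show "C \<in> (\<lambda>b. (\<lambda>d. b ** d) ` cyc a) ` ?Q" by blast
  qed
  ultimately show ?thesis by (meson finite_surj)
qed

end

section \<open>Intersection numbers with closed curves\<close>

text \<open>Scales a timelike vector to the upper sheet. The value is the same on \<open>z\<close>
  and \<open>- z\<close>, so the signs of the normals do not affect the intersection point.\<close>

definition ipt :: "real^3 \<Rightarrow> real^3" where
  "ipt z = (if z$3 > 0 then 1 / sqrt (- lor z z) else - 1 / sqrt (- lor z z)) *\<^sub>R z"

text \<open>The planes of the two geodesics meet in the line spanned by \<open>lcross n m\<close>;
  the geodesics cross iff this line is timelike, that is iff
  \<open>\<bar>lor n m\<bar> < 1\<close>.\<close>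

lemma gd_Int_gd:
  assumes "n \<in> dS" "m \<in> dS"
  shows "transverse (gd n) (gd m) \<longleftrightarrow> lor (lcross n m) (lcross n m) < 0" (is "?T \<longleftrightarrow> lor ?z ?z < 0")
    and "lor (lcross n m) (lcross n m) < 0 \<Longrightarrow> gd n \<inter> gd m = {ipt (lcross n m)}"
proof -
  have nm: "lor n n = 1" "lor m m = 1" using assms by (auto simp: dS_def)
  have zz: "lor ?z ?z = (lor n m)\<^sup>2 - 1" using nm by (simp add: lor_lcross_lcross)
  have uniq: "p = q" if "gd n \<noteq> gd m" "p \<in> gd n \<inter> gd m" "q \<in> gd n \<inter> gd m" for p q
  proof (rule ccontr)
    assume "p \<noteq> q"
    have H: "p \<in> Hyp" "q \<in> Hyp" using that by (auto simp: gd_def)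
    obtain v where v: "\<And>n. n \<in> dS \<Longrightarrow> lor p n = 0 \<Longrightarrow> lor q n = 0 \<Longrightarrow> gd n = gd v"
      using geod_through_eq[OF H \<open>p \<noteq> q\<close>] by metis
    then show False using v[of n] v[of m] that assms by (auto simp: gd_def)
  qed
  have pt: "ipt ?z \<in> gd n \<inter> gd m" if "lor ?z ?z < 0"
  proof -
    define k where "k = 1 / sqrt (- lor ?z ?z)"
    have k: "k > 0" "k * k * lor ?z ?z = - 1" using that by (simp_all add: k_def)
    have z3: "?z$3 \<noteq> 0" using timelike_third_nonzero that by blast
    define s where "s = (if ?z$3 > 0 then k else - k)"
    have s: "ipt ?z = s *\<^sub>R ?z" "s * ?z$3 > 0" "s * s = k * k"
      using k z3 by (auto simp: s_def ipt_def k_def mult_neg_neg mult_pos_neg divide_neg_pos simp del: lcross_nth)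
    have "lor (ipt ?z) (ipt ?z) = s * s * lor ?z ?z" unfolding s(1) by simp
    then have "lor (ipt ?z) (ipt ?z) = - 1" using k s by simp
    moreover have "(ipt ?z)$3 > 0" unfolding s(1) using s(2) by (simp del: lcross_nth)
    ultimately have "ipt ?z \<in> Hyp" by (simp add: Hyp_def)
    then show ?thesis unfolding gd_def s(1) by simp
  qed
  have ne: "gd n \<noteq> gd m" if "lor ?z ?z < 0"
  proof
    assume "gd n = gd m"
    then have "m = n \<or> m = - n" using gd_eq_iff assms by blast
    then have "lor ?z ?z = 0" unfolding zz using nm by auto
    with that show False by simp
  qed
  show "?T \<longleftrightarrow> lor ?z ?z < 0"
  proof
    assume T: ?T
    then obtain p where p: "p \<in> Hyp" "lor p n = 0" "lor p m = 0" by (auto simp: transverse_def gd_def)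
    let ?n' = "n - lor n m *\<^sub>R m"
    have "?n' \<noteq> 0"
    proof
      assume "?n' = 0"
      then have e: "n = lor n m *\<^sub>R m" by simp
      then have "lor n n = (lor n m)^2" using nm by (metis lor_linear_right(3) power2_eq_square)
      then have "lor n m = 1 \<or> lor n m = - 1" using nm by (simp add: power2_eq_1_iff)
      with e have "n = m \<or> n = - m" by (metis scaleR_one scaleR_minus1_left)
      then show False using T by (auto simp: transverse_def gd_uminus)
    qed
    moreover have o: "lor p ?n' = 0" using p by simp
    ultimately have "lor ?n' ?n' > 0"
      using orth_Hyp_nonneg[OF p(1) o] orth_Hyp_null[OF p(1) o] by linarith
    then show "lor ?z ?z < 0" unfolding zz using nm by (simp add: power2_eq_square lor_commute)
  next
    assume "lor ?z ?z < 0"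
    then show ?T using pt ne assms by (auto simp: transverse_def)
  qed
  show "lor ?z ?z < 0 \<Longrightarrow> gd n \<inter> gd m = {ipt ?z}"
    using pt ne uniq by blast
qed

text \<open>Through \<open>sect\<close>, \<open>lcross\<close> and \<open>ipt\<close>,
  transversality and the intersection point become Borel conditions on the pair.\<close>

lemma transverse_set_sets:
  assumes [measurable]: "F \<in> sets borel"
  shows "{(g, h). transverse g h \<and> (\<exists>p\<in>F. g \<inter> h = {p})} \<in> sets (GeodM \<Otimes>\<^sub>M GeodM)"
proof -
  define z where "z = (\<lambda>x. lcross (sect (fst x)) (sect (snd x)))"
  have [measurable]: "z \<in> borel_measurable (GeodM \<Otimes>\<^sub>M GeodM)"
  proof (rule borel_measurable_vec3I)
    fix i :: 3
    show "(\<lambda>x. z x $ i) \<in> borel_measurable (GeodM \<Otimes>\<^sub>M GeodM)"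
      using exhaust_3[of i] by (auto simp: z_def)
  qed
  have [measurable]: "(\<lambda>x. ipt (z x)) \<in> borel_measurable (GeodM \<Otimes>\<^sub>M GeodM)"
    unfolding ipt_def by measurable
  have "{x \<in> space (GeodM \<Otimes>\<^sub>M GeodM). lor (z x) (z x) < 0 \<and> ipt (z x) \<in> F} \<in> sets (GeodM \<Otimes>\<^sub>M GeodM)"
    by measurable
  also have "{x \<in> space (GeodM \<Otimes>\<^sub>M GeodM). lor (z x) (z x) < 0 \<and> ipt (z x) \<in> F}
    = {(g, h). transverse g h \<and> (\<exists>p\<in>F. g \<inter> h = {p})}"
  proof -
    have "lor (z (g, h)) (z (g, h)) < 0 \<and> ipt (z (g, h)) \<in> F \<longleftrightarrow> transverse g h \<and> (\<exists>p\<in>F. g \<inter> h = {p})"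
      if "g \<in> Geod" "h \<in> Geod" for g h
    proof -
      have s: "sect g \<in> dS" "sect h \<in> dS" "gd (sect g) = g" "gd (sect h) = h" using that by auto
      show ?thesis using gd_Int_gd[OF s(1,2)] unfolding s(3,4) z_def by auto
    qed
    moreover have "transverse g h \<Longrightarrow> g \<in> Geod \<and> h \<in> Geod" for g h by (simp add: transverse_def)
    ultimately show ?thesis by (auto simp: space_pair_measure)
  qed
  finally show ?thesis .
qed

lemma transverse_slice:
  assumes "frame u w v"
  shows "{g. transverse g (gd v) \<and> (\<exists>p\<in>F. g \<inter> gd v = {p})}
    = gset (\<lambda>n. crosses u w n \<and> hline u w (ctime u w n) \<in> F)" (is "?L = ?R")
proof -
  have v: "v \<in> dS" using assms by (simp add: frame_def)
  have ev: "evenp (\<lambda>n. crosses u w n \<and> hline u w (ctime u w n) \<in> F)" by (simp add: evenp_def)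
  note np = frame_nullpair[OF assms]
  have "gd n \<in> ?L \<longleftrightarrow> gd n \<in> ?R" if n: "n \<in> dS" for n
  proof -
    have Int: "gd n \<inter> gd v = {hline u w t | t. lor (hline u w t) n = 0}"
      unfolding frame_gd[OF assms] using hline_in_Hyp[OF np] by (auto simp: gd_def)
    have "transverse (gd n) (gd v) \<longleftrightarrow> crosses u w n"
    proof
      assume T: "transverse (gd n) (gd v)"
      have "\<not> (lor u n = 0 \<and> lor w n = 0)"
      proof
        assume "lor u n = 0 \<and> lor w n = 0"
        then have "n = v \<or> n = - v" using frame_orth_unit[OF assms n] by blast
        then show False using T by (auto simp: transverse_def gd_uminus)
      qed
      moreover have "\<exists>t. lor (hline u w t) n = 0" using T Int by (auto simp: transverse_def)
      ultimately show "crosses u w n" using crosses_iff by blast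
    next
      assume c: "crosses u w n"
      then have "gd n \<inter> gd v \<noteq> {}" using Int crosses_zero_iff[OF c] by auto
      moreover have "gd n \<noteq> gd v"
      proof
        assume "gd n = gd v"
        then have "n = v \<or> n = - v" using gd_eq_iff n v by blast
        then show False using c frameD[OF assms] by (auto simp: crosses_def)
      qed
      ultimately show "transverse (gd n) (gd v)" using n v by (simp add: transverse_def)
    qed
    moreover have "gd n \<inter> gd v = {hline u w (ctime u w n)}" if "crosses u w n"
      unfolding Int using crosses_zero_iff[OF that] by auto
    ultimately show ?thesis unfolding gd_in_gset[OF ev n] by auto
  qed
  moreover have "?L \<subseteq> Geod" by (auto simp: transverse_def)
  moreover have "?R \<subseteq> Geod" by (auto simp: gset_def)
  ultimately show ?thesis by (blast elim: GeodE)
qed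

text \<open>Two fundamental domains of a measure preserving action of the integers have the same
  mass: cut each one by the translates of the other and match the pieces.\<close>

lemma emeasure_fundamental_domain:
  fixes \<mu> :: "real measure"
  assumes sets: "sets \<mu> = sets borel" and l: "l > 0"
    and inv: "\<And>A. A \<in> sets borel \<Longrightarrow> emeasure \<mu> {t. t - l \<in> A} = emeasure \<mu> A"
    and S: "S \<in> sets borel" "\<And>t. \<exists>!k::int. t + of_int k * l \<in> S"
  shows "emeasure \<mu> S = emeasure \<mu> {0..<l}"
proof -
  have shift_meas: "{t. t + c \<in> A} \<in> sets borel" if [measurable]: "A \<in> sets borel" for A and c :: real
  proof -
    have "{t \<in> space borel. t + c \<in> A} \<in> sets borel" by measurable
    then show ?thesis by simp
  qed
  have nat_inv: "emeasure \<mu> {t. t + (- (of_nat k * l)) \<in> A} = emeasure \<mu> A" if "A \<in> sets borel" for A and k :: nat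
    using that
  proof (induction k)
    case (Suc k)
    have "emeasure \<mu> {t. t - l \<in> {t. t + (- (of_nat k * l)) \<in> A}} = emeasure \<mu> {t. t + (- (of_nat k * l)) \<in> A}"
      by (rule inv[OF shift_meas[OF Suc.prems]])
    moreover have "{t. t - l \<in> {t. t + (- (of_nat k * l)) \<in> A}} = {t. t + (- (of_nat (Suc k) * l)) \<in> A}"
      by (auto simp: algebra_simps)
    ultimately show ?case using Suc by simp
  qed simp
  have int_inv: "emeasure \<mu> {t. t + of_int k * l \<in> A} = emeasure \<mu> A" if A: "A \<in> sets borel" for A and k :: int
  proof (cases "k \<le> 0")
    case True
    then show ?thesis using nat_inv[OF A, of "nat (- k)"] by simp
  next
    case False
    have "emeasure \<mu> {t. t + (- (of_nat (nat k) * l)) \<in> {t. t + of_int k * l \<in> A}} = emeasure \<mu> {t. t + of_int k * l \<in> A}"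
      by (rule nat_inv[OF shift_meas[OF A]])
    moreover have "{t. t + (- (of_nat (nat k) * l)) \<in> {t. t + of_int k * l \<in> A}} = A" using False by auto
    ultimately show ?thesis by simp
  qed
  have fl: "\<exists>!k::int. t + of_int k * l \<in> {0..<l}" for t
  proof (rule ex1I[of _ "- \<lfloor>t / l\<rfloor>"])
    have "of_int \<lfloor>t / l\<rfloor> \<le> t / l" "t / l < of_int \<lfloor>t / l\<rfloor> + 1" by linarith+
    then have "of_int \<lfloor>t / l\<rfloor> * l \<le> t" "t < (of_int \<lfloor>t / l\<rfloor> + 1) * l"
      using l by (simp_all only: pos_le_divide_eq pos_divide_less_eq)
    then show "t + of_int (- \<lfloor>t / l\<rfloor>) * l \<in> {0..<l}" by (simp add: algebra_simps)
    fix k :: int assume "t + of_int k * l \<in> {0..<l}"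
    then have "of_int (- k) \<le> t / l" "t / l < of_int (- k) + 1" using l by (simp_all add: field_simps)
    then have "\<lfloor>t / l\<rfloor> = - k" by (simp add: floor_unique)
    then show "k = - \<lfloor>t / l\<rfloor>" by simp
  qed
  have split: "emeasure \<mu> A = (\<integral>\<^sup>+k. emeasure \<mu> (A \<inter> {t. t + of_int k * l \<in> B}) \<partial>count_space (UNIV :: int set))"
    if A: "A \<in> sets borel" and B: "B \<in> sets borel" "\<And>t. \<exists>!k::int. t + of_int k * l \<in> B" for A B
  proof -
    have "A = (\<Union>k. A \<inter> {t. t + of_int k * l \<in> B})" using B(2) by blast
    then have "emeasure \<mu> A = emeasure \<mu> (\<Union>k. A \<inter> {t. t + of_int k * l \<in> B})" by simp
    also have "\<dots> = (\<integral>\<^sup>+k. emeasure \<mu> (A \<inter> {t. t + of_int k * l \<in> B}) \<partial>count_space (UNIV :: int set))"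
    proof (rule emeasure_UN_countable)
      show "A \<inter> {t. t + of_int k * l \<in> B} \<in> sets \<mu>" for k :: int
        unfolding sets using A shift_meas[OF B(1)] by blast
      show "disjoint_family (\<lambda>k::int. A \<inter> {t. t + of_int k * l \<in> B})"
        using B(2) by (auto simp: disjoint_family_on_def)
    qed auto
    finally show ?thesis .
  qed
  have "emeasure \<mu> S = (\<integral>\<^sup>+k. emeasure \<mu> (S \<inter> {t. t + of_int k * l \<in> {0..<l}}) \<partial>count_space UNIV)"
    by (rule split[OF S(1) _ fl]) simp
  also have "\<dots> = (\<integral>\<^sup>+k. emeasure \<mu> ({0..<l} \<inter> {t. t + of_int (- k) * l \<in> S}) \<partial>count_space UNIV)"
  proof (rule nn_integral_cong)
    fix k :: int
    let ?A = "{0..<l} \<inter> {t. t + of_int (- k) * l \<in> S}"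
    have "?A \<in> sets borel" by (intro sets.Int shift_meas[OF S(1)]) auto
    then have "emeasure \<mu> {t. t + of_int k * l \<in> ?A} = emeasure \<mu> ?A" by (rule int_inv)
    moreover have "{t. t + of_int k * l \<in> ?A} = S \<inter> {t. t + of_int k * l \<in> {0..<l}}" by auto
    ultimately show "emeasure \<mu> (S \<inter> {t. t + of_int k * l \<in> {0..<l}}) = emeasure \<mu> ?A" by simp
  qed
  also have "\<dots> = (\<integral>\<^sup>+k. emeasure \<mu> ({0..<l} \<inter> {t. t + of_int k * l \<in> S}) \<partial>count_space UNIV)"
  proof -
    have "bij (uminus :: int \<Rightarrow> int)" by (simp add: bij_def inj_def surj_def)
    from nn_integral_bij_count_space[OF this, of "\<lambda>k. emeasure \<mu> ({0..<l} \<inter> {t. t + of_int k * l \<in> S})"]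
    show ?thesis by simp
  qed
  also have "\<dots> = emeasure \<mu> {0..<l}"
    by (rule split[OF _ S, symmetric]) simp
  finally show ?thesis .
qed

context surface
begin

lemma Curr_sigma_finite: assumes "\<eta> \<in> Curr \<Gamma>" shows "sigma_finite_measure \<eta>"
proof
  show "\<exists>A. countable A \<and> A \<subseteq> sets \<eta> \<and> \<Union>A = space \<eta> \<and> (\<forall>a\<in>A. emeasure \<eta> a \<noteq> \<infinity>)"
  proof (intro exI[of _ "range (\<lambda>n::nat. near x0 (real n))"] conjI)
    show "\<Union>(range (\<lambda>n::nat. near x0 (real n))) = space \<eta>"
      unfolding Curr_space[OF assms] near_def gset_def using real_arch_simple by auto
    show "\<forall>a\<in>range (\<lambda>n::nat. near x0 (real n)). emeasure \<eta> a \<noteq> \<infinity>"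
      using Curr_near_finite[OF assms x0_Hyp] by (auto simp: less_top)
  qed (auto simp: Curr_sets[OF assms] near_sets)
qed

lemma countable_cosets: "countable (cosets \<Gamma> a)"
proof -
  have "cosets \<Gamma> a = (\<lambda>h. (\<lambda>c. h ** c) ` cyc a) ` \<Gamma>" by (auto simp: cosets_def)
  then show ?thesis using countable_G by simp
qed

lemma crep_axis:
  assumes "haxis a u w v l" "a \<in> \<Gamma>" "C \<in> cosets \<Gamma> a"
  shows "gimg (SOME h. h \<in> C) (axis a) = gd (crep C *v v)"
  using crep(1)[OF assms] G_SOplus assms by (simp add: axis_haxis gimg_gd flip: crep_def)

lemma haxis_dS: "haxis a u w v l \<Longrightarrow> v \<in> dS"
  by (simp add: haxis_def frame_def)

lemma curve_current_measurable:
  assumes "haxis a u w v l" "a \<in> \<Gamma>"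
  shows "(\<lambda>C. gimg (SOME h. h \<in> C) (axis a)) \<in> measurable (count_space (cosets \<Gamma> a)) GeodM"
proof -
  have "gimg (SOME h. h \<in> C) (axis a) \<in> Geod" if "C \<in> cosets \<Gamma> a" for C
    using crep_axis[OF assms that] crep(1)[OF assms that] G_SOplus SOplus_dS haxis_dS[OF assms(1)] by simp
  then show ?thesis by simp
qed

lemma curve_current_sigma_finite:
  assumes "haxis a u w v l" "a \<in> \<Gamma>"
  shows "sigma_finite_measure (curve_current \<Gamma> a)"
proof
  let ?c = "curve_current \<Gamma> a"
  have s: "sets ?c = sets GeodM" "space ?c = Geod" by (simp_all add: curve_current_def)
  have "emeasure ?c (near x0 r) \<noteq> \<infinity>" for r
  proof -
    have "emeasure ?c (near x0 r) = emeasure (count_space (cosets \<Gamma> a))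
      ((\<lambda>C. gimg (SOME h. h \<in> C) (axis a)) -` near x0 r \<inter> cosets \<Gamma> a)"
      unfolding curve_current_def
      by (subst emeasure_distr[OF curve_current_measurable[OF assms]]) (simp_all add: near_sets)
    also have "(\<lambda>C. gimg (SOME h. h \<in> C) (axis a)) -` near x0 r \<inter> cosets \<Gamma> a
      = {C\<in>cosets \<Gamma> a. \<bar>lor x0 (crep C *v v)\<bar> \<le> r}"
    proof -
      have ev: "evenp (\<lambda>n. \<bar>lor x0 n\<bar> \<le> r)" by (simp add: evenp_def)
      have "gimg (SOME h. h \<in> C) (axis a) \<in> near x0 r \<longleftrightarrow> \<bar>lor x0 (crep C *v v)\<bar> \<le> r" if "C \<in> cosets \<Gamma> a" for C
        unfolding crep_axis[OF assms that] near_def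
        using gd_in_gset[OF ev] SOplus_dS[OF G_SOplus[OF crep(1)[OF assms that]] haxis_dS[OF assms(1)]] by blast
      then show ?thesis by auto
    qed
    finally show ?thesis using finite_near_cosets[OF assms, of r]
      by (simp add: emeasure_count_space_finite)
  qed
  then show "\<exists>A. countable A \<and> A \<subseteq> sets ?c \<and> \<Union>A = space ?c \<and> (\<forall>a\<in>A. emeasure ?c a \<noteq> \<infinity>)"
    unfolding s
  proof (intro exI[of _ "range (\<lambda>n::nat. near x0 (real n))"] conjI)
    show "\<Union>(range (\<lambda>n::nat. near x0 (real n))) = Geod"
      unfolding near_def gset_def using real_arch_simple by auto
  qed (auto simp: near_sets)
qed

text \<open>Fubini writes the intersection number as a sum over cosets. Each coset contributes the
  crossing times \<open>t\<close> at which its representative brings \<open>hline u w t\<close> into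
  the fundamental domain; together these times form a fundamental domain for translation by
  \<open>l\<close>, so they may be replaced by \<open>{0..<l}\<close>.\<close>

lemma inter_curve_current:
  assumes "\<eta> \<in> Curr \<Gamma>" "haxis a u w v l" "a \<in> \<Gamma>"
  shows "inter \<Gamma> \<eta> (curve_current \<Gamma> a) = emeasure (lm \<eta> u w) {0..<l}"
proof -
  let ?c = "curve_current \<Gamma> a" and ?F = "fund_dom \<Gamma>" and ?Cs = "cosets \<Gamma> a"
  let ?X = "{(g, h). transverse g h \<and> (\<exists>p\<in>?F. g \<inter> h = {p})}"
  let ?\<phi> = "\<lambda>C. gimg (SOME h. h \<in> C) (axis a)"
  note f = haxis_frame[OF assms(2)] and np = frame_nullpair[OF haxis_frame[OF assms(2)]]
  interpret c: sigma_finite_measure ?c by (rule curve_current_sigma_finite[OF assms(2,3)])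
  interpret e: sigma_finite_measure \<eta> by (rule Curr_sigma_finite[OF assms(1)])
  interpret pair_sigma_finite \<eta> ?c ..
  have sc: "sets ?c = sets GeodM" by (simp add: curve_current_def)
  have X: "?X \<in> sets (\<eta> \<Otimes>\<^sub>M ?c)"
    using transverse_set_sets[OF fund_dom(1)]
    by (simp only: sets_pair_measure_cong[OF Curr_sets[OF assms(1)] sc])
  have hl_meas: "{t. b *v hline u w t \<in> ?F} \<in> sets borel" for b
  proof -
    have [measurable]: "(\<lambda>t. b *v hline u w t) \<in> borel_measurable borel"
      unfolding hline_def by (intro borel_measurable_continuous_onI continuous_intros)
    have [measurable]: "?F \<in> sets borel" by (rule fund_dom(1))
    have "{t \<in> space borel. b *v hline u w t \<in> ?F} \<in> sets borel" by measurable
    then show ?thesis by simp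
  qed
  have slice: "emeasure \<eta> ((\<lambda>x. (x, ?\<phi> C)) -` ?X) = emeasure (lm \<eta> u w) {t. crep C *v hline u w t \<in> ?F}"
    if C: "C \<in> ?Cs" for C
  proof -
    let ?b = "crep C"
    have b: "?b \<in> \<Gamma>" using crep(1)[OF assms(2,3) C] .
    have fb: "frame (?b *v u) (?b *v w) (?b *v v)" using f frame_image G_SOplus b by blast
    have "(\<lambda>x. (x, ?\<phi> C)) -` ?X = {g. transverse g (gd (?b *v v)) \<and> (\<exists>p\<in>?F. g \<inter> gd (?b *v v) = {p})}"
      unfolding crep_axis[OF assms(2,3) C] by auto
    also have "\<dots> = gset (\<lambda>n. crosses (?b *v u) (?b *v w) n
        \<and> ctime (?b *v u) (?b *v w) n \<in> {t. ?b *v hline u w t \<in> ?F})"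
      unfolding transverse_slice[OF fb] by (simp add: hline_image)
    also have "emeasure \<eta> \<dots> = emeasure (lm \<eta> (?b *v u) (?b *v w)) {t. ?b *v hline u w t \<in> ?F}"
      by (rule emeasure_lm[OF assms(1) hl_meas, symmetric])
    also have "\<dots> = emeasure (lm \<eta> u w) {t. ?b *v hline u w t \<in> ?F}"
      by (rule emeasure_lm_image[OF assms(1) b hl_meas])
    finally show ?thesis .
  qed
  let ?S = "\<Union>C\<in>?Cs. {t. crep C *v hline u w t \<in> ?F}"
  have fd: "\<exists>!b. b \<in> \<Gamma> \<and> b *v hline u w t \<in> ?F" for t
    by (rule fund_dom(3)[OF hline_in_Hyp[OF np]])
  \<comment> \<open>Exactly one group element brings a given point into the domain, so two cosets
    containing such an element coincide.\<close>
  have Ceq: "C = D" if "C \<in> ?Cs" "D \<in> ?Cs" "c \<in> cyc a" "d \<in> cyc a"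
    "(crep C ** c) *v hline u w t \<in> ?F" "(crep D ** d) *v hline u w t \<in> ?F" for C D c d t
  proof -
    have "crep C ** c = crep D ** d"
      using fd[of t] that crep(1)[OF assms(2,3)] cyc_G[OF assms(3)] by blast
    then have "(\<lambda>x. (crep C ** c) ** x) ` cyc a = (\<lambda>x. (crep D ** d) ** x) ` cyc a" by simp
    then show "C = D"
      using coset_eq[OF assms(2,3) that(3), of "crep C"] coset_eq[OF assms(2,3) that(4), of "crep D"]
        crep(2)[OF assms(2,3) that(1)] crep(2)[OF assms(2,3) that(2)] by simp
  qed
  have "inter \<Gamma> \<eta> ?c = (\<integral>\<^sup>+h. emeasure \<eta> ((\<lambda>x. (x, h)) -` ?X) \<partial>?c)"
    unfolding inter_def by (rule emeasure_pair_measure_alt2[OF X])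
  also have "\<dots> = (\<integral>\<^sup>+C. emeasure \<eta> ((\<lambda>x. (x, ?\<phi> C)) -` ?X) \<partial>count_space ?Cs)"
    unfolding curve_current_def
  proof (rule nn_integral_distr[OF curve_current_measurable[OF assms(2,3)]])
    have "(\<lambda>h. emeasure \<eta> ((\<lambda>x. (x, h)) -` ?X)) \<in> borel_measurable ?c"
      by (rule measurable_emeasure_Pair2[OF X])
    then show "(\<lambda>h. emeasure \<eta> ((\<lambda>x. (x, h)) -` ?X)) \<in> borel_measurable (distr (count_space ?Cs) GeodM ?\<phi>)"
      by (simp add: curve_current_def)
  qed
  also have "\<dots> = (\<integral>\<^sup>+C. emeasure (lm \<eta> u w) {t. crep C *v hline u w t \<in> ?F} \<partial>count_space ?Cs)"
    by (rule nn_integral_cong) (use slice in simp)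
  also have "\<dots> = emeasure (lm \<eta> u w) ?S"
  proof (rule emeasure_UN_countable[symmetric])
    show "disjoint_family_on (\<lambda>C. {t. crep C *v hline u w t \<in> ?F}) ?Cs"
      using Ceq[OF _ _ one_in_cyc one_in_cyc] by (fastforce simp: disjoint_family_on_def)
  qed (auto simp: hl_meas countable_cosets)
  also have "\<dots> = emeasure (lm \<eta> u w) {0..<l}"
  proof (rule emeasure_fundamental_domain)
    show "l > 0" by (rule haxis_pos[OF assms(2)])
    show "emeasure (lm \<eta> u w) {t. t - l \<in> A} = emeasure (lm \<eta> u w) A" if "A \<in> sets borel" for A
      by (rule emeasure_lm_periodic[OF assms(1,3,2) that])
    show "?S \<in> sets borel" using hl_meas countable_cosets by (intro sets.countable_UN') auto
    show "\<exists>!k::int. t + of_int k * l \<in> ?S" for t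
    proof -
      obtain b where b: "b \<in> \<Gamma>" "b *v hline u w t \<in> ?F" using fd[of t] by blast
      define C where "C = (\<lambda>d. b ** d) ` cyc a"
      have C: "C \<in> ?Cs" using b by (auto simp: C_def cosets_def)
      \<comment> \<open>The element that brings the point into the domain differs from the
        representative of its coset by a power of \<open>a\<close>, and this power is the required
        shift by \<open>k\<close> periods.\<close>
      have "b \<in> C" unfolding C_def using one_in_cyc[of a] by (metis image_eqI matrix_mul_rid)
      then obtain c where c: "c \<in> cyc a" "b = crep C ** c" using crep(2)[OF assms(2,3) C] by blast
      obtain k where k: "\<And>t. c *v hline u w t = hline u w (t + of_int k * l)"
        using cyc_hline[OF assms(2,3) c(1)] by blast
      have "crep C *v hline u w (t + of_int k * l) \<in> ?F"
        using b(2) by (simp add: c(2) k matrix_vector_mul_assoc[symmetric])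
      then have ex: "t + of_int k * l \<in> ?S" using C by blast
      show ?thesis
      proof (rule ex1I[of _ k])
        show "t + of_int k * l \<in> ?S" by (rule ex)
        fix j :: int assume "t + of_int j * l \<in> ?S"
        then obtain D where D: "D \<in> ?Cs" "crep D *v hline u w (t + of_int j * l) \<in> ?F" by blast
        obtain d where d: "d \<in> cyc a" "\<And>t. d *v hline u w t = hline u w (t + of_int j * l)"
          using cyc_exists[OF assms(2,3)] by blast
        have dF: "(crep D ** d) *v hline u w t \<in> ?F"
          using D(2) by (simp add: d(2) matrix_vector_mul_assoc[symmetric])
        moreover have "(crep C ** c) *v hline u w t \<in> ?F" using b c by simp
        ultimately have "C = D" using Ceq[OF C D(1) c(1) d(1)] by blast
        then have "crep C ** d = crep C ** c"
          using fd[of t] dF b c crep(1)[OF assms(2,3) C] cyc_G[OF assms(3)] d(1) by blast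
        then have "crep C *v (d *v hline u w t) = crep C *v (c *v hline u w t)"
          by (metis matrix_vector_mul_assoc)
        then have "matrix_inv (crep C) *v (crep C *v (d *v hline u w t)) = matrix_inv (crep C) *v (crep C *v (c *v hline u w t))"
          by simp
        then have "hline u w (t + of_int j * l) = hline u w (t + of_int k * l)"
          using crep(1)[OF assms(2,3) C] by (simp add: d(2) k)
        then have "cosh ((t + of_int j * l) - (t + of_int k * l)) = cosh 0"
          using lor_hline[OF np, of "t + of_int j * l" "t + of_int k * l"]
            lor_hline[OF np, of "t + of_int j * l" "t + of_int j * l"] by simp
        then have "(t + of_int j * l) - (t + of_int k * l) = 0" by (simp add: cosh_real_one_iff)
        then show "j = k" using haxis_pos[OF assms(2)] by simp
      qed
    qed
  qed simp
  finally show ?thesis .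
qed


section \<open>Intersection number and displacement\<close>

lemma measure_lm_period:
  assumes "\<eta> \<in> Curr \<Gamma>" "haxis a u w v l" "a \<in> \<Gamma>"
  shows "measure (lm \<eta> u w) {real n * l..<(real n + 1) * l} = measure (lm \<eta> u w) {0..<l}"
proof (induction n)
  case (Suc n)
  have "{t. t - l \<in> {real n * l..<(real n + 1) * l}} = {real (Suc n) * l..<(real (Suc n) + 1) * l}"
    by (auto simp: algebra_simps)
  then have "emeasure (lm \<eta> u w) {real (Suc n) * l..<(real (Suc n) + 1) * l} = emeasure (lm \<eta> u w) {real n * l..<(real n + 1) * l}"
    using emeasure_lm_periodic[OF assms(1,3,2), of "{real n * l..<(real n + 1) * l}"] by simp
  then show ?case using Suc by (simp add: measure_def)
qed simp

lemma measure_lm_periods: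
  assumes "\<eta> \<in> Curr \<Gamma>" "haxis a u w v l" "a \<in> \<Gamma>"
  shows "measure (lm \<eta> u w) {0..<real n * l} = real n * measure (lm \<eta> u w) {0..<l}"
proof (induction n)
  case (Suc n)
  note np = frame_nullpair[OF haxis_frame[OF assms(2)]] and lp = haxis_pos[OF assms(2)]
  have "measure (lm \<eta> u w) {0..<(real n + 1) * l}
    = measure (lm \<eta> u w) {0..<real n * l} + measure (lm \<eta> u w) {real n * l..<(real n + 1) * l}"
    using lp by (intro measure_lm_split[OF assms(1) np]) auto
  then show ?case using Suc measure_lm_period[OF assms, of n] by (simp add: algebra_simps)
qed simp

lemma ds_mpow:
  assumes "\<eta> \<in> Curr \<Gamma>" "a \<in> \<Gamma>" "x \<in> Hyp"
  shows "ds \<eta> x (mpow a n *v x) \<le> real n * ds \<eta> x (a *v x)"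
proof (induction n)
  case 0 then show ?case by (simp add: mpow_0 ds_def segset_self)
next
  case (Suc n)
  have "ds \<eta> x (mpow a (Suc n) *v x) \<le> ds \<eta> x (a *v x) + ds \<eta> (a *v x) (a *v (mpow a n *v x))"
    using ds_triangle[OF assms(1,3), of "a *v x" "a *v (mpow a n *v x)"] assms mpow_in_G[OF assms(2)]
    by (simp add: mpow_Suc matrix_vector_mul_assoc[symmetric])
  also have "\<dots> \<le> ds \<eta> x (a *v x) + real n * ds \<eta> x (a *v x)" using Suc assms by (simp add: ds_invariant)
  finally show ?case by (simp add: algebra_simps)
qed

text \<open>Stable length: \<open>n\<close> periods of the axis carry \<open>n\<close> times the
  intersection number, while the displacement of \<open>mpow a n\<close> at \<open>x\<close> is at
  most \<open>n\<close> times that of \<open>a\<close>. Moving between \<open>x\<close> and the axis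
  costs a constant, negligible for large \<open>n\<close>.\<close>

lemma intersection_le_ds:
  assumes "\<eta> \<in> Curr \<Gamma>" "haxis a u w v l" "a \<in> \<Gamma>" "x \<in> Hyp"
  shows "measure (lm \<eta> u w) {0..<l} \<le> ds \<eta> x (a *v x)"
proof (rule ccontr)
  let ?I = "measure (lm \<eta> u w) {0..<l}" and ?p = "hline u w 0" and ?d = "ds \<eta> x (a *v x)"
  assume "\<not> ?I \<le> ?d"
  note np = frame_nullpair[OF haxis_frame[OF assms(2)]] and lp = haxis_pos[OF assms(2)]
  have p: "?p \<in> Hyp" by (rule hline_in_Hyp[OF np])
  have bound: "real n * ?I \<le> 2 * ds \<eta> ?p x + real n * ?d" if "n > 0" for n
  proof -
    have G: "mpow a n \<in> \<Gamma>" using mpow_in_G assms by blast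
    have "real n * ?I = measure (lm \<eta> u w) {0..<real n * l}" using measure_lm_periods[OF assms(1-3)] by simp
    also have "\<dots> \<le> measure (lm \<eta> u w) {0..real n * l}"
      by (rule measure_mono_fmeasurable) (auto intro!: lm_fmeasurable[OF assms(1) np, of _ 0 "real n * l"])
    also have "\<dots> = ds \<eta> ?p (hline u w (real n * l))" using ds_hline[OF assms(1), of 0 "real n * l"] lp that by simp
    also have "hline u w (real n * l) = mpow a n *v ?p" using mpow_hline(1)[OF assms(2,3), of n 0] by simp
    also have "ds \<eta> ?p (mpow a n *v ?p) \<le> ds \<eta> ?p x + ds \<eta> x (mpow a n *v ?p)"
      using p assms G by (intro ds_triangle) auto
    also have "ds \<eta> x (mpow a n *v ?p) \<le> ds \<eta> x (mpow a n *v x) + ds \<eta> (mpow a n *v x) (mpow a n *v ?p)"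
      using p assms G by (intro ds_triangle) auto
    also have "ds \<eta> (mpow a n *v x) (mpow a n *v ?p) = ds \<eta> ?p x"
      unfolding ds_invariant[OF assms(1) G] by (rule ds_commute)
    also have "ds \<eta> x (mpow a n *v x) \<le> real n * ?d" using ds_mpow assms by blast
    finally show ?thesis by simp
  qed
  obtain n :: nat where n: "2 * ds \<eta> ?p x / (?I - ?d) < real n" using reals_Archimedean2 by blast
  have "?I - ?d > 0" using \<open>\<not> ?I \<le> ?d\<close> by simp
  then have "2 * ds \<eta> ?p x < real n * (?I - ?d)" using n by (simp add: pos_divide_less_eq)
  moreover have "n > 0"
  proof (rule ccontr)
    assume "\<not> n > 0"
    then have "2 * ds \<eta> ?p x / (?I - ?d) < 0" using n by simp
    moreover have "0 \<le> 2 * ds \<eta> ?p x / (?I - ?d)"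
      using \<open>?I - ?d > 0\<close> by (intro divide_nonneg_pos mult_nonneg_nonneg ds_nonneg) auto
    ultimately show False by linarith
  qed
  ultimately show False using bound[of n] by (simp add: algebra_simps)
qed

text \<open>The distance counts a closed segment and the intersection number a half-open period;
  they differ by the atom at the endpoint.\<close>

lemma ds_axis_le_intersection:
  assumes "\<eta> \<in> Curr \<Gamma>" "haxis a u w v l" "a \<in> \<Gamma>"
  shows "ds \<eta> (hline u w 0) (a *v hline u w 0) \<le> measure (lm \<eta> u w) {0..<l} + mass \<eta> 0"
proof -
  note np = frame_nullpair[OF haxis_frame[OF assms(2)]] and lp = haxis_pos[OF assms(2)]
  have "ds \<eta> (hline u w 0) (a *v hline u w 0) = measure (lm \<eta> u w) {0..l}"
    using ds_hline[OF assms(1), of 0 l u w] lp haxis_hline[OF assms(2), of 0] by simp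
  also have "{0..l} = {0..<l} \<union> {l}" using lp by auto
  also have "measure (lm \<eta> u w) ({0..<l} \<union> {l}) \<le> measure (lm \<eta> u w) {0..<l} + measure (lm \<eta> u w) {l}"
    by (rule measure_Un_le) auto
  also have "\<dots> \<le> measure (lm \<eta> u w) {0..<l} + mass \<eta> 0" using lm_point[OF assms(1) np, of l] by simp
  finally show ?thesis .
qed

definition inum :: "(real^3) set measure \<Rightarrow> (real^3^3) set \<Rightarrow> real" where
  "inum \<eta> c = enn2real (inter \<Gamma> \<eta> (class_current \<Gamma> c))"

section \<open>Conjugacy classes and their intersection numbers\<close>

lemma matrix_inv_mult: "a \<in> \<Gamma> \<Longrightarrow> b \<in> \<Gamma> \<Longrightarrow> matrix_inv (a ** b) = matrix_inv b ** matrix_inv a"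
proof -
  assume ab: "a \<in> \<Gamma>" "b \<in> \<Gamma>"
  have "matrix_inv (a ** b) = matrix_inv (a ** b) ** (a ** (b ** matrix_inv b) ** matrix_inv a)"
    using ab by (simp add: G_inv_right)
  also have "\<dots> = (matrix_inv (a ** b) ** (a ** b)) ** (matrix_inv b ** matrix_inv a)"
    by (simp only: matrix_mul_assoc)
  also have "\<dots> = matrix_inv b ** matrix_inv a" using ab by (simp add: G_inv_left)
  finally show ?thesis .
qed

lemma matrix_inv_inv: "a \<in> \<Gamma> \<Longrightarrow> matrix_inv (matrix_inv a) = a"
proof -
  assume a: "a \<in> \<Gamma>"
  have "matrix_inv (matrix_inv a) = matrix_inv (matrix_inv a) ** (matrix_inv a ** a)" using a by (simp add: G_inv_left)
  also have "\<dots> = (matrix_inv (matrix_inv a) ** matrix_inv a) ** a" by (simp only: matrix_mul_assoc)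
  also have "\<dots> = a" using a by (simp add: G_inv_left)
  finally show ?thesis .
qed

lemma conjcl_self: "a \<in> conjcl \<Gamma> a"
proof -
  have "matrix_inv (mat 1 :: real^3^3) = mat 1" using G_inv_left[OF G_one] by simp
  then have "a = mat 1 ** a ** matrix_inv (mat 1)" by simp
  then show ?thesis unfolding conjcl_def using G_one by blast
qed

lemma conjcl_eq:
  assumes "a \<in> \<Gamma>" "b \<in> conjcl \<Gamma> a"
  shows "conjcl \<Gamma> b = conjcl \<Gamma> a"
proof -
  have sub: "conjcl \<Gamma> y \<subseteq> conjcl \<Gamma> x" if x: "x \<in> \<Gamma>" "y \<in> conjcl \<Gamma> x" for x y
  proof
    fix z assume "z \<in> conjcl \<Gamma> y"
    then obtain k where k: "k \<in> \<Gamma>" "z = k ** y ** matrix_inv k" by (auto simp: conjcl_def)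
    obtain h where h: "h \<in> \<Gamma>" "y = h ** x ** matrix_inv h" using x by (auto simp: conjcl_def)
    have "z = (k ** h) ** x ** matrix_inv (k ** h)"
      using k h by (simp add: matrix_inv_mult matrix_mul_assoc)
    then show "z \<in> conjcl \<Gamma> x" unfolding conjcl_def using k h by blast
  qed
  obtain h where h: "h \<in> \<Gamma>" "b = h ** a ** matrix_inv h" using assms by (auto simp: conjcl_def)
  have "a = matrix_inv h ** b ** matrix_inv (matrix_inv h)"
  proof -
    have "matrix_inv h ** b ** matrix_inv (matrix_inv h) = (matrix_inv h ** h) ** a ** (matrix_inv h ** h)"
      unfolding matrix_inv_inv[OF h(1)] h(2) by (simp only: matrix_mul_assoc)
    then show ?thesis using h by (simp add: G_inv_left)
  qed
  then have "a \<in> conjcl \<Gamma> b" unfolding conjcl_def using h by blast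
  moreover have "b \<in> \<Gamma>" using h assms by simp
  ultimately show ?thesis using sub assms by blast
qed

lemma Curves_props:
  assumes "c \<in> Curves \<Gamma>"
  obtains a where "a \<in> \<Gamma>" "a \<noteq> mat 1" "c = conjcl \<Gamma> a" "class_current \<Gamma> c = curve_current \<Gamma> a"
proof -
  obtain b where b: "b \<in> \<Gamma>" "b \<noteq> mat 1" "c = conjcl \<Gamma> b" using assms by (auto simp: Curves_def)
  define a where "a = (SOME a. a \<in> c)"
  have "a \<in> c" unfolding a_def using conjcl_self b(3) by (metis someI)
  then obtain h where h: "h \<in> \<Gamma>" "a = h ** b ** matrix_inv h" using b by (auto simp: conjcl_def)
  have "a \<noteq> mat 1"
  proof
    assume "a = mat 1"
    then have "matrix_inv h ** a ** h = matrix_inv h ** h" by simp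
    moreover have "matrix_inv h ** a ** h = (matrix_inv h ** h) ** b ** (matrix_inv h ** h)"
      unfolding h(2) by (simp only: matrix_mul_assoc)
    ultimately show False using h b by (simp add: G_inv_left)
  qed
  moreover have "a \<in> \<Gamma>" using h b by simp
  moreover have "c = conjcl \<Gamma> a" using conjcl_eq[OF b(1)] \<open>a \<in> c\<close> b by simp
  moreover have "class_current \<Gamma> c = curve_current \<Gamma> a" by (simp add: class_current_def a_def)
  ultimately show ?thesis using that by blast
qed

lemma inter_class:
  assumes "\<eta> \<in> Curr \<Gamma>" "c \<in> Curves \<Gamma>"
  shows "inter \<Gamma> \<eta> (class_current \<Gamma> c) = ennreal (inum \<eta> c)"
    and "b \<in> c \<Longrightarrow> x \<in> Hyp \<Longrightarrow> inum \<eta> c \<le> ds \<eta> x (b *v x)"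
    and "\<exists>b\<in>c. b \<in> \<Gamma> \<and> ds \<eta> (b *v x0) x0 \<le> inum \<eta> c + (2 * mass \<eta> M0 + mass \<eta> 0)"
    and "\<exists>a u w v l. a \<in> c \<and> a \<in> \<Gamma> \<and> a \<noteq> mat 1 \<and> c = conjcl \<Gamma> a \<and> haxis a u w v l \<and> inum \<eta> c = measure (lm \<eta> u w) {0..<l}"
proof -
  obtain a where a: "a \<in> \<Gamma>" "a \<noteq> mat 1" "c = conjcl \<Gamma> a" "class_current \<Gamma> c = curve_current \<Gamma> a"
    using Curves_props[OF assms(2)] by blast
  obtain u w v l where h: "haxis a u w v l" using haxis_exists[OF a(1,2)] by blast
  note np = frame_nullpair[OF haxis_frame[OF h]] and lp = haxis_pos[OF h]
  have "{0..<l} \<in> fmeasurable (lm \<eta> u w)" by (rule lm_fmeasurable[OF assms(1) np, of _ 0 l]) auto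
  then have e: "inter \<Gamma> \<eta> (class_current \<Gamma> c) = ennreal (measure (lm \<eta> u w) {0..<l})"
    unfolding a(4) inter_curve_current[OF assms(1) h a(1)] by (simp add: emeasure_eq_measure2)
  then have I: "inum \<eta> c = measure (lm \<eta> u w) {0..<l}" by (simp add: inum_def)
  show "inter \<Gamma> \<eta> (class_current \<Gamma> c) = ennreal (inum \<eta> c)" using e I by simp
  show "inum \<eta> c \<le> ds \<eta> x (b *v x)" if bx: "b \<in> c" "x \<in> Hyp"
  proof -
    obtain k where k: "k \<in> \<Gamma>" "b = k ** a ** matrix_inv k"
      using bx(1) unfolding a(3) conjcl_def by blast
    have "inum \<eta> c \<le> ds \<eta> (matrix_inv k *v x) (a *v (matrix_inv k *v x))"
      unfolding I by (rule intersection_le_ds[OF assms(1) h a(1)]) (use k(1) bx(2) in simp)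
    also have "\<dots> = ds \<eta> (k *v (matrix_inv k *v x)) (k *v (a *v (matrix_inv k *v x)))"
      by (rule ds_invariant[OF assms(1) k(1), symmetric])
    also have "\<dots> = ds \<eta> x (b *v x)" using k(1) by (simp add: k(2) matrix_vector_mul_assoc[symmetric])
    finally show ?thesis .
  qed
  show "\<exists>b\<in>c. b \<in> \<Gamma> \<and> ds \<eta> (b *v x0) x0 \<le> inum \<eta> c + (2 * mass \<eta> M0 + mass \<eta> 0)"
  proof -
    let ?p = "hline u w 0"
    have p: "?p \<in> Hyp" by (rule hline_in_Hyp[OF np])
    \<comment> \<open>Conjugating by an element that moves \<open>x0\<close> near the axis gives a
      representative whose displacement exceeds the intersection number by at most two detours of
      size \<open>mass \<eta> M0\<close> and one atom.\<close>
    obtain k where k: "k \<in> \<Gamma>" "- lor ?p (k *v x0) \<le> M0" using M0(2)[OF p] by blast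
    define b where "b = matrix_inv k ** a ** k"
    have "b = matrix_inv k ** a ** matrix_inv (matrix_inv k)" using k by (simp add: b_def matrix_inv_inv)
    then have "b \<in> c" unfolding a(3) conjcl_def using k by blast
    have "ds \<eta> (b *v x0) x0 = ds \<eta> x0 (b *v x0)" by (rule ds_commute)
    also have "\<dots> = ds \<eta> (k *v x0) (k *v (b *v x0))" by (rule ds_invariant[OF assms(1) k(1), symmetric])
    also have "k *v (b *v x0) = a *v (k *v x0)"
      using k by (simp add: b_def matrix_vector_mul_assoc[symmetric])
    also have "ds \<eta> (k *v x0) (a *v (k *v x0)) \<le> ds \<eta> (k *v x0) ?p + ds \<eta> ?p (a *v (k *v x0))"
      using p k a assms by (intro ds_triangle) auto
    also have "ds \<eta> ?p (a *v (k *v x0)) \<le> ds \<eta> ?p (a *v ?p) + ds \<eta> (a *v ?p) (a *v (k *v x0))"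
      using p k a assms by (intro ds_triangle) auto
    also have "ds \<eta> (a *v ?p) (a *v (k *v x0)) = ds \<eta> ?p (k *v x0)" by (rule ds_invariant[OF assms(1) a(1)])
    also have "ds \<eta> (k *v x0) ?p = ds \<eta> ?p (k *v x0)" by (rule ds_commute)
    also have "ds \<eta> ?p (a *v ?p) \<le> inum \<eta> c + mass \<eta> 0"
      unfolding I by (rule ds_axis_le_intersection[OF assms(1) h a(1)])
    finally have "ds \<eta> (b *v x0) x0 \<le> 2 * ds \<eta> ?p (k *v x0) + inum \<eta> c + mass \<eta> 0" by simp
    moreover have "ds \<eta> ?p (k *v x0) \<le> mass \<eta> M0" using p k assms by (intro ds_le_mass) auto
    ultimately have "ds \<eta> (b *v x0) x0 \<le> inum \<eta> c + (2 * mass \<eta> M0 + mass \<eta> 0)" by simp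
    moreover have "b \<in> \<Gamma>" using k a by (simp add: b_def)
    ultimately show ?thesis using \<open>b \<in> c\<close> by blast
  qed
  show "\<exists>a u w v l. a \<in> c \<and> a \<in> \<Gamma> \<and> a \<noteq> mat 1 \<and> c = conjcl \<Gamma> a \<and> haxis a u w v l \<and> inum \<eta> c = measure (lm \<eta> u w) {0..<l}"
    using a h I conjcl_self by blast
qed

section \<open>Closing up orbit segments\<close>

lemma G_nontrivial: obtains a where "a \<in> \<Gamma>" "a \<noteq> mat 1"
proof -
  have "\<exists>a\<in>\<Gamma>. a \<noteq> mat 1"
  proof (rule ccontr)
    assume "\<not> ?thesis"
    then have triv: "\<And>a. a \<in> \<Gamma> \<Longrightarrow> a = mat 1" by blast
    \<comment> \<open>The first coordinate gets the sign opposite to that of \<open>x0\<close>, so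
      neither term of \<open>- lor x x0\<close> is negative and the first alone exceeds
      \<open>M0\<close>.\<close>
    define s where "s = (if x0$1 \<ge> 0 then - (M0 + 1) else M0 + 1)"
    define x where "x = (vector [s, 0, sqrt (1 + s\<^sup>2)] :: real^3)"
    have x: "x$1 = s" "x$2 = 0" "x$3 = sqrt (1 + s\<^sup>2)" by (simp_all add: x_def)
    have p: "1 + s\<^sup>2 > 0" by (smt (verit) zero_le_power2)
    have "x \<in> Hyp" using p by (simp add: Hyp_def lor_def x power2_eq_square)
    then have "- lor x x0 \<le> M0" using M0(2)[of x] triv by fastforce
    moreover have "- lor x x0 = sqrt (1 + s\<^sup>2) * x0$3 - s * x0$1" by (simp add: lor_def x)
    moreover have "s * x0$1 \<le> 0" using M0(1) by (auto simp: s_def mult_le_0_iff)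
    moreover have "x0$3 \<ge> 1"
    proof (rule power2_le_imp_le[of 1, simplified])
      have "(x0$3)\<^sup>2 = 1 + ((x0$1)\<^sup>2 + (x0$2)\<^sup>2)"
        using x0_Hyp by (simp add: Hyp_def lor_def power2_eq_square)
      then show "1 \<le> (x0$3)\<^sup>2" by simp
      show "0 \<le> x0$3" using Hyp_third_pos[OF x0_Hyp] by simp
    qed
    moreover have "sqrt (1 + s\<^sup>2) \<ge> M0 + 1"
      by (rule real_le_rsqrt) (auto simp: s_def power2_eq_square algebra_simps)
    moreover have "sqrt (1 + s\<^sup>2) * 1 \<le> sqrt (1 + s\<^sup>2) * x0$3"
      using \<open>x0$3 \<ge> 1\<close> by (intro mult_left_mono) auto
    ultimately show False by linarith
  qed
  then show ?thesis using that by blast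
qed

text \<open>A common end would make every element commute with \<open>a\<close>: the commutator
  fixes \<open>u\<close> itself and is trivial by \<open>no_null_fixed\<close>. The whole group then
  preserves the axis of \<open>a\<close>, so the orbit of \<open>x0\<close> stays at constant
  distance from it, against cocompactness.\<close>

lemma no_fixed_null_line:
  assumes "lor u u = 0" "u \<noteq> 0" "\<And>s. s \<in> \<Gamma> \<Longrightarrow> \<exists>k. s *v u = k *\<^sub>R u"
  shows False
proof -
  obtain a where a: "a \<in> \<Gamma>" "a \<noteq> mat 1" by (rule G_nontrivial)
  obtain u' w' v l where h: "haxis a u' w' v l" using haxis_exists[OF a] by blast
  note f = haxis_frame[OF h]
  have comm: "a ** b = b ** a" if b: "b \<in> \<Gamma>" for b
  proof -
    define d where "d = matrix_inv (b ** a) ** (a ** b)"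
    obtain k where k: "a *v u = k *\<^sub>R u" using assms(3) a by blast
    obtain j where j: "b *v u = j *\<^sub>R u" using assms(3) b by blast
    have "(a ** b) *v u = (b ** a) *v u"
      by (simp add: matrix_vector_mul_assoc[symmetric] k j matrix_vector_mult_scaleR)
    then have "d *v u = u" using a b by (simp add: d_def matrix_vector_mul_assoc[symmetric, of "matrix_inv _"])
    then have "d = mat 1" using no_null_fixed[of d u] assms a b by (auto simp: d_def)
    then have "(b ** a) ** d = b ** a" by simp
    then show ?thesis using a b by (simp add: d_def matrix_mul_assoc G_inv_right)
  qed
  have vinv: "b *v v = v \<or> b *v v = - v" if b: "b \<in> \<Gamma>" for b
  proof -
    have "a *v (b *v v) = b *v v"
      using comm[OF b] h by (simp add: matrix_vector_mul_assoc haxis_def) (metis matrix_vector_mul_assoc)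
    moreover have bv: "b *v v \<in> dS" using haxis_dS[OF h] SOplus_dS[OF G_SOplus[OF b]] by blast
    ultimately have "gd (b *v v) = gd v" using haxis_fixed_normal[OF h G_SOplus[OF a(1)]] by blast
    then show ?thesis using gd_eq_iff[OF haxis_dS[OF h] bv] by simp
  qed
  \<comment> \<open>One more than the value of \<open>\<bar>lor x v\<bar>\<close> that
    \<open>lor_dS_compare\<close> permits within \<open>M0\<close> of the orbit; \<open>x\<close> is
    a point at that height above the axis.\<close>
  define s where "s = M0 * (2 * \<bar>lor x0 v\<bar> + 1) + 1"
  let ?p = "hline u' w' 0"
  define x where "x = sqrt (1 + s\<^sup>2) *\<^sub>R ?p + s *\<^sub>R v"
  have p: "?p \<in> Hyp" "lor ?p v = 0" using hline_in_Hyp[OF frame_nullpair[OF f]] hline_orth[OF f] by blast+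
  have pv: "lor v ?p = 0" "lor ?p ?p = - 1" "lor v v = 1"
    using p(2) haxis_dS[OF h] lor_commute[of v ?p] Hyp_lor_self[OF p(1)] dS_lor_self by simp_all
  have sq: "1 + s\<^sup>2 > 0" by (smt (verit) zero_le_power2)
  have "lor x x = - 1" using p pv sq by (simp add: x_def power2_eq_square del: hline_0)
  moreover have "lor x ?p < 0" using pv sq by (simp add: x_def del: hline_0)
  ultimately have x: "x \<in> Hyp" using HypI_lor p by blast
  obtain b where b: "b \<in> \<Gamma>" "- lor x (b *v x0) \<le> M0" using M0(2)[OF x] by blast
  have "\<bar>lor (b *v x0) v\<bar> = \<bar>lor x0 v\<bar>"
  proof -
    have "lor (b *v x0) v = lor x0 (matrix_inv b *v v)" using b by (simp add: G_lor_inv)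
    then show ?thesis using vinv[OF G_inv[OF b(1)]] by auto
  qed
  moreover have "\<bar>lor x v\<bar> \<le> - lor (b *v x0) x * (2 * \<bar>lor (b *v x0) v\<bar> + 1)"
    using b x haxis_dS[OF h] by (intro lor_dS_compare) auto
  moreover have "- lor (b *v x0) x * (2 * \<bar>lor x0 v\<bar> + 1) \<le> M0 * (2 * \<bar>lor x0 v\<bar> + 1)"
    using b by (intro mult_right_mono) (auto simp: lor_commute)
  moreover have "lor x v = s" using p pv by (simp add: x_def del: hline_0)
  ultimately show False by (simp add: s_def)
qed

lemma null_parallel:
  assumes "lor u u = 0" "u \<noteq> 0" "lor z z = 0" "lor u z = 0"
  obtains k where "z = k *\<^sub>R u"
proof -
  have c: "lor x0 u \<noteq> 0" using orth_Hyp_null[OF x0_Hyp] assms by blast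
  define k where "k = lor x0 z / lor x0 u"
  have "lor x0 (z - k *\<^sub>R u) = 0" using c by (simp add: k_def)
  moreover have "lor (z - k *\<^sub>R u) (z - k *\<^sub>R u) = 0" using assms by (simp add: lor_commute)
  ultimately have "z - k *\<^sub>R u = 0" using orth_Hyp_null[OF x0_Hyp] by blast
  then show ?thesis using that[of k] by simp
qed

lemma trace_rank_one:
  fixes A :: "real^3^3"
  assumes "\<And>x. A *v x = f x *\<^sub>R u" "\<And>x y. f (x + y) = f x + f y" "\<And>c x. f (c *\<^sub>R x) = c * f x"
  shows "trace A = f u"
proof -
  let ?e = "\<lambda>i. Finite_Cartesian_Product.axis i 1 :: real^3"
  have "A $ i $ i = f (u $ i *\<^sub>R ?e i)" for i
  proof -
    have "A $ i $ i = (A *v ?e i) $ i" by (simp add: matrix_vector_mult_basis column_def)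
    then show ?thesis by (simp add: assms)
  qed
  then have "trace A = f (u $ 1 *\<^sub>R ?e 1 + u $ 2 *\<^sub>R ?e 2 + u $ 3 *\<^sub>R ?e 3)"
    by (simp add: trace_def sum_3 assms(2))
  also have "u $ 1 *\<^sub>R ?e 1 + u $ 2 *\<^sub>R ?e 2 + u $ 3 *\<^sub>R ?e 3 = u"
    by (rule vec3_eqI) (simp_all add: Finite_Cartesian_Product.axis_def)
  finally show ?thesis .
qed

text \<open>If no finite set of elements of the group closes up all orbit segments, then a limit of
  rescaled group elements is a rank one map whose image and kernel force the group to fix a
  null line.\<close>

lemma closing_trace:
  "\<exists>S c. finite S \<and> S \<subseteq> \<Gamma> \<and> c > 0 \<and> (\<forall>g\<in>\<Gamma>. \<exists>s\<in>S. c * - lor x0 (g *v x0) \<le> \<bar>trace (g ** s)\<bar>)"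
proof (rule ccontr)
  assume neg: "\<not> ?thesis"
  \<comment> \<open>Enumerating the group lets the negated claim be applied to the first
    \<open>n + 1\<close> elements with the constant \<open>1 / (n + 1)\<close>.\<close>
  define e where "e = from_nat_into \<Gamma>"
  have eG: "e i \<in> \<Gamma>" for i unfolding e_def using G_one by (intro from_nat_into) blast
  have esurj: "\<exists>i. e i = s" if "s \<in> \<Gamma>" for s
    using from_nat_into_surj[OF countable_G that] by (auto simp: e_def)
  have "\<exists>g\<in>\<Gamma>. \<forall>i\<le>n. \<bar>trace (g ** e i)\<bar> < 1 / (real n + 1) * - lor x0 (g *v x0)" for n :: nat
  proof -
    have "finite (e ` {..n})" "e ` {..n} \<subseteq> \<Gamma>" "1 / (real n + 1) > 0" using eG by auto
    then have "\<not> (\<forall>g\<in>\<Gamma>. \<exists>s\<in>e ` {..n}. 1 / (real n + 1) * - lor x0 (g *v x0) \<le> \<bar>trace (g ** s)\<bar>)"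
      using neg by blast
    then show ?thesis by (auto simp: not_le)
  qed
  then obtain g where g: "\<And>n. g n \<in> \<Gamma>"
    "\<And>n i. i \<le> n \<Longrightarrow> \<bar>trace (g n ** e i)\<bar> < 1 / (real n + 1) * - lor x0 (g n *v x0)"
    by metis
  define ch where "ch n = - lor x0 (g n *v x0)" for n
  have ch1: "ch n \<ge> 1" for n using Hyp_lor_le[of x0 "g n *v x0"] g(1) by (simp add: ch_def)
  have "filterlim ch at_top sequentially"
    unfolding filterlim_at_top
  proof
    fix B
    let ?F = "{a\<in>\<Gamma>. - lor x0 (a *v x0) \<le> B}"
    \<comment> \<open>A value \<open>h\<close> cannot recur forever: its inverse occurs in the
      enumeration, and the trace of the identity is 3.\<close>
    have "\<exists>N. \<forall>n\<ge>N. g n \<noteq> h" if h: "h \<in> \<Gamma>" for h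
    proof -
      obtain i where i: "e i = matrix_inv h" using esurj h by blast
      obtain N :: nat where N: "- lor x0 (h *v x0) < real N" using reals_Archimedean2 by blast
      have "g n \<noteq> h" if n: "n \<ge> max i N" for n
      proof
        assume gh: "g n = h"
        have "\<bar>trace (mat 1 :: real^3^3)\<bar> < 1 / (real n + 1) * - lor x0 (h *v x0)"
          using g(2)[of i n] n gh i G_inv_right[OF h] by simp
        moreover have "\<bar>trace (mat 1 :: real^3^3)\<bar> = 3" by (simp add: trace_def mat_def)
        moreover have "1 / (real n + 1) * - lor x0 (h *v x0) \<le> 1"
          using N n by (simp add: field_simps)
        ultimately show False by simp
      qed
      then show ?thesis by blast
    qed
    then have "\<forall>\<^sub>F n in sequentially. g n \<noteq> h" if "h \<in> \<Gamma>" for h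
      using that by (auto simp: eventually_sequentially)
    then have "\<forall>\<^sub>F n in sequentially. \<forall>h\<in>?F. g n \<noteq> h"
      by (intro eventually_ball_finite finite_displacement) auto
    then show "\<forall>\<^sub>F n in sequentially. B \<le> ch n"
      by eventually_elim (use g(1) in \<open>force simp: ch_def\<close>)
  qed
  then have th0: "(\<lambda>n. 1 / ch n) \<longlonglongrightarrow> 0"
    using tendsto_inverse_0_at_top by (simp add: inverse_eq_divide)
  obtain K where K: "K \<ge> 0" "\<And>a. a \<in> SOplus \<Longrightarrow> norm a \<le> K * - lor x0 (a *v x0)"
    using norm_SOplus_le[OF x0_Hyp] by blast
  \<comment> \<open>Elements and their inverses are rescaled together, so that the two limits are
    adjoint to each other for \<open>lor\<close>.\<close>
  define A' B' where "A' n = (1 / ch n) *\<^sub>R g n" and "B' n = (1 / ch n) *\<^sub>R matrix_inv (g n)" for n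
  have chinv: "- lor x0 (matrix_inv (g n) *v x0) = ch n" for n
    using G_lor_inv[OF g(1), of n x0 x0] by (simp add: ch_def lor_commute)
  have "norm (A' n) \<le> K" "norm (B' n) \<le> K" for n
  proof -
    have "norm (g n) \<le> K * ch n" "norm (matrix_inv (g n)) \<le> K * ch n"
      using K(2)[OF G_SOplus[OF g(1)], of n] K(2)[OF SOplus_inv[OF G_SOplus[OF g(1)]], of n] chinv[of n]
      by (simp_all add: ch_def)
    then show "norm (A' n) \<le> K" "norm (B' n) \<le> K"
      using ch1[of n] by (simp_all add: A'_def B'_def field_simps)
  qed
  then have "bounded (range (\<lambda>n. (A' n, B' n)))"
    by (intro bounded_subset[OF bounded_Times[OF bounded_cball[of 0 K] bounded_cball[of 0 K]]]) auto
  then obtain L r where r: "strict_mono r" "((\<lambda>n. (A' n, B' n)) \<circ> r) \<longlonglongrightarrow> L"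
    using bounded_imp_convergent_subsequence by blast
  define A B where "A = fst L" and "B = snd L"
  have A: "(\<lambda>n. A' (r n)) \<longlonglongrightarrow> A" and B: "(\<lambda>n. B' (r n)) \<longlonglongrightarrow> B"
    using tendsto_fst[OF r(2)] tendsto_snd[OF r(2)] by (simp_all add: o_def A_def B_def)
  have th: "(\<lambda>n. 1 / ch (r n)) \<longlonglongrightarrow> 0" using LIMSEQ_subseq_LIMSEQ[OF th0 r(1)] by (simp add: o_def)
  have sv: "(c *\<^sub>R M) *v x = c *\<^sub>R (M *v x)" for c and M :: "real^3^3" and x
    by (simp add: scaleR_matrix_vector_assoc)
  \<comment> \<open>The rescaled maps multiply \<open>lor\<close> by a factor tending to 0, so the
    image of the limit is totally isotropic, hence at most a line.\<close>
  have isoA: "lor (A *v x) (A *v y) = 0" for x y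
  proof -
    have "(\<lambda>n. lor (A' (r n) *v x) (A' (r n) *v y)) \<longlonglongrightarrow> lor (A *v x) (A *v y)"
      by (intro tendsto_intros A)
    moreover have "lor (A' n *v x) (A' n *v y) = (1 / ch n) * (1 / ch n) * lor x y" for n
      using g(1) by (simp add: A'_def sv G_lor)
    moreover have "(\<lambda>n. (1 / ch (r n)) * (1 / ch (r n)) * lor x y) \<longlonglongrightarrow> 0 * 0 * lor x y"
      by (intro tendsto_intros th)
    ultimately show ?thesis using LIMSEQ_unique by fastforce
  qed
  have isoB: "lor (B *v x) (B *v y) = 0" for x y
  proof -
    have "(\<lambda>n. lor (B' (r n) *v x) (B' (r n) *v y)) \<longlonglongrightarrow> lor (B *v x) (B *v y)"
      by (intro tendsto_intros B)
    moreover have "lor (B' n *v x) (B' n *v y) = (1 / ch n) * (1 / ch n) * lor x y" for n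
      using g(1) by (simp add: B'_def sv G_lor)
    moreover have "(\<lambda>n. (1 / ch (r n)) * (1 / ch (r n)) * lor x y) \<longlonglongrightarrow> 0 * 0 * lor x y"
      by (intro tendsto_intros th)
    ultimately show ?thesis using LIMSEQ_unique by fastforce
  qed
  have adj: "lor (B *v x) y = lor x (A *v y)" for x y
  proof -
    have "(\<lambda>n. lor (B' (r n) *v x) y) \<longlonglongrightarrow> lor (B *v x) y" by (intro tendsto_intros B)
    moreover have "lor (B' n *v x) y = lor x (A' n *v y)" for n
      using g(1) by (simp add: A'_def B'_def sv G_lor_inv')
    moreover have "(\<lambda>n. lor x (A' (r n) *v y)) \<longlonglongrightarrow> lor x (A *v y)" by (intro tendsto_intros A)
    ultimately show ?thesis using LIMSEQ_unique by fastforce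
  qed
  have "lor x0 (A *v x0) = - 1"
  proof -
    have "(\<lambda>n. lor x0 (A' (r n) *v x0)) \<longlonglongrightarrow> lor x0 (A *v x0)" by (intro tendsto_intros A)
    moreover have "lor x0 (A' n *v x0) = - 1" for n
    proof -
      have "lor x0 (A' n *v x0) = 1 / ch n * - ch n" by (simp only: A'_def sv lor_linear_right(3)) (simp add: ch_def)
      then show ?thesis using ch1[of n] by simp
    qed
    ultimately show ?thesis by (simp add: LIMSEQ_const_iff)
  qed
  define u q where "u = A *v x0" and "q = B *v x0"
  have u: "lor u u = 0" "u \<noteq> 0" "lor x0 u = - 1" using isoA \<open>lor x0 (A *v x0) = - 1\<close> by (auto simp: u_def)
  have q: "lor q q = 0" "q \<noteq> 0" using isoB adj[of x0 x0] \<open>lor x0 (A *v x0) = - 1\<close> by (auto simp: q_def)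
  \<comment> \<open>The range is spanned by the null vector \<open>u\<close>, and adjointness
    expresses the coefficient through the null vector \<open>q\<close> in the image of
    \<open>B\<close>.\<close>
  have Ax: "A *v x = (- lor q x) *\<^sub>R u" for x
  proof -
    obtain k where k: "A *v x = k *\<^sub>R u" using null_parallel[OF u(1,2), of "A *v x"] isoA by (auto simp: u_def)
    then have "lor q x = - k" using adj[of x0 x] u(3) by (simp add: q_def)
    with k show ?thesis by simp
  qed
  have tr0: "trace (A ** s) = 0" if s: "s \<in> \<Gamma>" for s
  proof -
    obtain i where i: "e i = s" using esurj s by blast
    have "(\<lambda>n. trace (A' (r n) ** s)) \<longlonglongrightarrow> trace (A ** s)"
      unfolding trace_def by (intro tendsto_intros A)
    moreover have "(\<lambda>n. trace (A' (r n) ** s)) \<longlonglongrightarrow> 0"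
    proof (rule Lim_null_comparison)
      show "(\<lambda>n. 1 / (real (r n) + 1)) \<longlonglongrightarrow> 0"
        using LIMSEQ_subseq_LIMSEQ[OF LIMSEQ_Suc[OF lim_inverse_n'] r(1)] by (simp add: o_def add.commute)
      show "\<forall>\<^sub>F n in sequentially. norm (trace (A' (r n) ** s)) \<le> 1 / (real (r n) + 1)"
        unfolding eventually_sequentially
      proof (intro exI[of _ i] allI impI)
        fix n assume "i \<le> n"
        then have "i \<le> r n" using seq_suble[OF r(1), of n] by linarith
        then have "\<bar>trace (g (r n) ** s)\<bar> \<le> 1 / (real (r n) + 1) * ch (r n)"
          using g(2)[of i "r n"] i by (simp add: ch_def)
        moreover have "trace (A' (r n) ** s) = trace (g (r n) ** s) / ch (r n)"
          by (simp add: A'_def trace_def matrix_matrix_mult_def sum_3 field_simps add_divide_distrib)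
        ultimately show "norm (trace (A' (r n) ** s)) \<le> 1 / (real (r n) + 1)"
          using ch1[of "r n"] by (simp add: pos_divide_le_eq)
      qed
    qed
    ultimately show ?thesis using LIMSEQ_unique by blast
  qed
  have qs: "lor q (s *v u) = 0" if s: "s \<in> \<Gamma>" for s
  proof -
    have "trace (A ** s) = - lor q (s *v u)"
      by (rule trace_rank_one) (simp_all add: matrix_vector_mul_assoc[symmetric] Ax vec.add matrix_vector_mult_scaleR)
    then show ?thesis using tr0[OF s] by simp
  qed
  \<comment> \<open>Orthogonal null vectors are parallel, so the whole group maps \<open>u\<close>
    into the line of \<open>q\<close>; taking the identity shows that this is the line of
    \<open>u\<close>.\<close>
  have "\<exists>k. s *v u = k *\<^sub>R q" if s: "s \<in> \<Gamma>" for s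
    using null_parallel[OF q, of "s *v u"] qs[OF s] s u by (metis G_lor)
  moreover obtain j where j: "u = j *\<^sub>R q" using calculation[OF G_one] by auto
  moreover have "j \<noteq> 0" using j u by auto
  ultimately have "\<exists>k. s *v u = k *\<^sub>R u" if s: "s \<in> \<Gamma>" for s
  proof -
    obtain k where "s *v u = k *\<^sub>R q" using \<open>\<And>s. s \<in> \<Gamma> \<Longrightarrow> \<exists>k. s *v u = k *\<^sub>R q\<close> s by blast
    moreover have "q = (1 / j) *\<^sub>R u" using \<open>j \<noteq> 0\<close> by (subst j) simp
    ultimately show ?thesis by (metis scaleR_scaleR)
  qed
  then show False using no_fixed_null_line[OF u(1,2)] by blast
qed

text \<open>By \<open>haxis_trace\<close> the trace bound makes \<open>cosh l\<close> comparable to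
  the displacement at \<open>x0\<close>, and \<open>haxis_displacement\<close> converts this into a
  bound for the distance from \<open>x0\<close> to the axis.\<close>

lemma closing:
  "\<exists>S c r. finite S \<and> S \<subseteq> \<Gamma> \<and> c > 0 \<and> r \<ge> 0 \<and> (\<forall>g\<in>\<Gamma>. \<exists>s\<in>S. c * - lor x0 (g *v x0) \<le> \<bar>trace (g ** s)\<bar>
     \<and> (\<forall>u w v l. g ** s \<noteq> mat 1 \<longrightarrow> haxis (g ** s) u w v l \<longrightarrow> \<bar>lor x0 v\<bar> \<le> r))"
proof -
  obtain S c where S: "finite S" "S \<subseteq> \<Gamma>" "c > 0"
    "\<And>g. g \<in> \<Gamma> \<Longrightarrow> \<exists>s\<in>S. c * - lor x0 (g *v x0) \<le> \<bar>trace (g ** s)\<bar>"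
    using closing_trace by blast
  define B where "B = Max (insert 1 ((\<lambda>s. - lor x0 (s *v x0)) ` S))"
  have B: "B \<ge> 1" "\<And>s. s \<in> S \<Longrightarrow> - lor x0 (s *v x0) \<le> B" using S(1) by (auto simp: B_def)
  \<comment> \<open>\<open>6 * B / c\<close> bounds the ratio of displacement to
    \<open>cosh l\<close>, with \<open>6 = 2 * 3\<close> from \<open>lor_triangle\<close> and
    \<open>1 + 2 * cosh l \<le> 3 * cosh l\<close>; the last factor bounds
    \<open>cosh l / (cosh l - 1)\<close> by means of \<open>cosh l \<ge> 1 + e0\<close>.\<close>
  define D where "D = 6 * B / c * (1 + 1 / e0)"
  have D: "D \<ge> 0" using B S e0 by (simp add: D_def)
  have "\<bar>lor x0 v\<bar> \<le> sqrt D"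
    if g: "g \<in> \<Gamma>" "s \<in> S" "c * - lor x0 (g *v x0) \<le> \<bar>trace (g ** s)\<bar>" "g ** s \<noteq> mat 1" "haxis (g ** s) u w v l"
    for g s u w v l
  proof -
    have sG: "s \<in> \<Gamma>" using g S by blast
    let ?k = "(lor x0 v)\<^sup>2" and ?C = "cosh l"
    have C: "?C \<ge> 1 + e0" using haxis_length[OF g(5)] g sG by simp
    have "- lor x0 ((g ** s) *v x0) \<le> 2 * (- lor x0 (g *v x0) * - lor (g *v x0) (g *v (s *v x0)))"
      using lor_triangle(1)[of x0 "g *v x0" "g *v (s *v x0)"] g sG by (simp add: matrix_vector_mul_assoc)
    also have "\<dots> \<le> 2 * (- lor x0 (g *v x0) * B)"
      using B(2)[OF g(2)] Hyp_lor_le[of x0 "g *v x0"] g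
      by (intro mult_left_mono) (auto simp: G_lor)
    finally have "c * - lor x0 ((g ** s) *v x0) \<le> c * (2 * (- lor x0 (g *v x0) * B))"
      using S(3) by (intro mult_left_mono) auto
    also have "\<dots> = 2 * B * (c * - lor x0 (g *v x0))" by simp
    also have "\<dots> \<le> 2 * B * (1 + 2 * ?C)"
      using g(3) haxis_trace[OF g(5)] B C e0(1) by (intro mult_left_mono) auto
    also have "\<dots> \<le> 2 * B * (3 * ?C)" using B C e0(1) by (intro mult_left_mono) auto
    finally have "c * ((1 + ?k) * ?C - ?k) \<le> 6 * B * ?C"
      using haxis_displacement[OF g(5) x0_Hyp] by simp
    then have "(1 + ?k) * ?C - ?k \<le> 6 * B / c * ?C" using S(3) by (simp add: field_simps)
    moreover have "(1 + ?k) * ?C - ?k = ?C + ?k * (?C - 1)" by (simp add: algebra_simps)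
    ultimately have "?k * (?C - 1) \<le> 6 * B / c * ?C" using C e0(1) by linarith
    moreover have "?C \<le> (1 + 1 / e0) * (?C - 1)" using C e0(1) by (simp add: field_simps)
    then have "6 * B / c * ?C \<le> 6 * B / c * ((1 + 1 / e0) * (?C - 1))"
      using B S(3) by (intro mult_left_mono) auto
    ultimately have "?k * (?C - 1) \<le> D * (?C - 1)" by (simp add: D_def)
    then have "?k \<le> D" using C e0(1) by (simp add: mult_le_cancel_right)
    then show ?thesis by (simp add: real_le_rsqrt)
  qed
  then have "\<exists>s\<in>S. c * - lor x0 (g *v x0) \<le> \<bar>trace (g ** s)\<bar>
     \<and> (\<forall>u w v l. g ** s \<noteq> mat 1 \<longrightarrow> haxis (g ** s) u w v l \<longrightarrow> \<bar>lor x0 v\<bar> \<le> sqrt D)" if "g \<in> \<Gamma>" for g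
    using S(4)[OF that] that by blast
  then show ?thesis
    by (intro exI[of _ S] exI[of _ c] exI[of _ "sqrt D"] conjI ballI S(1-3)) (use D in auto)
qed

end

section \<open>Filling currents dominate the hyperbolic length\<close>

lemma transverse_crosses:
  assumes "frame u w v" "n \<in> dS" "transverse (gd v) (gd n)"
  shows "crosses u w n"
proof -
  have v: "v \<in> dS" using assms(1) by (simp add: frame_def)
  have T: "transverse (gd n) (gd v)" using assms(3) by (auto simp: transverse_def)
  then have "gd n \<inter> gd v = {ipt (lcross n v)}" using gd_Int_gd[OF assms(2) v] by blast
  then have "gd n \<in> gset (\<lambda>n. crosses u w n \<and> hline u w (ctime u w n) \<in> UNIV)"
    using transverse_slice[OF assms(1), of UNIV] T by blast
  moreover have "evenp (\<lambda>n. crosses u w n \<and> hline u w (ctime u w n) \<in> UNIV)" by (simp add: evenp_def)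
  ultimately show ?thesis using gd_in_gset assms(2) by blast
qed

lemma openin_gd_image: assumes "open N" shows "openin geod_top (gd ` (N \<inter> dS))"
proof -
  have "{n \<in> dS. gd n \<in> gd ` (N \<inter> dS)} = dS \<inter> (N \<union> uminus -` N)"
  proof (intro set_eqI iffI)
    fix n assume "n \<in> {n \<in> dS. gd n \<in> gd ` (N \<inter> dS)}"
    then obtain m where m: "n \<in> dS" "m \<in> N" "m \<in> dS" "gd n = gd m" by auto
    then have "m = n \<or> m = - n" using gd_eq_iff by blast
    with m show "n \<in> dS \<inter> (N \<union> uminus -` N)" by auto
  next
    fix n assume "n \<in> dS \<inter> (N \<union> uminus -` N)"
    then consider "n \<in> dS" "n \<in> N" | "n \<in> dS" "- n \<in> N" by auto
    then show "n \<in> {n \<in> dS. gd n \<in> gd ` (N \<inter> dS)}"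
    proof cases
      case 2
      then have "gd (- n) \<in> gd ` (N \<inter> dS)" using dS_uminus by blast
      with 2 show ?thesis by (simp add: gd_uminus)
    qed auto
  qed
  moreover have "open (N \<union> uminus -` N)"
    using assms by (intro open_Un open_vimage continuous_intros)
  ultimately show ?thesis by (auto simp: openin_geod_top openin_open)
qed

context surface
begin

text \<open>Suppose longer and longer windows carry less and less mass. Translated near
  \<open>x0\<close>, the lines subconverge to a line, which crosses a geodesic of the support.
  Crossing within bounded time is an open condition on the pair, so a neighbourhood of that
  geodesic, of fixed positive mass, crosses all late lines of the subsequence inside their
  windows.\<close>

lemma filling_crossing:
  assumes "\<eta> \<in> Curr \<Gamma>" "filling \<eta>"
  shows "\<exists>L>0. \<exists>e>0. \<forall>u w. nullpair u w \<longrightarrow> e \<le> measure (lm \<eta> u w) {- L..L}"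
proof (rule ccontr)
  assume neg: "\<not> ?thesis"
  have "\<exists>u w. nullpair u w \<and> - lor x0 (u + w) \<le> M0 \<and> measure (lm \<eta> u w) {- (real n + 1)..real n + 1} < 1 / (real n + 1)"
    for n :: nat
  proof -
    have "\<not> (\<forall>u w. nullpair u w \<longrightarrow> 1 / (real n + 1) \<le> measure (lm \<eta> u w) {- (real n + 1)..real n + 1})"
    proof
      assume "\<forall>u w. nullpair u w \<longrightarrow> 1 / (real n + 1) \<le> measure (lm \<eta> u w) {- (real n + 1)..real n + 1}"
      moreover have "real n + 1 > 0" "1 / (real n + 1) > 0" by simp_all
      ultimately show False using neg by blast
    qed
    then obtain u w where uw: "nullpair u w" "measure (lm \<eta> u w) {- (real n + 1)..real n + 1} < 1 / (real n + 1)"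
      by (auto simp: not_le)
    have H: "u + w \<in> Hyp" using uw(1) by (simp add: nullpair_def)
    obtain a where a: "a \<in> \<Gamma>" "- lor (u + w) (a *v x0) \<le> M0" using M0(2)[OF H] by blast
    let ?b = "matrix_inv a"
    have b: "?b \<in> \<Gamma>" using a by simp
    have "nullpair (?b *v u) (?b *v w)" using nullpair_image G_SOplus b uw by blast
    moreover have "- lor x0 (?b *v u + ?b *v w) \<le> M0"
      using a G_lor_inv'[OF a(1), of "u + w" x0] lor_commute[of x0] by (simp only: vec.add)
    moreover have "measure (lm \<eta> (?b *v u) (?b *v w)) {- (real n + 1)..real n + 1}
        = measure (lm \<eta> u w) {- (real n + 1)..real n + 1}"
      using emeasure_lm_image[OF assms(1) b, of "{- (real n + 1)..real n + 1}" u w] by (simp add: measure_def)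
    ultimately show ?thesis using uw(2) by metis
  qed
  then obtain U W where UW: "\<And>n. nullpair (U n) (W n)" "\<And>n. - lor x0 (U n + W n) \<le> M0"
    "\<And>n. measure (lm \<eta> (U n) (W n)) {- (real n + 1)..real n + 1} < 1 / (real n + 1)"
    by metis
  \<comment> \<open>A line is encoded by its base point \<open>u + w\<close> and unit tangent
    \<open>u - w\<close>, which range over compact sets.\<close>
  let ?P = "{k\<in>Hyp. - lor x0 k \<le> M0}" and ?Q = "{n\<in>dS. \<bar>lor x0 n\<bar> \<le> M0}"
  have "compact (?P \<times> ?Q)" by (intro compact_Times compact_Hyp_near compact_dS_near) simp_all
  moreover have "(U n + W n, U n - W n) \<in> ?P \<times> ?Q" for n
  proof -
    note np = UW(1)[of n]
    have H: "U n + W n \<in> Hyp" using np by (simp add: nullpair_def)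
    have d: "U n - W n \<in> dS" "lor (U n + W n) (U n - W n) = 0" using nullpairD[OF np] by (simp_all add: dS_def)
    have "\<bar>lor x0 (U n - W n)\<bar> \<le> - lor (U n + W n) x0 * (2 * \<bar>lor (U n + W n) (U n - W n)\<bar> + 1)"
      by (rule lor_dS_compare[OF H x0_Hyp d(1)])
    also have "\<dots> = - lor x0 (U n + W n)" by (simp only: d(2) lor_commute[of "U n + W n" x0]) simp
    finally show ?thesis using UW(2)[of n] H d(1) by auto
  qed
  ultimately obtain pq r where pq: "pq \<in> ?P \<times> ?Q" "strict_mono r"
      "((\<lambda>n. (U n + W n, U n - W n)) \<circ> r) \<longlonglongrightarrow> pq"
    unfolding compact_def by (metis (no_types, lifting))
  define p q where "p = fst pq" and "q = snd pq"
  have pl: "(\<lambda>n. U (r n) + W (r n)) \<longlonglongrightarrow> p" and ql: "(\<lambda>n. U (r n) - W (r n)) \<longlonglongrightarrow> q"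
    using tendsto_fst[OF pq(3)] tendsto_snd[OF pq(3)] by (simp_all add: o_def p_def q_def)
  have p: "p \<in> Hyp" and q: "q \<in> dS" using pq(1) by (auto simp: p_def q_def)
  have "lor p q = 0"
  proof -
    have "(\<lambda>n. lor (U (r n) + W (r n)) (U (r n) - W (r n))) \<longlonglongrightarrow> lor p q" by (intro tendsto_lor pl ql)
    moreover have "lor (U n + W n) (U n - W n) = 0" for n using nullpairD[OF UW(1)] by simp
    ultimately show ?thesis by (simp only: LIMSEQ_const_iff)
  qed
  then have pq0: "lor p q = 0" "lor q p = 0" by (simp_all add: lor_commute)
  define u w where "u = (1/2) *\<^sub>R (p + q)" and "w = (1/2) *\<^sub>R (p - q)"
  have "u + w = p" by (simp add: u_def w_def vec_eq_iff field_simps)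
  then have np: "nullpair u w"
    using p q pq0 by (simp add: nullpair_def u_def w_def Hyp_lor_self dS_lor_self)
  have ul: "(\<lambda>n. U (r n)) \<longlonglongrightarrow> u"
  proof -
    have "(\<lambda>n. (1/2) *\<^sub>R ((U (r n) + W (r n)) + (U (r n) - W (r n)))) \<longlonglongrightarrow> u"
      unfolding u_def by (intro tendsto_intros pl ql)
    moreover have "(1/2) *\<^sub>R ((U n + W n) + (U n - W n)) = U n" for n by (simp add: vec_eq_iff)
    ultimately show ?thesis by simp
  qed
  have wl: "(\<lambda>n. W (r n)) \<longlonglongrightarrow> w"
  proof -
    have "(\<lambda>n. (1/2) *\<^sub>R ((U (r n) + W (r n)) - (U (r n) - W (r n)))) \<longlonglongrightarrow> w"
      unfolding w_def by (intro tendsto_intros pl ql)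
    moreover have "(1/2) *\<^sub>R ((U n + W n) - (U n - W n)) = W n" for n by (simp add: vec_eq_iff)
    ultimately show ?thesis by simp
  qed
  obtain v where f: "frame u w v" using nullpair_frame[OF np] by blast
  have "gd v \<in> Geod" using f by (simp add: frame_def)
  then obtain h where h: "h \<in> supp \<eta>" "transverse (gd v) h" using assms(2) by (auto simp: filling_def)
  then obtain m where m: "m \<in> dS" "h = gd m" by (auto simp: supp_def elim: GeodE)
  have c: "crosses u w m" using transverse_crosses[OF f m(1)] h m by simp
  define T where "T = \<bar>ctime u w m\<bar> + 1"
  \<comment> \<open>Crossing at a time of absolute value below \<open>T\<close>, written without the
    quotient and logarithm of \<open>ctime\<close> as strict polynomial inequalities, so that
    openness is evident.\<close>
  define O' :: "(((real^3) \<times> (real^3)) \<times> (real^3)) set" where "O' = {x. lor (fst (fst x)) (snd x) * lor (snd (fst x)) (snd x) < 0}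
     \<inter> {x. exp (- 2 * T) * (lor (fst (fst x)) (snd x))\<^sup>2 < - (lor (fst (fst x)) (snd x) * lor (snd (fst x)) (snd x))}
     \<inter> {x. - (lor (fst (fst x)) (snd x) * lor (snd (fst x)) (snd x)) < exp (2 * T) * (lor (fst (fst x)) (snd x))\<^sup>2}"
  have O'_iff: "((u', w'), n) \<in> O' \<longleftrightarrow> crosses u' w' n \<and> \<bar>ctime u' w' n\<bar> < T" for u' w' n
  proof (cases "crosses u' w' n")
    case True
    let ?\<alpha> = "lor u' n" and ?\<beta> = "lor w' n"
    have a: "?\<alpha> \<noteq> 0" using True by (auto simp: crosses_def)
    have pos: "- ?\<beta> / ?\<alpha> > 0" using True
      by (auto simp: crosses_def mult_less_0_iff divide_less_0_iff zero_less_divide_iff)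
    have e: "- (?\<alpha> * ?\<beta>) = (- ?\<beta> / ?\<alpha>) * ?\<alpha>\<^sup>2" using a by (simp add: power2_eq_square)
    have a2: "?\<alpha>\<^sup>2 > 0" using a by simp
    have "exp (- 2 * T) * ?\<alpha>\<^sup>2 < - (?\<alpha> * ?\<beta>) \<longleftrightarrow> exp (- 2 * T) < - ?\<beta> / ?\<alpha>"
      unfolding e using a2 by (simp only: mult_less_cancel_right_pos)
    also have "\<dots> \<longleftrightarrow> - 2 * T < ln (- ?\<beta> / ?\<alpha>)" using pos by (metis exp_less_cancel_iff exp_ln)
    finally have 1: "exp (- 2 * T) * ?\<alpha>\<^sup>2 < - (?\<alpha> * ?\<beta>) \<longleftrightarrow> - T < ctime u' w' n" by (auto simp: ctime_def)
    have "- (?\<alpha> * ?\<beta>) < exp (2 * T) * ?\<alpha>\<^sup>2 \<longleftrightarrow> - ?\<beta> / ?\<alpha> < exp (2 * T)"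
      unfolding e using a2 by (simp only: mult_less_cancel_right_pos)
    also have "\<dots> \<longleftrightarrow> ln (- ?\<beta> / ?\<alpha>) < 2 * T" using pos by (metis exp_less_cancel_iff exp_ln)
    finally have 2: "- (?\<alpha> * ?\<beta>) < exp (2 * T) * ?\<alpha>\<^sup>2 \<longleftrightarrow> ctime u' w' n < T" by (auto simp: ctime_def)
    show ?thesis using True 1 2 by (auto simp: O'_def crosses_def)
  qed (auto simp: O'_def crosses_def)
  have "open O'" unfolding O'_def
    by (intro open_Int open_Collect_less continuous_intros)
  moreover have "((u, w), m) \<in> O'" unfolding O'_iff using c by (simp add: T_def)
  ultimately obtain A N where AN: "open A" "open N" "(u, w) \<in> A" "m \<in> N" "A \<times> N \<subseteq> O'"
    by (metis mem_Sigma_iff open_prod_elim)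
  let ?V = "gd ` (N \<inter> dS)"
  have V: "openin geod_top ?V" by (rule openin_gd_image[OF AN(2)])
  have "gd m \<in> ?V" using m AN by blast
  then have Vpos: "emeasure \<eta> ?V > 0" using h V m by (auto simp: supp_def)
  have Vs: "?V \<in> sets \<eta>" using sets_GeodM_open[OF V] Curr_sets[OF assms(1)] by simp
  have Vk: "?V \<subseteq> gset (\<lambda>n. crosses (U k) (W k) n \<and> ctime (U k) (W k) n \<in> {- (real k + 1)..real k + 1})"
    if k: "(U k, W k) \<in> A" "T \<le> real k + 1" for k
  proof
    fix g assume "g \<in> ?V"
    then obtain n where n: "n \<in> N" "n \<in> dS" "g = gd n" by blast
    then have "((U k, W k), n) \<in> O'" using AN k by blast
    then have "crosses (U k) (W k) n \<and> ctime (U k) (W k) n \<in> {- (real k + 1)..real k + 1}"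
      unfolding O'_iff using k by auto
    moreover have "evenp (\<lambda>n. crosses (U k) (W k) n \<and> ctime (U k) (W k) n \<in> {- (real k + 1)..real k + 1})"
      by (simp add: evenp_def)
    ultimately show "g \<in> gset (\<lambda>n. crosses (U k) (W k) n \<and> ctime (U k) (W k) n \<in> {- (real k + 1)..real k + 1})"
      using n gd_in_gset by blast
  qed
  have fin: "gset (\<lambda>n. crosses (U k) (W k) n \<and> ctime (U k) (W k) n \<in> {- (real k + 1)..real k + 1}) \<in> fmeasurable \<eta>" for k
    using lm_fmeasurable[OF assms(1) UW(1)[of k], of "{- (real k + 1)..real k + 1}" "- (real k + 1)" "real k + 1"]
      emeasure_lm[OF assms(1), of "{- (real k + 1)..real k + 1}" "U k" "W k"]
    by (auto simp: fmeasurable_def intro!: Curr_gset_sets[OF assms(1)])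
  have meas: "measure \<eta> ?V < 1 / (real k + 1)" if k: "(U k, W k) \<in> A" "T \<le> real k + 1" for k
  proof -
    have "measure \<eta> ?V \<le> measure (lm \<eta> (U k) (W k)) {- (real k + 1)..real k + 1}"
      unfolding measure_lm[OF assms(1) borel_closed[OF closed_real_atLeastAtMost]]
      by (rule measure_mono_fmeasurable[OF Vk[OF k] Vs fin])
    then show ?thesis using UW(3)[of k] by simp
  qed
  have ev: "\<forall>\<^sub>F n in sequentially. (U (r n), W (r n)) \<in> A \<and> T \<le> real (r n) + 1"
  proof (intro eventually_conj)
    show "\<forall>\<^sub>F n in sequentially. (U (r n), W (r n)) \<in> A"
      using topological_tendstoD[OF tendsto_Pair[OF ul wl] AN(1,3)] .
    obtain N' :: nat where "T \<le> real N'" using real_arch_simple by blast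
    then show "\<forall>\<^sub>F n in sequentially. T \<le> real (r n) + 1"
      unfolding eventually_sequentially using seq_suble[OF pq(2)]
      by (intro exI[of _ N']) (metis add_increasing2 of_nat_mono order_trans zero_le_one)
  qed
  obtain k0 where k0: "(U k0, W k0) \<in> A" "T \<le> real k0 + 1"
    using ev by (auto simp: eventually_sequentially)
  have "?V \<in> fmeasurable \<eta>" using fmeasurableI2[OF fin Vk[OF k0] Vs] .
  then have mpos: "measure \<eta> ?V > 0" using Vpos by (simp add: emeasure_eq_measure2)
  then obtain N' :: nat where N': "1 / measure \<eta> ?V < real N'" using reals_Archimedean2 by blast
  have "\<forall>\<^sub>F n in sequentially. n \<ge> N'" by (rule eventually_ge_at_top)
  from eventually_conj[OF ev this] obtain n where n: "(U (r n), W (r n)) \<in> A" "T \<le> real (r n) + 1" "n \<ge> N'"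
    by (auto simp: eventually_sequentially)
  have "real N' \<le> real (r n) + 1" using n(3) seq_suble[OF pq(2), of n] by linarith
  then have "1 / measure \<eta> ?V < real (r n) + 1" using N' by linarith
  then have "1 / (real (r n) + 1) < measure \<eta> ?V" using mpos by (simp add: field_simps)
  then show False using meas[OF n(1,2)] by simp
qed

lemma filling_length:
  assumes "\<eta> \<in> Curr \<Gamma>" "filling \<eta>"
  obtains A B where "A > 0" "B > 0" "\<And>u w l. nullpair u w \<Longrightarrow> l \<ge> 0 \<Longrightarrow> l \<le> A * measure (lm \<eta> u w) {0..<l} + B"
proof -
  obtain L e where L: "L > 0" "e > 0" "\<And>u w. nullpair u w \<Longrightarrow> e \<le> measure (lm \<eta> u w) {- L..L}"
    using filling_crossing[OF assms] by blast
  \<comment> \<open>One more than the length of a window, so that a half-open interval of length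
    \<open>P\<close> contains a closed window; such intervals tile the line.\<close>
  define P where "P = 2 * L + 1"
  have P: "P > 0" using L by (simp add: P_def)
  have seg: "e \<le> measure (lm \<eta> u w) {s..<s + P}" if np: "nullpair u w" for u w s
  proof -
    have "e \<le> measure (lm \<eta> (exp (s + L) *\<^sub>R u) (exp (- (s + L)) *\<^sub>R w)) {- L..L}"
      by (rule L(3)) (rule nullpair_shift[OF np])
    also have "\<dots> = measure (lm \<eta> u w) {t. t - (s + L) \<in> {- L..L}}"
      using emeasure_lm_shift[OF assms(1), of "{- L..L}" "s + L" u w] by (simp add: measure_def)
    also have "{t. t - (s + L) \<in> {- L..L}} = {s..s + 2 * L}" by auto
    also have "measure (lm \<eta> u w) {s..s + 2 * L} \<le> measure (lm \<eta> u w) {s..<s + P}"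
      by (rule measure_mono_fmeasurable)
        (auto intro!: lm_fmeasurable[OF assms(1) np, of _ s "s + P"] simp: P_def)
    finally show ?thesis .
  qed
  have many: "real n * e \<le> measure (lm \<eta> u w) {0..<real n * P}" if np: "nullpair u w" for u w n
  proof (induction n)
    case (Suc n)
    have "measure (lm \<eta> u w) {0..<real n * P + P}
      = measure (lm \<eta> u w) {0..<real n * P} + measure (lm \<eta> u w) {real n * P..<real n * P + P}"
      using P by (intro measure_lm_split[OF assms(1) np]) auto
    then show ?case using Suc seg[OF np, of "real n * P"] by (simp add: algebra_simps)
  qed simp
  show ?thesis
  proof (rule that[of "P / e" P])
    show "P / e > 0" "P > 0" using P L by simp_all
    fix u w and l :: real assume np: "nullpair u w" and l: "l \<ge> 0"
    define n where "n = nat \<lfloor>l / P\<rfloor>"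
    have "real n \<le> l / P" "l / P < real n + 1" using l P by (simp_all add: n_def)
    then have n: "real n * P \<le> l" "l < (real n + 1) * P" using P by (simp_all only: pos_le_divide_eq pos_divide_less_eq)
    have "real n * e \<le> measure (lm \<eta> u w) {0..<real n * P}" by (rule many[OF np])
    also have "\<dots> \<le> measure (lm \<eta> u w) {0..<l}"
      by (rule measure_mono_fmeasurable) (use n in \<open>auto intro!: lm_fmeasurable[OF assms(1) np, of _ 0 l]\<close>)
    finally have "real n \<le> measure (lm \<eta> u w) {0..<l} / e" using L by (simp add: pos_le_divide_eq)
    then have "real n * P \<le> measure (lm \<eta> u w) {0..<l} / e * P" using P by (intro mult_right_mono) auto
    then show "l \<le> P / e * measure (lm \<eta> u w) {0..<l} + P" using n(2) by (simp add: algebra_simps)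
  qed
qed

lemma filling_orbit_length:
  assumes "\<eta> \<in> Curr \<Gamma>" "filling \<eta>"
  obtains A B where "A > 0" "B > 0" "\<And>x y l. x \<in> Hyp \<Longrightarrow> y \<in> Hyp \<Longrightarrow> l \<ge> 0 \<Longrightarrow> cosh l = - lor x y \<Longrightarrow> l \<le> A * ds \<eta> x y + B"
proof -
  obtain A B where AB: "A > 0" "B > 0" "\<And>u w l. nullpair u w \<Longrightarrow> l \<ge> 0 \<Longrightarrow> l \<le> A * measure (lm \<eta> u w) {0..<l} + B"
    using filling_length[OF assms] by blast
  show ?thesis
  proof (rule that[OF AB(1,2)])
    fix x y and l :: real assume xy: "x \<in> Hyp" "y \<in> Hyp" and l: "l \<ge> 0" "cosh l = - lor x y"
    show "l \<le> A * ds \<eta> x y + B"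
    proof (cases "x = y")
      case True
      then have "cosh l = cosh 0" using l xy by (simp add: Hyp_lor_self)
      then have "l = 0" by (simp add: cosh_real_one_iff)
      then show ?thesis using AB by simp
    next
      case False
      obtain u w l' where l': "nullpair u w" "l' > 0" "hline u w 0 = x" "hline u w l' = y" "cosh l' = - lor x y"
        using nullpair_through[OF xy False] by metis
      have "l = l'" using l l' cosh_real_nonneg_le_iff[of l l'] cosh_real_nonneg_le_iff[of l' l] by simp
      have "measure (lm \<eta> u w) {0..<l} \<le> measure (lm \<eta> u w) {0..l}"
        by (rule measure_mono_fmeasurable) (auto intro!: lm_fmeasurable[OF assms(1) l'(1), of _ 0 l])
      also have "\<dots> = ds \<eta> x y" using ds_hline[OF assms(1), of 0 l u w] l' \<open>l = l'\<close> by simp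
      finally have "A * measure (lm \<eta> u w) {0..<l} \<le> A * ds \<eta> x y" using AB by simp
      then show ?thesis using AB(3)[OF l'(1) l(1)] by linarith
    qed
  qed
qed

section \<open>Orbit growth\<close>

text \<open>A crude exponential bound: following a segment of length \<open>n\<close> in unit steps,
  successive nearby orbit points differ by elements of a fixed finite set, so the group elements in
  question are words of length \<open>n + 1\<close> in that set.\<close>

lemma orbit_growth:
  obtains N :: nat where "N \<ge> 1" "\<And>n. card {g\<in>\<Gamma>. - lor x0 (g *v x0) \<le> cosh (real n)} \<le> N ^ (n + 1)"
proof -
  \<comment> \<open>The bound of \<open>displacement_compare\<close> for two orbit points within
    \<open>M0\<close> of points at distance at most 1.\<close>
  let ?F = "{b\<in>\<Gamma>. - lor x0 (b *v x0) \<le> 4 * M0 * M0 * cosh 1}"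
  define W where "W n = ((\<lambda>S. (\<lambda>(a, b). a ** b) ` (S \<times> ?F)) ^^ n) {mat 1}" for n
  have W0: "W 0 = {mat 1}" and WSuc: "W (Suc n) = (\<lambda>(a, b). a ** b) ` (W n \<times> ?F)" for n
    by (simp_all add: W_def)
  have finF: "finite ?F" by (rule finite_displacement)
  have WG: "W n \<subseteq> \<Gamma>" for n
    by (induction n) (auto simp: W0 WSuc)
  have finW: "finite (W n)" for n by (induction n) (auto simp: W0 WSuc finF)
  have cardW: "card (W n) \<le> card ?F ^ n" for n
  proof (induction n)
    case (Suc n)
    have "card (W (Suc n)) \<le> card (W n \<times> ?F)" unfolding WSuc by (rule card_image_le) (simp add: finW finF)
    also have "\<dots> \<le> card ?F ^ n * card ?F" using Suc by (simp add: card_cartesian_product)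
    finally show ?case by (simp add: mult.commute)
  qed (simp add: W0)
  have step: "c \<in> W (Suc n)" if "a \<in> W n" "c \<in> \<Gamma>" "x \<in> Hyp" "y \<in> Hyp"
    "- lor x (a *v x0) \<le> M0" "- lor y (c *v x0) \<le> M0" "- lor x y \<le> cosh 1" for a c x y n
  proof -
    have aG: "a \<in> \<Gamma>" using WG that by blast
    have "- lor (a *v x0) (c *v x0) \<le> 4 * M0 * M0 * - lor x y"
      using that aG by (intro displacement_compare) auto
    also have "\<dots> \<le> 4 * M0 * M0 * cosh 1" using that M0(1) by (intro mult_left_mono) auto
    finally have "matrix_inv a ** c \<in> ?F"
      using aG that(2) by (simp add: G_lor_inv matrix_vector_mul_assoc)
    moreover have "c = a ** (matrix_inv a ** c)" using G_inv_right[OF aG] by (simp add: matrix_mul_assoc)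
    ultimately show ?thesis unfolding WSuc using that(1) by force
  qed
  have reach: "\<exists>c\<in>W n. - lor y (c *v x0) \<le> M0" if "y \<in> Hyp" "- lor x0 y \<le> cosh (real n)" for y n
    using that
  proof (induction n arbitrary: y)
    case 0
    then have "lor x0 y = - 1" using Hyp_lor_le[of x0 y] by simp
    then have "x0 = y" using Hyp_lor_eqD[of x0 y] 0 by simp
    moreover have "- lor x0 x0 \<le> M0" using M0(1) by (simp add: Hyp_lor_self)
    ultimately show ?case by (simp add: W0)
  next
    case (Suc n)
    obtain c where c: "c \<in> \<Gamma>" "- lor y (c *v x0) \<le> M0" using M0(2)[OF Suc.prems(1)] by blast
    have "\<exists>x\<in>Hyp. - lor x0 x \<le> cosh (real n) \<and> - lor x y \<le> cosh 1"
    proof (cases "y = x0")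
      case True
      have "1 \<le> cosh (real n)" "1 \<le> cosh (1::real)" by (rule cosh_real_ge_1)+
      then show ?thesis using True by (intro bexI[of _ x0]) (auto simp: Hyp_lor_self)
    next
      case False
      then obtain u w l where l: "nullpair u w" "l > 0" "hline u w 0 = x0" "hline u w l = y" "cosh l = - lor x0 y"
        using nullpair_through[OF x0_Hyp Suc.prems(1)] by metis
      have "cosh l \<le> cosh (real (Suc n))" using l Suc.prems by simp
      then have ll: "l \<le> real (Suc n)" using l(2) by (subst (asm) cosh_real_nonneg_le_iff) auto
      \<comment> \<open>The point at the fraction \<open>n / (n + 1)\<close> of the segment: at most
        \<open>n\<close> from \<open>x0\<close> and at most 1 from \<open>y\<close>.\<close>
      define t where "t = l * (real n / real (Suc n))"
      have t: "0 \<le> t" "t \<le> real n" "0 \<le> l - t" "l - t \<le> 1"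
      proof -
        show "0 \<le> t" using l by (simp add: t_def)
        show "t \<le> real n" using mult_right_mono[OF ll, of "real n / real (Suc n)"] by (simp add: t_def)
        have "l - t = l / real (Suc n)" by (simp add: t_def field_simps)
        then show "0 \<le> l - t" "l - t \<le> 1" using l ll by simp_all
      qed
      have "- lor x0 (hline u w t) = cosh (0 - t)" using lor_hline[OF l(1), of 0 t] l(3) by (simp del: hline_0)
      also have "\<dots> = cosh t" by simp
      also have "\<dots> \<le> cosh (real n)" using t by (subst cosh_real_nonneg_le_iff) auto
      finally have 1: "- lor x0 (hline u w t) \<le> cosh (real n)" .
      have "- lor (hline u w t) y = cosh (t - l)" using lor_hline[OF l(1), of t l] l(4) by simp
      also have "\<dots> = cosh (l - t)" using cosh_minus[of "l - t"] by simp
      also have "\<dots> \<le> cosh 1" using t by (subst cosh_real_nonneg_le_iff) auto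
      finally show ?thesis using 1 hline_in_Hyp[OF l(1), of t] by blast
    qed
    then obtain x where x: "x \<in> Hyp" "- lor x0 x \<le> cosh (real n)" "- lor x y \<le> cosh 1" by blast
    obtain a where a: "a \<in> W n" "- lor x (a *v x0) \<le> M0" using Suc.IH[OF x(1,2)] by blast
    have "c \<in> W (Suc n)" using step[OF a(1) c(1) x(1) Suc.prems(1) a(2) c(2) x(3)] .
    with c show ?case by blast
  qed
  have sub: "{g\<in>\<Gamma>. - lor x0 (g *v x0) \<le> cosh (real n)} \<subseteq> W (Suc n)" for n
  proof
    fix g assume "g \<in> {g\<in>\<Gamma>. - lor x0 (g *v x0) \<le> cosh (real n)}"
    then have g: "g \<in> \<Gamma>" "- lor x0 (g *v x0) \<le> cosh (real n)" by auto
    then obtain a where a: "a \<in> W n" "- lor (g *v x0) (a *v x0) \<le> M0" using reach[of "g *v x0" n] by auto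
    have gg: "lor (g *v x0) (g *v x0) = - 1" using g by (simp add: Hyp_lor_self)
    show "g \<in> W (Suc n)"
      by (rule step[OF a(1) g(1) _ _ a(2), of "g *v x0"]) (use g M0(1) cosh_real_ge_1[of 1] gg in auto)
  qed
  have "card {g\<in>\<Gamma>. - lor x0 (g *v x0) \<le> cosh (real n)} \<le> card ?F ^ (n + 1)" for n
    using card_mono[OF finW sub[of n]] cardW[of "Suc n"] by simp
  moreover have "card ?F \<ge> 1"
  proof -
    have "1 * 1 * 1 \<le> 4 * M0 * M0 * cosh 1"
      using M0(1) cosh_real_ge_1[of 1] by (intro mult_mono) auto
    then have "mat 1 \<in> ?F" by (simp add: Hyp_lor_self)
    then show ?thesis using finF by (metis (no_types, lifting) One_nat_def Suc_leI card_gt_0_iff empty_iff)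
  qed
  ultimately show ?thesis using that by blast
qed

section \<open>Comparing two currents along long segments\<close>

text \<open>The hypothesis concerns segments from \<open>x0\<close> to finitely many orbit points
  only. Any short segment is brought to one of these after moving both ends by at most
  \<open>M0\<close>, at a cost of two masses for each current.\<close>

lemma compare_segment:
  assumes "\<eta> \<in> Curr \<Gamma>" "\<eta>' \<in> Curr \<Gamma>"
    and E: "\<And>b. b \<in> \<Gamma> \<Longrightarrow> - lor x0 (b *v x0) \<le> 4 * M0 * M0 * cosh L \<Longrightarrow> ds \<eta>' x0 (b *v x0) \<le> ds \<eta> x0 (b *v x0) + E"
    and xy: "x \<in> Hyp" "y \<in> Hyp" "- lor x y \<le> cosh L"
  shows "ds \<eta>' x y \<le> ds \<eta> x y + (E + 2 * mass \<eta> M0 + 2 * mass \<eta>' M0)"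
proof -
  obtain a where a: "a \<in> \<Gamma>" "- lor x (a *v x0) \<le> M0" using M0(2)[OF xy(1)] by blast
  obtain c where c: "c \<in> \<Gamma>" "- lor y (c *v x0) \<le> M0" using M0(2)[OF xy(2)] by blast
  have near: "ds \<mu> x (a *v x0) \<le> mass \<mu> M0" "ds \<mu> y (c *v x0) \<le> mass \<mu> M0" if "\<mu> \<in> Curr \<Gamma>" for \<mu>
    using that a c xy by (auto intro!: ds_le_mass)
  have A: "\<bar>ds \<mu> x y - ds \<mu> (a *v x0) (c *v x0)\<bar> \<le> 2 * mass \<mu> M0" if \<mu>: "\<mu> \<in> Curr \<Gamma>" for \<mu>
  proof -
    have H: "a *v x0 \<in> Hyp" "c *v x0 \<in> Hyp" using a c by simp_all
    have "ds \<mu> x y \<le> ds \<mu> x (a *v x0) + ds \<mu> (a *v x0) y" "ds \<mu> (a *v x0) y \<le> ds \<mu> (a *v x0) (c *v x0) + ds \<mu> (c *v x0) y"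
      "ds \<mu> (a *v x0) (c *v x0) \<le> ds \<mu> (a *v x0) x + ds \<mu> x (c *v x0)" "ds \<mu> x (c *v x0) \<le> ds \<mu> x y + ds \<mu> y (c *v x0)"
      using \<mu> H xy by (auto intro!: ds_triangle)
    then show ?thesis using near[OF \<mu>] ds_commute[of \<mu> "c *v x0" y] ds_commute[of \<mu> "a *v x0" x] by linarith
  qed
  define b where "b = matrix_inv a ** c"
  have b: "b \<in> \<Gamma>" using a c by (simp add: b_def)
  have ds: "ds \<mu> (a *v x0) (c *v x0) = ds \<mu> x0 (b *v x0)" if "\<mu> \<in> Curr \<Gamma>" for \<mu>
    using ds_invariant[OF that a(1), of x0 "b *v x0"] a by (simp add: b_def matrix_vector_mul_assoc[symmetric])
  have "- lor (a *v x0) (c *v x0) \<le> 4 * M0 * M0 * - lor x y" using a c xy by (intro displacement_compare) auto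
  also have "\<dots> \<le> 4 * M0 * M0 * cosh L" using xy M0(1) by (intro mult_left_mono) auto
  finally have "- lor x0 (b *v x0) \<le> 4 * M0 * M0 * cosh L"
    using a by (simp add: b_def G_lor_inv matrix_vector_mul_assoc)
  from E[OF b this] show ?thesis
    using A[OF assms(1)] A[OF assms(2)] ds[OF assms(1)] ds[OF assms(2)] by linarith
qed

text \<open>The segment is cut into equal pieces of length at most \<open>L\<close>. For
  \<open>\<eta>'\<close> the triangle inequality suffices; for \<open>\<eta>\<close> the half-open
  pieces add up exactly, and each closed piece exceeds its half-open one by an atom, which is the
  summand \<open>mass \<eta> 0\<close>.\<close>

lemma compare_long:
  assumes "\<eta> \<in> Curr \<Gamma>" "\<eta>' \<in> Curr \<Gamma>" "L > 0" "E \<ge> 0"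
    and E: "\<And>b. b \<in> \<Gamma> \<Longrightarrow> - lor x0 (b *v x0) \<le> 4 * M0 * M0 * cosh L \<Longrightarrow> ds \<eta>' x0 (b *v x0) \<le> ds \<eta> x0 (b *v x0) + E"
    and xy: "x \<in> Hyp" "y \<in> Hyp" "l \<ge> 0" "cosh l = - lor x y"
  shows "ds \<eta>' x y \<le> ds \<eta> x y + (l / L + 1) * (E + 2 * mass \<eta> M0 + 2 * mass \<eta>' M0 + mass \<eta> 0)"
proof (cases "x = y")
  case True
  then show ?thesis using assms(3,4) xy by (simp add: ds_def segset_self add_nonneg_nonneg)
next
  case False
  let ?K = "E + 2 * mass \<eta> M0 + 2 * mass \<eta>' M0 + mass \<eta> 0"
  obtain u w l' where l': "nullpair u w" "l' > 0" "hline u w 0 = x" "hline u w l' = y" "cosh l' = - lor x y"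
    using nullpair_through[OF xy(1,2) False] by metis
  have ll: "l' = l" using xy l' cosh_real_nonneg_le_iff[of l l'] cosh_real_nonneg_le_iff[of l' l] by simp
  note np = l'(1)
  have lp: "l > 0" using l' ll by simp
  define n where "n = nat \<lceil>l / L\<rceil>"
  have "l / L > 0" using lp assms(3) by simp
  then have n: "n > 0" "l / L \<le> real n" "real n \<le> l / L + 1" by (simp_all add: n_def)
  define d where "d = l / real n"
  have d: "d > 0" "d \<le> L" "real n * d = l"
    using lp n assms(3) by (simp_all add: d_def field_simps)
  define m where "m = measure (lm \<eta> u w)"
  have step: "ds \<eta>' (hline u w s) (hline u w (s + d)) \<le> m {s..<s + d} + ?K" for s
  proof -
    have "- lor (hline u w s) (hline u w (s + d)) = cosh d" using lor_hline[OF np, of s "s + d"] by simp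
    moreover have "cosh d \<le> cosh L" using d by (subst cosh_real_nonneg_le_iff) auto
    ultimately have "ds \<eta>' (hline u w s) (hline u w (s + d)) \<le> ds \<eta> (hline u w s) (hline u w (s + d))
        + (E + 2 * mass \<eta> M0 + 2 * mass \<eta>' M0)"
      by (intro compare_segment[OF assms(1,2) E] hline_in_Hyp[OF np]) auto
    also have "ds \<eta> (hline u w s) (hline u w (s + d)) = m {s..s + d}"
      unfolding m_def using d by (intro ds_hline[OF assms(1)]) simp
    also have "{s..s + d} = {s..<s + d} \<union> {s + d}" using d by auto
    also have "m ({s..<s + d} \<union> {s + d}) \<le> m {s..<s + d} + m {s + d}"
      unfolding m_def by (rule measure_Un_le) auto
    also have "m {s + d} \<le> mass \<eta> 0" unfolding m_def by (rule lm_point[OF assms(1) np])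
    finally show ?thesis by simp
  qed
  have "ds \<eta>' x (hline u w (real j * d)) \<le> m {0..<real j * d} + real j * ?K" for j
  proof (induction j)
    case 0 then show ?case using l' by (simp add: ds_def segset_self m_def)
  next
    case (Suc j)
    have e: "real (Suc j) * d = real j * d + d" "real (Suc j) * ?K = real j * ?K + ?K"
      by (simp_all add: algebra_simps)
    have t: "ds \<eta>' x (hline u w (real j * d + d)) \<le> ds \<eta>' x (hline u w (real j * d))
        + ds \<eta>' (hline u w (real j * d)) (hline u w (real j * d + d))"
      by (intro ds_triangle assms xy hline_in_Hyp[OF np])
    have "m {0..<real j * d + d} = m {0..<real j * d} + m {real j * d..<real j * d + d}"
      unfolding m_def using d by (intro measure_lm_split[OF assms(1) np]) auto
    then show ?case unfolding e using Suc t step[of "real j * d"] by linarith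
  qed
  from this[of n] have "ds \<eta>' x y \<le> m {0..<l} + real n * ?K" using d l' ll by simp
  also have "m {0..<l} \<le> m {0..l}"
    unfolding m_def by (rule measure_mono_fmeasurable) (auto intro!: lm_fmeasurable[OF assms(1) np, of _ 0 l])
  also have "m {0..l} = ds \<eta> x y" unfolding m_def using ds_hline[OF assms(1), of 0 l u w] l' ll by simp
  also have "real n * ?K \<le> (l / L + 1) * ?K" using n assms(4) by (intro mult_right_mono) auto
  finally show ?thesis by simp
qed

end

section \<open>Continuity of the pseudodistance in the current\<close>

context surface
begin

text \<open>A continuous stand-in for the indicator of \<open>segset x y\<close>, equal to 1 there
  and to 0 once the product is at least 1. The product is even in \<open>n\<close>, so the function
  descends to geodesics.\<close>

definition tent :: "real^3 \<Rightarrow> real^3 \<Rightarrow> real^3 \<Rightarrow> real" where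
  "tent x y n = max 0 (min 1 (1 - lor x n * lor y n))"

text \<open>Lies between the indicators of \<open>near x0 r\<close> and
  \<open>near x0 (r + 1)\<close>; weak-star control of its integral bounds \<open>mass\<close> on a
  whole neighbourhood of a current.\<close>

definition bump :: "real \<Rightarrow> real^3 \<Rightarrow> real" where
  "bump r n = max 0 (min 1 (r + 1 - \<bar>lor x0 n\<bar>))"

lemma tent_support:
  assumes "x \<in> Hyp" "y \<in> Hyp" "n \<in> dS" "tent x y n \<noteq> 0"
  shows "lor x n * lor y n \<le> 0 \<and> \<not> (lor x n = 0 \<and> lor y n = 0) \<or> \<bar>lor x n\<bar> \<le> 1 \<or> \<bar>lor y n\<bar> \<le> 1"
proof (rule ccontr)
  assume neg: "\<not> ?thesis"
  then have "\<bar>lor x n\<bar> * \<bar>lor y n\<bar> > 1 * 1" by (intro mult_strict_mono) auto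
  moreover have "lor x n * lor y n > 0" using neg by auto
  ultimately have "lor x n * lor y n > 1" by (simp add: abs_mult[symmetric])
  then show False using assms(4) by (simp add: tent_def)
qed

lemma tent_Cc: assumes "x \<in> Hyp" "y \<in> Hyp" shows "(\<lambda>g. tent x y (sect g)) \<in> Cc"
proof -
  have "continuous_map geod_top euclideanreal (\<lambda>g. tent x y (sect g))"
    by (rule continuous_map_even(1)) (auto simp: tent_def intro!: continuous_intros)
  moreover have "compactin geod_top (near x (- lor x y) \<union> near x 1 \<union> near y 1)"
    using assms by (intro compactin_Un compactin_near)
  moreover have "tent x y (sect g) = 0" if "g \<in> Geod - (near x (- lor x y) \<union> near x 1 \<union> near y 1)" for g
  proof (rule ccontr)
    have g: "g \<in> Geod" using that by blast
    assume "tent x y (sect g) \<noteq> 0"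
    from tent_support[OF assms _ this] g that show False
      using lor_dS_crossing[OF assms, of "sect g"] by (auto simp: near_def gset_def)
  qed
  ultimately show ?thesis unfolding Cc_def by blast
qed

lemma bump_Cc: "(\<lambda>g. bump r (sect g)) \<in> Cc"
proof -
  have "continuous_map geod_top euclideanreal (\<lambda>g. bump r (sect g))"
    by (rule continuous_map_even(1)) (auto simp: bump_def intro!: continuous_intros)
  moreover have "compactin geod_top (near x0 (r + 1))" by (rule compactin_near) simp
  moreover have "bump r (sect g) = 0" if "g \<in> Geod - near x0 (r + 1)" for g
    using that by (auto simp: near_def gset_def bump_def)
  ultimately show ?thesis unfolding Cc_def by blast
qed

lemma Cc_measurable: "\<eta> \<in> Curr \<Gamma> \<Longrightarrow> f \<in> Cc \<Longrightarrow> f \<in> borel_measurable \<eta>"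
  using continuous_map_measurable[of f] measurable_cong_sets[OF Curr_sets[of \<eta> \<Gamma>] refl, of borel]
  unfolding Cc_def by blast

lemma integral_between:
  fixes f :: "(real^3) set \<Rightarrow> real"
  assumes "\<eta> \<in> Curr \<Gamma>" "f \<in> borel_measurable \<eta>" "S \<in> fmeasurable \<eta>" "T \<in> fmeasurable \<eta>"
    and f: "\<And>g. g \<in> Geod \<Longrightarrow> indicator S g \<le> f g \<and> f g \<le> indicator T g"
  shows "measure \<eta> S \<le> (\<integral>g. f g \<partial>\<eta>)" "(\<integral>g. f g \<partial>\<eta>) \<le> measure \<eta> T"
proof -
  have sp: "space \<eta> = Geod" by (rule Curr_space[OF assms(1)])
  have iS: "integrable \<eta> (indicator S :: _ \<Rightarrow> real)" and iT: "integrable \<eta> (indicator T :: _ \<Rightarrow> real)"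
    using assms(3,4) by (auto simp: fmeasurable_def)
  have if': "integrable \<eta> f"
  proof (rule Bochner_Integration.integrable_bound[OF iT assms(2)])
    have "norm (f g) \<le> norm (indicator T g :: real)" if "g \<in> Geod" for g
    proof -
      have "0 \<le> (indicator S g :: real)" by simp
      then have "0 \<le> f g" "f g \<le> indicator T g" using f[OF that] by linarith+
      then show ?thesis by simp
    qed
    then show "AE g in \<eta>. norm (f g) \<le> norm (indicator T g :: real)" using sp by (intro AE_I2) auto
  qed
  have Ss: "S \<subseteq> Geod" "T \<subseteq> Geod" using assms(3,4) sp sets.sets_into_space fmeasurableD by blast+
  have "(\<integral>g. indicator S g \<partial>\<eta>) \<le> (\<integral>g. f g \<partial>\<eta>)" using f sp by (intro integral_mono iS if') auto
  then show "measure \<eta> S \<le> (\<integral>g. f g \<partial>\<eta>)" using Ss sp by (simp add: Int_absorb2)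
  have "(\<integral>g. f g \<partial>\<eta>) \<le> (\<integral>g. indicator T g \<partial>\<eta>)" using f sp by (intro integral_mono iT if') auto
  then show "(\<integral>g. f g \<partial>\<eta>) \<le> measure \<eta> T" using Ss sp by (simp add: Int_absorb2)
qed

text \<open>Outside \<open>segset x y\<close> the tent is nonzero only for geodesics with
  \<open>\<bar>lor x n\<bar> \<le> 1\<close> or \<open>\<bar>lor y n\<bar> \<le> 1\<close>, whence
  the error \<open>2 * mass \<eta> 1\<close>.\<close>

lemma tent_integral:
  assumes "\<eta> \<in> Curr \<Gamma>" "x \<in> Hyp" "y \<in> Hyp"
  shows "ds \<eta> x y \<le> (\<integral>g. tent x y (sect g) \<partial>\<eta>)"
    and "(\<integral>g. tent x y (sect g) \<partial>\<eta>) \<le> ds \<eta> x y + 2 * mass \<eta> 1"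
proof -
  let ?T = "segset x y \<union> (near x 1 \<union> near y 1)"
  have fm: "segset x y \<in> fmeasurable \<eta>" "near x 1 \<in> fmeasurable \<eta>" "near y 1 \<in> fmeasurable \<eta>"
    using assms segset_fmeasurable near_fmeasurable by auto
  have T: "?T \<in> fmeasurable \<eta>" using fm by (intro fmeasurable.Un)
  have bt: "indicator (segset x y) g \<le> tent x y (sect g) \<and> tent x y (sect g) \<le> indicator ?T g" if g: "g \<in> Geod" for g
  proof
    show "indicator (segset x y) g \<le> tent x y (sect g)"
      by (auto simp: indicator_def segset_def gset_def tent_def)
    show "tent x y (sect g) \<le> indicator ?T g"
    proof (cases "tent x y (sect g) = 0")
      case False
      then have "g \<in> ?T" using tent_support[OF assms(2,3) sect_in_dS[OF g] False] g
        by (auto simp: segset_def near_def gset_def)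
      then show ?thesis by (simp add: tent_def)
    qed simp
  qed
  note ib = integral_between[OF assms(1) Cc_measurable[OF assms(1) tent_Cc[OF assms(2,3)]] fm(1) T bt]
  show "ds \<eta> x y \<le> (\<integral>g. tent x y (sect g) \<partial>\<eta>)" using ib(1) by (simp add: ds_def)
  have "measure \<eta> ?T \<le> measure \<eta> (segset x y) + measure \<eta> (near x 1 \<union> near y 1)"
    using fm by (intro measure_Un_le) (auto dest: fmeasurableD)
  also have "measure \<eta> (near x 1 \<union> near y 1) \<le> measure \<eta> (near x 1) + measure \<eta> (near y 1)"
    using fm by (intro measure_Un_le) (auto dest: fmeasurableD)
  also have "measure \<eta> (near x 1) \<le> mass \<eta> 1" using assms by (intro measure_near_le) auto
  also have "measure \<eta> (near y 1) \<le> mass \<eta> 1" using assms by (intro measure_near_le) auto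
  finally show "(\<integral>g. tent x y (sect g) \<partial>\<eta>) \<le> ds \<eta> x y + 2 * mass \<eta> 1" using ib(2) by (simp add: ds_def)
qed

lemma bump_integral:
  assumes "\<eta> \<in> Curr \<Gamma>"
  shows "measure \<eta> (near x0 r) \<le> (\<integral>g. bump r (sect g) \<partial>\<eta>)"
proof (rule integral_between(1)[OF assms Cc_measurable[OF assms bump_Cc]])
  show "near x0 r \<in> fmeasurable \<eta>" "near x0 (r + 1) \<in> fmeasurable \<eta>" using near_fmeasurable assms by auto
  show "indicator (near x0 r) g \<le> bump r (sect g) \<and> bump r (sect g) \<le> indicator (near x0 (r + 1)) g" if "g \<in> Geod" for g
    using that by (auto simp: indicator_def near_def gset_def bump_def)
qed

lemma openin_curr_top_basic:
  assumes "f \<in> Cc" "open U"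
  shows "openin (curr_top \<Gamma>) {\<eta>\<in>Curr \<Gamma>. (\<integral>g. f g \<partial>\<eta>) \<in> U}"
  unfolding curr_top_def by (rule topology_generated_by_Basis) (use assms in blast)

lemma zero_in_Cc: "(\<lambda>g. 0) \<in> Cc"
  by (auto simp: Cc_def intro: exI[of _ "{}"])

lemma openin_curr_top_Curr: "openin (curr_top \<Gamma>) (Curr \<Gamma>)"
  using openin_curr_top_basic[OF zero_in_Cc open_UNIV] by simp

text \<open>The order of choices matters. A first neighbourhood bounds the masses by a constant,
  which fixes the error per piece independently of the length \<open>L\<close> of the pieces. Then
  \<open>L\<close> is taken so large that the total error is \<open>\<delta>\<close> times the
  distance plus a constant, and only afterwards a smaller neighbourhood controls the finitely many
  segments relevant for this \<open>L\<close>.\<close>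

lemma ds_continuity:
  assumes "\<eta> \<in> Curr \<Gamma>" "filling \<eta>" "\<delta> > 0"
  obtains W C where "openin (curr_top \<Gamma>) W" "\<eta> \<in> W" "C \<ge> 0"
    "\<And>\<eta>' g. \<eta>' \<in> W \<Longrightarrow> g \<in> \<Gamma> \<Longrightarrow> \<eta>' \<in> Curr \<Gamma> \<and>
       ds \<eta>' (g *v x0) x0 \<le> (1 + \<delta>) * ds \<eta> (g *v x0) x0 + C \<and>
       (1 - \<delta>) * ds \<eta> (g *v x0) x0 \<le> ds \<eta>' (g *v x0) x0 + C"
proof -
  obtain A B where AB: "A > 0" "B > 0" "\<And>x y l. x \<in> Hyp \<Longrightarrow> y \<in> Hyp \<Longrightarrow> l \<ge> 0 \<Longrightarrow> cosh l = - lor x y \<Longrightarrow> l \<le> A * ds \<eta> x y + B"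
    using filling_orbit_length[OF assms(1,2)] by blast
  define r where "r = M0 * (2 * M0 + 1)"
  define C where "C = (\<integral>g. bump r (sect g) \<partial>\<eta>) + 1"
  define W0 where "W0 = {\<mu>\<in>Curr \<Gamma>. (\<integral>g. bump r (sect g) \<partial>\<mu>) \<in> {..<C}}"
  have "openin (curr_top \<Gamma>) W0" unfolding W0_def by (rule openin_curr_top_basic[OF bump_Cc]) simp
  moreover have "\<eta> \<in> W0" using assms by (simp add: W0_def C_def)
  ultimately have W0: "openin (curr_top \<Gamma>) W0" "\<eta> \<in> W0" by simp_all
  have massC: "mass \<mu> M0 \<le> C" "mass \<mu> 1 \<le> C" "mass \<mu> 0 \<le> C" if "\<mu> \<in> W0" for \<mu>
  proof -
    have \<mu>: "\<mu> \<in> Curr \<Gamma>" "(\<integral>g. bump r (sect g) \<partial>\<mu>) < C" using that by (auto simp: W0_def)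
    show *: "mass \<mu> M0 \<le> C" using bump_integral[OF \<mu>(1), of r] \<mu>(2) by (simp add: mass_def r_def)
    show "mass \<mu> 1 \<le> C" "mass \<mu> 0 \<le> C"
      using * mass_mono[OF \<mu>(1), of 1 M0] mass_mono[OF \<mu>(1), of 0 M0] M0(1) by linarith+
  qed
  have C0: "C \<ge> 0" using massC(1)[OF W0(2)] mass_nonneg[of \<eta> M0] by linarith
  \<comment> \<open>\<open>2 * C\<close> pays for replacing distances by integrals of tents and 1
    for the width of the neighbourhoods \<open>?V\<close>; the five masses in
    \<open>compare_long\<close> give the \<open>5 * C\<close> in \<open>K\<close>.\<close>
  define E where "E = 2 * C + 1"
  define K where "K = E + 5 * C"
  have K: "K > 0" using C0 by (simp add: K_def E_def)
  define L where "L = A * K / \<delta>"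
  have L: "L > 0" using AB K assms(3) by (simp add: L_def)
  have AKL: "A * K / L = \<delta>" using AB K assms(3) by (simp add: L_def)
  let ?F = "{b\<in>\<Gamma>. - lor x0 (b *v x0) \<le> 4 * M0 * M0 * cosh L}"
  let ?I = "\<lambda>b \<mu>. (\<integral>g. tent x0 (b *v x0) (sect g) \<partial>\<mu>)"
  let ?V = "\<lambda>b. {\<mu>\<in>Curr \<Gamma>. ?I b \<mu> \<in> {?I b \<eta> - 1<..<?I b \<eta> + 1}}"
  define W where "W = W0 \<inter> \<Inter>(insert (Curr \<Gamma>) (?V ` ?F))"
  have "openin (curr_top \<Gamma>) (\<Inter>(insert (Curr \<Gamma>) (?V ` ?F)))"
  proof (rule openin_Inter)
    show "finite (insert (Curr \<Gamma>) (?V ` ?F))" using finite_displacement by simp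
    have "openin (curr_top \<Gamma>) (?V b)" if "b \<in> \<Gamma>" for b
      by (rule openin_curr_top_basic[OF tent_Cc[OF x0_Hyp]]) (use that in auto)
    then show "openin (curr_top \<Gamma>) X" if "X \<in> insert (Curr \<Gamma>) (?V ` ?F)" for X
      using that openin_curr_top_Curr by blast
  qed simp
  then have W: "openin (curr_top \<Gamma>) W" unfolding W_def using W0 by (intro openin_Int)
  have \<eta>W: "\<eta> \<in> W" unfolding W_def using W0 assms by auto
  have main: "\<mu> \<in> Curr \<Gamma> \<and> ds \<mu> (g *v x0) x0 \<le> (1 + \<delta>) * ds \<eta> (g *v x0) x0 + (B / L + 1) * K \<and>
       (1 - \<delta>) * ds \<eta> (g *v x0) x0 \<le> ds \<mu> (g *v x0) x0 + (B / L + 1) * K"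
    if \<mu>W: "\<mu> \<in> W" and g: "g \<in> \<Gamma>" for \<mu> g
  proof -
    have \<mu>: "\<mu> \<in> W0" "\<mu> \<in> Curr \<Gamma>" using \<mu>W by (auto simp: W_def)
    have I: "\<bar>?I b \<mu> - ?I b \<eta>\<bar> < 1" if "b \<in> ?F" for b
    proof -
      have "\<mu> \<in> ?V b" using \<mu>W that unfolding W_def by blast
      then show ?thesis by auto
    qed
    have E1: "ds \<mu> x0 (b *v x0) \<le> ds \<eta> x0 (b *v x0) + E" and E2: "ds \<eta> x0 (b *v x0) \<le> ds \<mu> x0 (b *v x0) + E"
      if b: "b \<in> \<Gamma>" "- lor x0 (b *v x0) \<le> 4 * M0 * M0 * cosh L" for b
    proof -
      have bH: "b *v x0 \<in> Hyp" using b by simp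
      have "b \<in> ?F" using b by simp
      note Ib = I[OF this]
      show "ds \<mu> x0 (b *v x0) \<le> ds \<eta> x0 (b *v x0) + E" "ds \<eta> x0 (b *v x0) \<le> ds \<mu> x0 (b *v x0) + E"
        using Ib tent_integral[OF \<mu>(2) x0_Hyp bH] tent_integral[OF assms(1) x0_Hyp bH]
          massC(2)[OF \<mu>(1)] massC(2)[OF W0(2)] unfolding E_def by linarith+
    qed
    define l where "l = arcosh (- lor (g *v x0) x0)"
    have H: "g *v x0 \<in> Hyp" using g by simp
    have ge: "- lor (g *v x0) x0 \<ge> 1" using Hyp_lor_le[OF H x0_Hyp] by linarith
    have l: "l \<ge> 0" "cosh l = - lor (g *v x0) x0" using ge by (simp_all add: l_def)
    have E0: "E \<ge> 0" using C0 by (simp add: E_def)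
    have "ds \<mu> (g *v x0) x0 \<le> ds \<eta> (g *v x0) x0 + (l / L + 1) * (E + 2 * mass \<eta> M0 + 2 * mass \<mu> M0 + mass \<eta> 0)"
      by (rule compare_long[OF assms(1) \<mu>(2) L E0 E1 H x0_Hyp l])
    moreover have "ds \<eta> (g *v x0) x0 \<le> ds \<mu> (g *v x0) x0 + (l / L + 1) * (E + 2 * mass \<mu> M0 + 2 * mass \<eta> M0 + mass \<mu> 0)"
      by (rule compare_long[OF \<mu>(2) assms(1) L E0 E2 H x0_Hyp l])
    moreover have "(l / L + 1) * (E + 2 * mass \<eta> M0 + 2 * mass \<mu> M0 + mass \<eta> 0) \<le> (l / L + 1) * K"
      "(l / L + 1) * (E + 2 * mass \<mu> M0 + 2 * mass \<eta> M0 + mass \<mu> 0) \<le> (l / L + 1) * K"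
      using massC[OF \<mu>(1)] massC[OF W0(2)] l L unfolding K_def by (intro mult_left_mono; simp)+
    moreover have "(l / L + 1) * K \<le> \<delta> * ds \<eta> (g *v x0) x0 + (B / L + 1) * K"
    proof -
      have "l \<le> A * ds \<eta> (g *v x0) x0 + B" by (rule AB(3)[OF H x0_Hyp l])
      then have "l / L \<le> (A * ds \<eta> (g *v x0) x0 + B) / L" using L by (intro divide_right_mono) auto
      then have "(l / L + 1) * K \<le> ((A * ds \<eta> (g *v x0) x0 + B) / L + 1) * K" using K by (intro mult_right_mono) auto
      also have "\<dots> = (A * K / L) * ds \<eta> (g *v x0) x0 + (B / L + 1) * K" by (simp add: add_divide_distrib algebra_simps)
      finally show ?thesis unfolding AKL .
    qed
    ultimately show ?thesis using \<mu>(2) by (simp add: algebra_simps)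
  qed
  have "(B / L + 1) * K \<ge> 0" using AB L K by simp
  then show ?thesis using that[OF W \<eta>W _ main] by blast
qed

end

section \<open>Critical exponents\<close>

lemma crit_exp_nonneg: "0 \<le> crit_exp A"
  unfolding crit_exp_def
proof (rule le_Limsup)
  \<comment> \<open>Includes the empty ball, since \<open>ln 0 = 0\<close>.\<close>
  have nn: "0 \<le> ln (real n)" for n :: nat by (cases n) auto
  show "\<forall>\<^sub>F R in at_top. 0 \<le> (if finite (A R) then ereal (ln (real (card (A R))) / R) else \<infinity>)"
    using eventually_gt_at_top[of 0] by eventually_elim (auto simp: nn)
qed simp

lemma crit_exp_cong:
  assumes "\<And>R. R \<ge> 0 \<Longrightarrow> A R = B R"
  shows "crit_exp A = crit_exp B"
  unfolding crit_exp_def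
  by (rule Limsup_eq) (use eventually_ge_at_top[of 0] in \<open>eventually_elim, simp add: assms\<close>)

lemma crit_exp_infinite:
  assumes "\<And>R. R \<ge> C \<Longrightarrow> infinite (A R)"
  shows "crit_exp A = \<infinity>"
proof -
  have "\<infinity> \<le> crit_exp A"
    unfolding crit_exp_def
  proof (rule le_Limsup)
    show "\<forall>\<^sub>F R in at_top. \<infinity> \<le> (if finite (A R) then ereal (ln (real (card (A R))) / R) else \<infinity>)"
      using eventually_ge_at_top[of C] by eventually_elim (use assms in simp)
  qed simp
  then show ?thesis by simp
qed

lemma crit_exp_bounded:
  assumes "\<And>R. R \<ge> 1 \<Longrightarrow> finite (A R) \<and> ln (real (card (A R))) \<le> K * R"
  shows "crit_exp A \<le> ereal K"
  unfolding crit_exp_def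
proof (rule Limsup_bounded)
  show "\<forall>\<^sub>F R in at_top. (if finite (A R) then ereal (ln (real (card (A R))) / R) else \<infinity>) \<le> ereal K"
    using eventually_ge_at_top[of 1] by eventually_elim (use assms in \<open>auto simp: pos_divide_le_eq\<close>)
qed

text \<open>After taking logarithms and dividing by \<open>R\<close>, the linear factor, the summand
  1 and the shift \<open>b\<close> disappear in the limit; only the dilation \<open>a\<close>
  survives.\<close>

lemma crit_exp_le:
  assumes a: "a > 0" and c: "c \<ge> 0"
    and H: "\<And>R. R \<ge> 0 \<Longrightarrow> finite (B (a * R + b)) \<Longrightarrow>
       finite (A R) \<and> real (card (A R)) \<le> (c * R + c) * (real (card (B (a * R + b))) + 1)"
  shows "crit_exp A \<le> ereal a * crit_exp B"
proof (cases "crit_exp B = \<infinity>")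
  case True
  then show ?thesis using a by simp
next
  case False
  then obtain \<beta> where \<beta>: "crit_exp B = ereal \<beta>" "\<beta> \<ge> 0"
    using crit_exp_nonneg[of B] by (cases "crit_exp B") auto
  have "crit_exp A \<le> ereal a * crit_exp B + ereal e" if e: "e > 0" for e :: real
  proof -
    \<comment> \<open>Half of \<open>e\<close> is spent on the slack in the exponent of
      \<open>B\<close>, the other half on the lower order terms
      \<open>2 * (ln R / R) + k / R\<close>.\<close>
    define \<beta>' where "\<beta>' = \<beta> + e / (2 * a)"
    have \<beta>': "\<beta> < \<beta>'" "a * \<beta>' = a * \<beta> + e / 2" "\<beta>' > 0"
      using a e \<beta>(2) by (simp_all add: \<beta>'_def distrib_left add_nonneg_pos)
    have "crit_exp B < ereal \<beta>'" using \<beta> \<beta>' by simp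
    then have "\<forall>\<^sub>F R in at_top. (if finite (B R) then ereal (ln (real (card (B R))) / R) else \<infinity>) < ereal \<beta>'"
      unfolding crit_exp_def by (rule Limsup_lessD)
    moreover have lin: "filterlim (\<lambda>R. a * R + b) at_top at_top"
      unfolding filterlim_at_top
    proof
      fix Z
      show "\<forall>\<^sub>F R in at_top. Z \<le> a * R + b"
        using eventually_ge_at_top[of "(Z - b) / a"]
        by eventually_elim (use a in \<open>simp add: pos_divide_le_eq algebra_simps\<close>)
    qed
    ultimately have ev1: "\<forall>\<^sub>F R in at_top. (if finite (B (a * R + b)) then ereal (ln (real (card (B (a * R + b)))) / (a * R + b)) else \<infinity>) < ereal \<beta>'"
      by (rule eventually_compose_filterlim)
    have ev2: "\<forall>\<^sub>F R in at_top. a * R + b > 0" using lin by (simp add: filterlim_at_top_dense)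
    define k where "k = ln 2 + \<beta>' * \<bar>b\<bar>"
    have lim: "((\<lambda>R. 2 * (ln R / R) + k / R) \<longlongrightarrow> 2 * 0 + 0) at_top"
      by (intro tendsto_intros ln_x_over_x_tendsto_0 tendsto_divide_0[OF tendsto_const] filterlim_at_top_imp_at_infinity filterlim_ident)
    then have ev3: "\<forall>\<^sub>F R in at_top. 2 * (ln R / R) + k / R < e / 2"
      using e by (intro order_tendstoD(2)[where y = "2 * 0 + 0"]) auto
    \<comment> \<open>In this range \<open>c * R + c \<le> R * R\<close>, so the linear factor
      contributes at most \<open>2 * ln R\<close>.\<close>
    have ev4: "\<forall>\<^sub>F R in at_top. R \<ge> 2 * c + 2" by (rule eventually_ge_at_top)
    have "\<forall>\<^sub>F R in at_top. (if finite (A R) then ereal (ln (real (card (A R))) / R) else \<infinity>) \<le> ereal (a * \<beta> + e)"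
      using ev1 ev2 ev3 ev4
    proof eventually_elim
      case (elim R)
      define q where "q = card (B (a * R + b))"
      have R: "R \<ge> 2" using elim c by linarith
      have finB: "finite (B (a * R + b))" using elim(1) by (auto split: if_splits)
      have lnq: "ln (real q) \<le> \<beta>' * (a * R + b)"
      proof -
        have "ln (real q) / (a * R + b) < \<beta>'" using elim(1) finB by (simp add: q_def)
        then show ?thesis using elim(2) by (simp add: pos_divide_less_eq)
      qed
      have fA: "finite (A R)" "real (card (A R)) \<le> (c * R + c) * (real q + 1)"
        using H[OF _ finB] R by (auto simp: q_def)
      have cR: "c * R + c \<le> R * R"
      proof -
        have "c * R + c \<le> c * R + c * R" using c R mult_left_mono[of 1 R c] by linarith
        also have "\<dots> = (2 * c) * R" by simp
        also have "\<dots> \<le> R * R" using elim(4) R by (intro mult_right_mono) auto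
        finally show ?thesis .
      qed
      have nonneg: "0 \<le> \<beta>' * (a * R + b)" using \<beta>' elim(2) by simp
      have ln1: "ln (real q + 1) \<le> ln 2 + \<beta>' * (a * R + b)"
      proof (cases "q = 0")
        case True then show ?thesis using nonneg by (simp add: add_nonneg_nonneg)
      next
        case False
        then have "real q + 1 \<le> 2 * real q" by simp
        then have "ln (real q + 1) \<le> ln (2 * real q)" by (intro ln_mono) auto
        also have "\<dots> = ln 2 + ln (real q)" using False by (simp add: ln_mult)
        finally show ?thesis using lnq by linarith
      qed
      have lnA: "ln (real (card (A R))) \<le> 2 * ln R + (ln 2 + \<beta>' * (a * R + b))"
      proof (cases "card (A R) = 0")
        case True
        have "0 \<le> ln R" using R by simp
        then show ?thesis using True nonneg by simp
      next
        case False
        have "real (card (A R)) \<le> R * R * (real q + 1)"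
          using fA(2) mult_right_mono[OF cR, of "real q + 1"] by linarith
        then have "ln (real (card (A R))) \<le> ln (R * R * (real q + 1))" using False by (intro ln_mono) auto
        also have "\<dots> = 2 * ln R + ln (real q + 1)" using R by (simp add: ln_mult)
        finally show ?thesis using ln1 by linarith
      qed
      also have "\<dots> \<le> 2 * ln R + k + a * \<beta>' * R"
        using mult_left_mono[OF abs_ge_self[of b], of \<beta>'] \<beta>'(3) by (simp add: k_def algebra_simps)
      finally have "ln (real (card (A R))) / R \<le> (2 * ln R + k + a * \<beta>' * R) / R" using R by (intro divide_right_mono) auto
      also have "\<dots> = 2 * (ln R / R) + k / R + a * \<beta>'" using R by (simp add: add_divide_distrib)
      also have "\<dots> \<le> a * \<beta> + e" using elim(3) \<beta>'(2) by linarith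
      finally show ?case using fA by simp
    qed
    then have "crit_exp A \<le> ereal (a * \<beta> + e)" unfolding crit_exp_def by (rule Limsup_bounded)
    then show ?thesis by (simp add: \<beta>)
  qed
  then show ?thesis by (rule ereal_le_epsilon2[rule_format])
qed

context surface
begin

definition ballA :: "(real^3) set measure \<Rightarrow> real \<Rightarrow> (real^3^3) set" where
  "ballA \<eta> R = {g\<in>\<Gamma>. ds \<eta> (g *v x0) x0 \<le> R}"

definition ballC :: "(real^3) set measure \<Rightarrow> real \<Rightarrow> (real^3^3) set set" where
  "ballC \<eta> R = {c\<in>Curves \<Gamma>. inum \<eta> c \<le> R}"

text \<open>Balls are compared for \<open>R \<ge> 0\<close> only, because \<open>ennreal R\<close>
  is 0 for negative \<open>R\<close>.\<close>

lemma metric_crit_eq: "\<eta> \<in> Curr \<Gamma> \<Longrightarrow> metric_crit \<Gamma> x0 \<eta> = crit_exp (ballA \<eta>)"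
  unfolding metric_crit_def by (rule crit_exp_cong) (auto simp: ballA_def d_curr_ds)

lemma geod_crit_eq: "\<eta> \<in> Curr \<Gamma> \<Longrightarrow> geod_crit \<Gamma> \<eta> = crit_exp (ballC \<eta>)"
  unfolding geod_crit_def by (rule crit_exp_cong) (auto simp: ballC_def inter_class(1))

lemma conj_Curves: "a \<in> \<Gamma> \<Longrightarrow> a \<noteq> mat 1 \<Longrightarrow> conjcl \<Gamma> a \<in> Curves \<Gamma>"
  by (auto simp: Curves_def)

lemma inum_conjcl_le:
  assumes "\<eta> \<in> Curr \<Gamma>" "a \<in> \<Gamma>" "a \<noteq> mat 1"
  shows "inum \<eta> (conjcl \<Gamma> a) \<le> ds \<eta> (a *v x0) x0"
  using inter_class(2)[OF assms(1) conj_Curves[OF assms(2,3)] conjcl_self x0_Hyp] by (simp add: ds_commute)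

lemma trace_conjcl: assumes "a \<in> \<Gamma>" "b \<in> conjcl \<Gamma> a" shows "trace b = trace a"
proof -
  obtain h where h: "h \<in> \<Gamma>" "b = h ** a ** matrix_inv h" using assms by (auto simp: conjcl_def)
  have "trace b = trace (matrix_inv h ** (h ** a))" unfolding h(2) by (rule trace_mul_sym)
  also have "matrix_inv h ** (h ** a) = a" using h by (simp add: matrix_mul_assoc G_inv_left)
  finally show ?thesis .
qed

subsection \<open>Non-filling currents\<close>

text \<open>A geodesic that crosses nothing in the support has zero crossing measure, so orbit
  points near it stay at bounded \<open>ds\<close> from \<open>x0\<close> while going to infinity.
  For curves, the closing elements have unbounded traces; the trace is a class invariant, so
  infinitely many classes occur.\<close>

lemma not_filling_infinite:
  assumes "\<eta> \<in> Curr \<Gamma>" "\<not> filling \<eta>"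
  obtains C where "infinite (ballA \<eta> C)" "infinite (ballC \<eta> C)"
proof -
  obtain g0 where g0: "g0 \<in> Geod" "\<And>h. h \<in> supp \<eta> \<Longrightarrow> \<not> transverse g0 h"
    using assms(2) by (auto simp: filling_def)
  obtain v where v: "v \<in> dS" "g0 = gd v" using g0(1) by (rule GeodE)
  obtain u w where f: "frame u w v" using dS_frame[OF v(1)] by blast
  note np = frame_nullpair[OF f]
  have "gset (crosses u w) \<inter> supp \<eta> = {}"
  proof (rule ccontr)
    assume "gset (crosses u w) \<inter> supp \<eta> \<noteq> {}"
    then obtain h where h: "h \<in> gset (crosses u w)" "h \<in> supp \<eta>" by blast
    then have "h \<in> {g. transverse g (gd v) \<and> (\<exists>p\<in>UNIV. g \<inter> gd v = {p})}"
      unfolding transverse_slice[OF f] by simp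
    then have "transverse g0 h" using v by (auto simp: transverse_def)
    then show False using g0 h by blast
  qed
  then have null: "emeasure \<eta> (gset (crosses u w)) = 0"
    using Curr_null_off_supp[OF assms(1) Curr_gset_sets[OF assms(1)], of "crosses u w"] by simp
  have lm0: "measure (lm \<eta> u w) S = 0" if "S \<in> sets borel" for S
  proof -
    have "emeasure (lm \<eta> u w) S \<le> emeasure \<eta> (gset (crosses u w))"
      unfolding emeasure_lm[OF assms(1) that]
      by (rule emeasure_mono) (auto simp: gset_def[of "crosses u w"] gset_def intro!: Curr_gset_sets[OF assms(1), unfolded gset_def])
    then show ?thesis using null by (simp add: measure_def)
  qed
  define p where "p j = hline u w (real j)" for j :: nat
  have pH: "p j \<in> Hyp" for j unfolding p_def by (rule hline_in_Hyp[OF np])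
  have ds0: "ds \<eta> (p 0) (p j) = 0" for j
  proof (cases "j = 0")
    case True then show ?thesis by (simp add: ds_def segset_self)
  next
    case False
    then show ?thesis using ds_hline[OF assms(1), of 0 "real j" u w] lm0[of "{0..real j}"] by (simp add: p_def)
  qed
  have "\<exists>a\<in>\<Gamma>. - lor (p j) (a *v x0) \<le> M0" for j using M0(2)[OF pH] .
  then obtain \<gamma> where \<gamma>: "\<And>j. \<gamma> j \<in> \<Gamma>" "\<And>j. - lor (p j) (\<gamma> j *v x0) \<le> M0" by metis
  define C1 where "C1 = ds \<eta> x0 (p 0) + mass \<eta> M0"
  have dsg: "ds \<eta> (\<gamma> j *v x0) x0 \<le> C1" for j
  proof -
    have "ds \<eta> x0 (\<gamma> j *v x0) \<le> ds \<eta> x0 (p 0) + ds \<eta> (p 0) (\<gamma> j *v x0)"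
      using \<gamma>(1) pH by (intro ds_triangle assms) auto
    also have "ds \<eta> (p 0) (\<gamma> j *v x0) \<le> ds \<eta> (p 0) (p j) + ds \<eta> (p j) (\<gamma> j *v x0)"
      using \<gamma>(1) pH by (intro ds_triangle assms) auto
    also have "ds \<eta> (p j) (\<gamma> j *v x0) \<le> mass \<eta> M0" using \<gamma> pH by (intro ds_le_mass assms) auto
    finally show ?thesis by (simp add: ds0 C1_def ds_commute)
  qed
  define c0 where "c0 = - lor (p 0) x0"
  have c0: "c0 \<ge> 1" using Hyp_lor_le[OF pH[of 0] x0_Hyp] by (simp add: c0_def)
  \<comment> \<open>Only divergence matters, so \<open>cosh (real j)\<close> is replaced by the
    linear lower bound \<open>real j\<close>.\<close>
  have chg: "real j \<le> 4 * c0 * M0 * - lor x0 (\<gamma> j *v x0)" for j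
  proof -
    have H: "\<gamma> j *v x0 \<in> Hyp" using \<gamma>(1) by simp
    have n1: "- lor x0 (\<gamma> j *v x0) \<ge> 1" using Hyp_lor_le[OF x0_Hyp H] by linarith
    have "real j \<le> cosh (real j)"
    proof -
      have "real j * 2 \<le> exp (real j)"
        using exp_lower_Taylor_quadratic[of "real j"] sum_squares_ge_zero[of "real j - 1" 0]
        by (simp add: power2_eq_square algebra_simps)
      moreover have "cosh (real j) = (exp (real j) + exp (- real j)) / 2" by (simp add: cosh_def)
      moreover have "0 < exp (- real j)" by simp
      ultimately show ?thesis by (simp only: pos_le_divide_eq zero_less_numeral)
    qed
    also have "cosh (real j) = - lor (p 0) (p j)" using lor_hline[OF np, of 0 "real j"] by (simp add: p_def)
    also have "\<dots> \<le> 2 * (c0 * - lor x0 (p j))"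
      using lor_triangle(1)[OF pH x0_Hyp pH, of 0 j] by (simp add: c0_def)
    also have "\<dots> \<le> 2 * (c0 * (2 * (- lor x0 (\<gamma> j *v x0) * M0)))"
    proof (intro mult_left_mono)
      have "- lor x0 (p j) \<le> 2 * (- lor x0 (\<gamma> j *v x0) * - lor (p j) (\<gamma> j *v x0))"
        using lor_triangle(1)[OF x0_Hyp H pH, of j] by (simp add: lor_commute)
      also have "\<dots> \<le> 2 * (- lor x0 (\<gamma> j *v x0) * M0)" using n1 \<gamma>(2)[of j] by (intro mult_left_mono) auto
      finally show "- lor x0 (p j) \<le> 2 * (- lor x0 (\<gamma> j *v x0) * M0)" .
    qed (use c0 in auto)
    finally show ?thesis by (simp add: algebra_simps)
  qed
  define k where "k = 4 * c0 * M0"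
  have k: "k > 0" using c0 M0(1) by (simp add: k_def)
  have unb: "\<exists>j. - lor x0 (\<gamma> j *v x0) > T" for T
  proof -
    obtain j :: nat where j: "k * T < real j" using reals_Archimedean2 by blast
    then have "k * T < k * - lor x0 (\<gamma> j *v x0)" using chg[of j] unfolding k_def by (rule less_le_trans)
    then have "T < - lor x0 (\<gamma> j *v x0)" using mult_less_cancel_left_pos[OF k] by blast
    then show ?thesis by blast
  qed
  obtain S c r where S: "finite S" "S \<subseteq> \<Gamma>" "c > 0"
    "\<And>g. g \<in> \<Gamma> \<Longrightarrow> \<exists>s\<in>S. c * - lor x0 (g *v x0) \<le> \<bar>trace (g ** s)\<bar>"
    using closing_trace by blast
  define C2 where "C2 = Max (insert 0 ((\<lambda>s. ds \<eta> (s *v x0) x0) ` S))"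
  have C2: "C2 \<ge> 0" "\<And>s. s \<in> S \<Longrightarrow> ds \<eta> (s *v x0) x0 \<le> C2" using S(1) by (auto simp: C2_def)
  show ?thesis
  proof (rule that[of "C1 + C2"])
    show "infinite (ballA \<eta> (C1 + C2))"
    proof
      assume fin: "finite (ballA \<eta> (C1 + C2))"
      define T where "T = Max ((\<lambda>g. - lor x0 (g *v x0)) ` ballA \<eta> (C1 + C2))"
      obtain j where j: "- lor x0 (\<gamma> j *v x0) > T" using unb by blast
      have "\<gamma> j \<in> ballA \<eta> (C1 + C2)" using \<gamma>(1) dsg[of j] C2 by (simp add: ballA_def)
      then have "- lor x0 (\<gamma> j *v x0) \<le> T" unfolding T_def using fin by (intro Max_ge) auto
      with j show False by simp
    qed
    show "infinite (ballC \<eta> (C1 + C2))"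
    proof
      assume fin: "finite (ballC \<eta> (C1 + C2))"
      define \<tau> where "\<tau> c = \<bar>trace (SOME a. a \<in> c)\<bar>" for c :: "(real^3^3) set"
      \<comment> \<open>Including 3 ensures that a trace above \<open>T\<close> excludes the
        identity.\<close>
      define T where "T = Max (insert 3 (\<tau> ` ballC \<eta> (C1 + C2)))"
      have T: "T \<ge> 3" "\<And>c. c \<in> ballC \<eta> (C1 + C2) \<Longrightarrow> \<tau> c \<le> T" using fin by (auto simp: T_def)
      obtain j where "- lor x0 (\<gamma> j *v x0) > T / c" using unb by blast
      then have j: "c * - lor x0 (\<gamma> j *v x0) > T" using S(3) by (simp add: pos_divide_less_eq mult.commute)
      obtain s where s: "s \<in> S" "c * - lor x0 (\<gamma> j *v x0) \<le> \<bar>trace (\<gamma> j ** s)\<bar>" using S(4)[OF \<gamma>(1)] by blast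
      define a where "a = \<gamma> j ** s"
      have sG: "s \<in> \<Gamma>" using s S by blast
      have a: "a \<in> \<Gamma>" "\<bar>trace a\<bar> > T" using sG \<gamma>(1) s j by (auto simp: a_def)
      have "\<bar>trace (mat 1 :: real^3^3)\<bar> = 3" by (simp add: trace_def mat_def)
      then have a1: "a \<noteq> mat 1" using a T by auto
      have "ds \<eta> x0 (a *v x0) \<le> ds \<eta> x0 (\<gamma> j *v x0) + ds \<eta> (\<gamma> j *v x0) (\<gamma> j *v (s *v x0))"
        unfolding a_def matrix_vector_mul_assoc[symmetric] using \<gamma>(1) sG by (intro ds_triangle assms) auto
      also have "ds \<eta> (\<gamma> j *v x0) (\<gamma> j *v (s *v x0)) = ds \<eta> (s *v x0) x0"
        using ds_invariant[OF assms(1) \<gamma>(1)] by (simp add: ds_commute)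
      finally have "ds \<eta> (a *v x0) x0 \<le> C1 + C2" using dsg[of j] C2(2)[OF s(1)] by (simp add: ds_commute)
      then have "inum \<eta> (conjcl \<Gamma> a) \<le> C1 + C2" using inum_conjcl_le[OF assms(1) a(1) a1] by simp
      then have "conjcl \<Gamma> a \<in> ballC \<eta> (C1 + C2)" using conj_Curves[OF a(1) a1] by (simp add: ballC_def)
      then have "\<tau> (conjcl \<Gamma> a) \<le> T" by (rule T(2))
      moreover have "\<tau> (conjcl \<Gamma> a) = \<bar>trace a\<bar>"
        unfolding \<tau>_def using trace_conjcl[OF a(1)] someI[of "\<lambda>x. x \<in> conjcl \<Gamma> a", OF conjcl_self] by simp
      ultimately show False using a by simp
    qed
  qed
qed

lemma not_filling_crit:
  assumes "\<eta> \<in> Curr \<Gamma>" "\<not> filling \<eta>"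
  shows "crit_exp (ballA \<eta>) = \<infinity>" "crit_exp (ballC \<eta>) = \<infinity>"
proof -
  obtain C where C: "infinite (ballA \<eta> C)" "infinite (ballC \<eta> C)" using not_filling_infinite[OF assms] by blast
  show "crit_exp (ballA \<eta>) = \<infinity>"
  proof (rule crit_exp_infinite[of C])
    fix R assume "C \<le> R"
    then have "ballA \<eta> C \<subseteq> ballA \<eta> R" by (auto simp: ballA_def)
    then show "infinite (ballA \<eta> R)" using C finite_subset by blast
  qed
  show "crit_exp (ballC \<eta>) = \<infinity>"
  proof (rule crit_exp_infinite[of C])
    fix R assume "C \<le> R"
    then have "ballC \<eta> C \<subseteq> ballC \<eta> R" by (auto simp: ballC_def)
    then show "infinite (ballC \<eta> R)" using C finite_subset by blast
  qed
qed

subsection \<open>Filling currents\<close>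

text \<open>A ball of the current lies in a hyperbolic ball of radius \<open>A * R + B\<close>,
  where \<open>orbit_growth\<close> gives an exponential bound.\<close>

lemma filling_ballA:
  assumes "\<eta> \<in> Curr \<Gamma>" "filling \<eta>"
  obtains K where "\<And>R. finite (ballA \<eta> R)" "\<And>R. R \<ge> 1 \<Longrightarrow> ln (real (card (ballA \<eta> R))) \<le> K * R"
proof -
  obtain A B where AB: "A > 0" "B > 0" "\<And>x y l. x \<in> Hyp \<Longrightarrow> y \<in> Hyp \<Longrightarrow> l \<ge> 0 \<Longrightarrow> cosh l = - lor x y \<Longrightarrow> l \<le> A * ds \<eta> x y + B"
    using filling_orbit_length[OF assms] by blast
  obtain N :: nat where N: "N \<ge> 1" "\<And>n. card {g\<in>\<Gamma>. - lor x0 (g *v x0) \<le> cosh (real n)} \<le> N ^ (n + 1)"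
    using orbit_growth by blast
  have sub: "ballA \<eta> R \<subseteq> {g\<in>\<Gamma>. - lor x0 (g *v x0) \<le> cosh (real n)}" if n: "A * R + B \<le> real n" for R n
  proof
    fix g assume "g \<in> ballA \<eta> R"
    then have g: "g \<in> \<Gamma>" "ds \<eta> (g *v x0) x0 \<le> R" by (auto simp: ballA_def)
    have H: "g *v x0 \<in> Hyp" using g by simp
    define l where "l = arcosh (- lor (g *v x0) x0)"
    have "- lor (g *v x0) x0 \<ge> 1" using Hyp_lor_le[OF H x0_Hyp] by linarith
    then have l: "l \<ge> 0" "cosh l = - lor (g *v x0) x0" by (simp_all add: l_def)
    have "l \<le> A * ds \<eta> (g *v x0) x0 + B" by (rule AB(3)[OF H x0_Hyp l])
    also have "\<dots> \<le> A * R + B" using g AB by simp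
    finally have "cosh l \<le> cosh (real n)" using n l by (subst cosh_real_nonneg_le_iff) auto
    then show "g \<in> {g\<in>\<Gamma>. - lor x0 (g *v x0) \<le> cosh (real n)}" using g l by (simp add: lor_commute)
  qed
  have fin: "finite (ballA \<eta> R)" for R
  proof -
    obtain n :: nat where "A * R + B \<le> real n" using real_arch_simple by blast
    then show ?thesis using sub finite_displacement finite_subset by blast
  qed
  show ?thesis
  proof (rule that[of "(A + B + 2) * ln (real N)", OF fin])
    fix R :: real assume R: "R \<ge> 1"
    define n where "n = nat \<lceil>A * R + B\<rceil>"
    have "A * R + B > 0" using AB R by (intro add_pos_pos mult_pos_pos) auto
    then have n: "A * R + B \<le> real n" "real n \<le> A * R + B + 1" by (simp_all add: n_def)
    have lnN: "0 \<le> ln (real N)" using N(1) by simp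
    have "card (ballA \<eta> R) \<le> N ^ (n + 1)"
      using card_mono[OF finite_displacement sub[OF n(1)]] N(2)[of n] by linarith
    moreover have "card (ballA \<eta> R) = 0 \<or> card (ballA \<eta> R) > 0" by auto
    ultimately have "ln (real (card (ballA \<eta> R))) \<le> ln (real (N ^ (n + 1)))"
    proof (elim disjE)
      assume "card (ballA \<eta> R) = 0"
      then show ?thesis using lnN by (simp add: ln_realpow del: power_Suc)
    next
      assume p: "card (ballA \<eta> R) > 0" and le: "card (ballA \<eta> R) \<le> N ^ (n + 1)"
      then show ?thesis by (intro ln_mono) (auto simp del: of_nat_power power_Suc)
    qed
    also have "\<dots> = (real n + 1) * ln (real N)" using N(1) by (simp add: ln_realpow del: power_Suc)
    also have "\<dots> \<le> (A * R + B + 2) * ln (real N)" using n lnN by (intro mult_right_mono) auto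
    also have "\<dots> \<le> ((A + B + 2) * R) * ln (real N)"
    proof (intro mult_right_mono lnN)
      have "B * 1 \<le> B * R" using AB(2) R by (intro mult_left_mono) auto
      then show "A * R + B + 2 \<le> (A + B + 2) * R" using R by (simp add: algebra_simps)
    qed
    finally show "ln (real (card (ballA \<eta> R))) \<le> (A + B + 2) * ln (real N) * R" by (simp add: algebra_simps)
  qed
qed

text \<open>Each curve is sent to a representative whose displacement exceeds the intersection
  number by at most a constant; a class is determined by any of its elements, so this map is
  injective.\<close>

lemma crit_ballC_le_ballA:
  assumes "\<eta> \<in> Curr \<Gamma>"
  shows "crit_exp (ballC \<eta>) \<le> crit_exp (ballA \<eta>)"
proof -
  let ?C = "2 * mass \<eta> M0 + mass \<eta> 0"
  have "crit_exp (ballC \<eta>) \<le> ereal 1 * crit_exp (ballA \<eta>)"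
  proof (rule crit_exp_le[where b = ?C and c = 1])
    fix R :: real assume R: "R \<ge> 0" and fin: "finite (ballA \<eta> (1 * R + ?C))"
    have "\<forall>c\<in>ballC \<eta> R. \<exists>b. b \<in> c \<and> b \<in> \<Gamma> \<and> ds \<eta> (b *v x0) x0 \<le> inum \<eta> c + ?C"
      using inter_class(3)[OF assms] by (auto simp: ballC_def)
    from bchoice[OF this] obtain f where f: "\<And>c. c \<in> ballC \<eta> R \<Longrightarrow> f c \<in> c \<and> f c \<in> \<Gamma> \<and> ds \<eta> (f c *v x0) x0 \<le> inum \<eta> c + ?C"
      by blast
    have sub: "f ` ballC \<eta> R \<subseteq> ballA \<eta> (1 * R + ?C)" using f by (fastforce simp: ballA_def ballC_def)
    have inj: "inj_on f (ballC \<eta> R)"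
    proof (rule inj_onI)
      fix c d assume cd: "c \<in> ballC \<eta> R" "d \<in> ballC \<eta> R" "f c = f d"
      obtain a where a: "a \<in> \<Gamma>" "c = conjcl \<Gamma> a" using cd(1) by (auto simp: ballC_def Curves_def)
      obtain b where b: "b \<in> \<Gamma>" "d = conjcl \<Gamma> b" using cd(2) by (auto simp: ballC_def Curves_def)
      have "f c \<in> conjcl \<Gamma> a" "f c \<in> conjcl \<Gamma> b" using f[OF cd(1)] f[OF cd(2)] a b cd(3) by auto
      then show "c = d" using conjcl_eq[OF a(1)] conjcl_eq[OF b(1)] a b by metis
    qed
    have "finite (ballC \<eta> R)" using inj_on_finite[OF inj sub fin] .
    moreover have "card (ballC \<eta> R) \<le> card (ballA \<eta> (1 * R + ?C))" by (rule card_inj_on_le[OF inj sub fin])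
    then have "real (card (ballC \<eta> R)) \<le> 1 * (real (card (ballA \<eta> (1 * R + ?C))) + 1)" by simp
    moreover have "1 * (real (card (ballA \<eta> (1 * R + ?C))) + 1) \<le> (1 * R + 1) * (real (card (ballA \<eta> (1 * R + ?C))) + 1)"
      using R by (intro mult_right_mono) auto
    ultimately show "finite (ballC \<eta> R) \<and> real (card (ballC \<eta> R)) \<le> (1 * R + 1) * (real (card (ballA \<eta> (1 * R + ?C))) + 1)"
      by linarith
  qed simp_all
  then show ?thesis by simp
qed

text \<open>The elements of a conjugacy class whose axis passes near \<open>x0\<close> correspond to the
  visits of the closed geodesic to a ball, so their number grows at most linearly in its length.\<close>

lemma card_class_near:
  assumes "a \<in> \<Gamma>" "haxis a u w v l" "r \<ge> 0"
  defines "Q \<equiv> card {b\<in>\<Gamma>. - lor x0 (b *v x0) \<le> 2 * (2 * sqrt (1 + r\<^sup>2) * cosh 1) * M0}"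
  defines "D \<equiv> {g\<in>conjcl \<Gamma> a. \<forall>u w v l. haxis g u w v l \<longrightarrow> \<bar>lor x0 v\<bar> \<le> r}"
  shows "finite D" "real (card D) \<le> (l + 1) * real Q"
proof -
  let ?R = "2 * sqrt (1 + r\<^sup>2) * cosh 1"
  let ?P = "\<lambda>j. {b\<in>\<Gamma>. - lor x0 (b *v hline u w (real j)) \<le> ?R}"
  let ?U = "\<Union>j\<in>{..nat \<lfloor>l\<rfloor>}. ?P j"
  note np = frame_nullpair[OF haxis_frame[OF assms(2)]] and lp = haxis_pos[OF assms(2)]
  have finU: "finite ?U" using finite_near_point(1) hline_in_Hyp[OF np] by blast
  have sub: "D \<subseteq> (\<lambda>b. b ** a ** matrix_inv b) ` ?U"
  proof
    fix g assume g: "g \<in> D"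
    then obtain k where k: "k \<in> \<Gamma>" "g = k ** a ** matrix_inv k" by (auto simp: D_def conjcl_def)
    have "haxis g (k *v u) (k *v w) (k *v v) l"
      using assms(2) k frame_image[OF G_SOplus[OF k(1)]]
      by (simp add: haxis_def matrix_vector_mul_assoc[symmetric] matrix_vector_mult_scaleR)
    then have "\<bar>lor x0 (k *v v)\<bar> \<le> r" using g unfolding D_def by blast
    then obtain c j where c: "c \<in> cyc a" "real j \<le> l" "- lor x0 ((k ** c) *v hline u w (real j)) \<le> ?R"
      using coset_near[OF assms(2,1) k(1)] by metis
    have cG: "c \<in> \<Gamma>" using cyc_G[OF assms(1) c(1)] .
    have "k ** c \<in> ?U" using c cG k by (auto simp: le_nat_floor)
    moreover have "g = (k ** c) ** a ** matrix_inv (k ** c)"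
    proof -
      obtain i where i: "\<And>t. c *v hline u w t = hline u w (t + of_int i * l)" using cyc_hline[OF assms(2,1) c(1)] by blast
      \<comment> \<open>Both are translations of the axis, and an element is determined by its
        action on one point; hence conjugating by \<open>k ** c\<close> instead of \<open>k\<close>
        gives the same element.\<close>
      have "c ** a = a ** c"
        by (rule G_eqI[where x = "hline u w 0"])
          (use cG assms(1) hline_in_Hyp[OF np] haxis_hline[OF assms(2)] in
           \<open>auto simp: i matrix_vector_mul_assoc[symmetric] algebra_simps simp del: hline_0\<close>)
      have "(k ** c) ** a ** matrix_inv (k ** c) = k ** (c ** a) ** matrix_inv c ** matrix_inv k"
        using k cG by (simp add: matrix_inv_mult matrix_mul_assoc)
      also have "\<dots> = k ** a ** (c ** matrix_inv c) ** matrix_inv k"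
        unfolding \<open>c ** a = a ** c\<close> by (simp only: matrix_mul_assoc)
      also have "\<dots> = g" using k cG by (simp add: G_inv_right)
      finally show ?thesis by simp
    qed
    ultimately show "g \<in> (\<lambda>b. b ** a ** matrix_inv b) ` ?U" by blast
  qed
  show "finite D" using finite_subset[OF sub] finU by blast
  have "card D \<le> card ?U" using surj_card_le[OF finU sub] .
  also have "\<dots> \<le> (\<Sum>j\<in>{..nat \<lfloor>l\<rfloor>}. card (?P j))" by (rule card_UN_le) simp
  also have "\<dots> \<le> (\<Sum>j\<in>{..nat \<lfloor>l\<rfloor>}. Q)"
    unfolding Q_def by (intro sum_mono finite_near_point(2) hline_in_Hyp[OF np])
  also have "\<dots> = (nat \<lfloor>l\<rfloor> + 1) * Q" by simp
  finally have "real (card D) \<le> (real (nat \<lfloor>l\<rfloor>) + 1) * real Q" by (metis of_nat_1 of_nat_add of_nat_le_iff of_nat_mult)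
  also have "\<dots> \<le> (l + 1) * real Q" using lp by (intro mult_right_mono) auto
  finally show "real (card D) \<le> (l + 1) * real Q" .
qed

text \<open>Every \<open>g\<close> in the ball is \<open>(g ** s) ** matrix_inv s\<close>, where
  \<open>g ** s\<close> is the identity or an element with axis near \<open>x0\<close> in a class of
  intersection number at most \<open>R + C\<close>. By filling, the length of such a class is at
  most linear in \<open>R\<close>, so \<open>card_class_near\<close> allows it linearly many such
  elements, a factor that \<open>crit_exp_le\<close> tolerates.\<close>

lemma crit_ballA_le_ballC:
  assumes "\<eta> \<in> Curr \<Gamma>" "filling \<eta>"
  shows "crit_exp (ballA \<eta>) \<le> crit_exp (ballC \<eta>)"
proof -
  obtain A B where AB: "A > 0" "B > 0" "\<And>u w l. nullpair u w \<Longrightarrow> l \<ge> 0 \<Longrightarrow> l \<le> A * measure (lm \<eta> u w) {0..<l} + B"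
    using filling_length[OF assms] by blast
  obtain S c r where S: "finite S" "S \<subseteq> \<Gamma>" "c > 0" "r \<ge> 0"
    "\<And>g. g \<in> \<Gamma> \<Longrightarrow> \<exists>s\<in>S. c * - lor x0 (g *v x0) \<le> \<bar>trace (g ** s)\<bar>
      \<and> (\<forall>u w v l. g ** s \<noteq> mat 1 \<longrightarrow> haxis (g ** s) u w v l \<longrightarrow> \<bar>lor x0 v\<bar> \<le> r)"
    using closing by blast
  define C where "C = Max (insert 0 ((\<lambda>s. ds \<eta> (s *v x0) x0) ` S))"
  have C: "C \<ge> 0" "\<And>s. s \<in> S \<Longrightarrow> ds \<eta> (s *v x0) x0 \<le> C" using S(1) by (auto simp: C_def)
  define Q where "Q = real (card {b\<in>\<Gamma>. - lor x0 (b *v x0) \<le> 2 * (2 * sqrt (1 + r\<^sup>2) * cosh 1) * M0})"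
  have Q: "Q \<ge> 0" by (simp add: Q_def)
  \<comment> \<open>Chosen so that \<open>card S * (1 + m) \<le> k * R + k\<close> for the bound
    \<open>m\<close> below on the number of elements per class.\<close>
  define k where "k = real (card S) * (1 + Q * (A + A * C + B + 1))"
  have "crit_exp (ballA \<eta>) \<le> ereal 1 * crit_exp (ballC \<eta>)"
  proof (rule crit_exp_le[where b = C and c = k])
    show "k \<ge> 0" using Q AB C by (simp add: k_def)
    fix R :: real assume R: "R \<ge> 0" and fin: "finite (ballC \<eta> (1 * R + C))"
    let ?D = "\<lambda>c. {g\<in>c. \<forall>u w v l. haxis g u w v l \<longrightarrow> \<bar>lor x0 v\<bar> \<le> r}"
    let ?q = "real (card (ballC \<eta> (1 * R + C)))"
    define V where "V = insert (mat 1) (\<Union>c\<in>ballC \<eta> (1 * R + C). ?D c)"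
    define m where "m = Q * (A * (R + C) + B + 1)"
    have m0: "m \<ge> 0" using Q AB C R by (simp add: m_def)
    have Dc: "finite (?D c) \<and> real (card (?D c)) \<le> m" if c: "c \<in> ballC \<eta> (1 * R + C)" for c
    proof -
      have cC: "c \<in> Curves \<Gamma>" "inum \<eta> c \<le> R + C" using c by (auto simp: ballC_def)
      obtain a u w v l where a: "a \<in> \<Gamma>" "c = conjcl \<Gamma> a" "haxis a u w v l" "inum \<eta> c = measure (lm \<eta> u w) {0..<l}"
        using inter_class(4)[OF assms(1) cC(1)] by blast
      note np = frame_nullpair[OF haxis_frame[OF a(3)]] and lp = haxis_pos[OF a(3)]
      have "l \<le> A * inum \<eta> c + B" unfolding a(4) using AB(3)[OF np] lp by simp
      also have "\<dots> \<le> A * (R + C) + B" using cC AB by simp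
      finally have "(l + 1) * Q \<le> m" unfolding m_def using Q by (subst mult.commute) (intro mult_left_mono, auto)
      then show ?thesis using card_class_near[OF a(1,3) S(4)] unfolding a(2) Q_def by linarith
    qed
    have finV: "finite V" unfolding V_def using fin Dc by blast
    have cardV: "real (card V) \<le> 1 + ?q * m"
    proof -
      have "card V \<le> card (\<Union>c\<in>ballC \<eta> (1 * R + C). ?D c) + 1"
        unfolding V_def using fin Dc by (subst card_insert_if) auto
      also have "card (\<Union>c\<in>ballC \<eta> (1 * R + C). ?D c) \<le> (\<Sum>c\<in>ballC \<eta> (1 * R + C). card (?D c))"
        by (rule card_UN_le[OF fin])
      finally have "real (card V) \<le> (\<Sum>c\<in>ballC \<eta> (1 * R + C). real (card (?D c))) + 1" by (simp flip: of_nat_sum)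
      also have "(\<Sum>c\<in>ballC \<eta> (1 * R + C). real (card (?D c))) \<le> (\<Sum>c\<in>ballC \<eta> (1 * R + C). m)"
        by (intro sum_mono) (use Dc in blast)
      finally show ?thesis by simp
    qed
    have sub: "ballA \<eta> R \<subseteq> (\<lambda>(g, s). g ** matrix_inv s) ` (V \<times> S)"
    proof
      fix g assume "g \<in> ballA \<eta> R"
      then have g: "g \<in> \<Gamma>" "ds \<eta> (g *v x0) x0 \<le> R" by (auto simp: ballA_def)
      obtain s where s: "s \<in> S" "\<And>u w v l. g ** s \<noteq> mat 1 \<Longrightarrow> haxis (g ** s) u w v l \<Longrightarrow> \<bar>lor x0 v\<bar> \<le> r"
        using S(5)[OF g(1)] by blast
      have sG: "s \<in> \<Gamma>" using s S by blast
      let ?a = "g ** s"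
      have aG: "?a \<in> \<Gamma>" using g sG by simp
      have "?a \<in> V"
      proof (cases "?a = mat 1")
        case False
        have "ds \<eta> x0 (?a *v x0) \<le> ds \<eta> x0 (g *v x0) + ds \<eta> (g *v x0) (g *v (s *v x0))"
          unfolding matrix_vector_mul_assoc[symmetric] using g sG by (intro ds_triangle assms) auto
        also have "ds \<eta> (g *v x0) (g *v (s *v x0)) = ds \<eta> (s *v x0) x0"
          using ds_invariant[OF assms(1) g(1)] by (simp add: ds_commute)
        finally have "ds \<eta> (?a *v x0) x0 \<le> R + C" using g C(2)[OF s(1)] by (simp add: ds_commute)
        then have "inum \<eta> (conjcl \<Gamma> ?a) \<le> R + C" using inum_conjcl_le[OF assms(1) aG False] by simp
        then have "conjcl \<Gamma> ?a \<in> ballC \<eta> (1 * R + C)" using conj_Curves[OF aG False] by (simp add: ballC_def)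
        moreover have "?a \<in> ?D (conjcl \<Gamma> ?a)" using conjcl_self s(2)[OF False] by blast
        ultimately show ?thesis unfolding V_def by blast
      qed (simp add: V_def)
      moreover have "g = ?a ** matrix_inv s" using G_inv_right[OF sG] by (simp flip: matrix_mul_assoc)
      ultimately show "g \<in> (\<lambda>(g, s). g ** matrix_inv s) ` (V \<times> S)" using s(1) by force
    qed
    have finVS: "finite (V \<times> S)" using finV S by simp
    have finA: "finite (ballA \<eta> R)" using finite_subset[OF sub] finVS by blast
    have "card (ballA \<eta> R) \<le> card V * card S"
      using surj_card_le[OF finVS sub] by (simp add: card_cartesian_product)
    then have "real (card (ballA \<eta> R)) \<le> real (card V) * real (card S)" by (metis of_nat_le_iff of_nat_mult)
    also have "\<dots> \<le> (1 + ?q * m) * real (card S)" using cardV by (intro mult_right_mono) auto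
    also have "\<dots> \<le> ((1 + m) * (?q + 1)) * real (card S)"
      using m0 by (intro mult_right_mono) (auto simp: algebra_simps)
    also have "\<dots> = real (card S) * (1 + m) * (?q + 1)" by simp
    also have "\<dots> \<le> (k * R + k) * (?q + 1)"
    proof (intro mult_right_mono)
      have "m \<le> Q * ((A + A * C + B + 1) * (R + 1))"
        unfolding m_def using R AB C Q by (intro mult_left_mono) (auto simp: algebra_simps)
      then have "1 + m \<le> (1 + Q * (A + A * C + B + 1)) * (R + 1)" using R by (simp add: algebra_simps)
      then have "real (card S) * (1 + m) \<le> real (card S) * ((1 + Q * (A + A * C + B + 1)) * (R + 1))"
        by (intro mult_left_mono) auto
      also have "\<dots> = k * R + k" by (simp add: k_def algebra_simps)
      finally show "real (card S) * (1 + m) \<le> k * R + k" .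
    qed simp
    finally show "finite (ballA \<eta> R) \<and> real (card (ballA \<eta> R)) \<le> (k * R + k) * (?q + 1)" using finA by blast
  qed simp
  then show ?thesis by simp
qed

lemma filling_crit_real:
  assumes "\<eta> \<in> Curr \<Gamma>" "filling \<eta>"
  obtains d where "crit_exp (ballA \<eta>) = ereal d" "d \<ge> 0"
proof -
  obtain K where K: "\<And>R. finite (ballA \<eta> R)" "\<And>R. R \<ge> 1 \<Longrightarrow> ln (real (card (ballA \<eta> R))) \<le> K * R"
    using filling_ballA[OF assms] by blast
  have "crit_exp (ballA \<eta>) \<le> ereal K" by (rule crit_exp_bounded) (use K in blast)
  then show ?thesis using crit_exp_nonneg[of "ballA \<eta>"] that by (cases "crit_exp (ballA \<eta>)") auto
qed

lemma crit_compare: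
  assumes "a > 0" "\<And>g. g \<in> \<Gamma> \<Longrightarrow> ds \<eta>' (g *v x0) x0 \<le> a * ds \<eta> (g *v x0) x0 + b"
  shows "crit_exp (ballA \<eta>) \<le> ereal a * crit_exp (ballA \<eta>')"
proof (rule crit_exp_le[OF assms(1), where b = b and c = 1])
  fix R :: real assume R: "R \<ge> 0" and fin: "finite (ballA \<eta>' (a * R + b))"
  have sub: "ballA \<eta> R \<subseteq> ballA \<eta>' (a * R + b)"
  proof
    fix g assume "g \<in> ballA \<eta> R"
    then have g: "g \<in> \<Gamma>" "ds \<eta> (g *v x0) x0 \<le> R" by (auto simp: ballA_def)
    have "ds \<eta>' (g *v x0) x0 \<le> a * ds \<eta> (g *v x0) x0 + b" by (rule assms(2)[OF g(1)])
    also have "\<dots> \<le> a * R + b" using g assms(1) by simp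
    finally show "g \<in> ballA \<eta>' (a * R + b)" using g by (simp add: ballA_def)
  qed
  let ?q = "real (card (ballA \<eta>' (a * R + b)))"
  have "real (card (ballA \<eta> R)) \<le> 1 * (?q + 1)" using card_mono[OF fin sub] by simp
  also have "\<dots> \<le> (1 * R + 1) * (?q + 1)" using R by (intro mult_right_mono) auto
  finally show "finite (ballA \<eta> R) \<and> real (card (ballA \<eta> R)) \<le> (1 * R + 1) * (?q + 1)"
    using finite_subset[OF sub fin] by blast
qed simp

lemma topspace_curr_top: "topspace (curr_top \<Gamma>) = Curr \<Gamma>"
proof
  show "Curr \<Gamma> \<subseteq> topspace (curr_top \<Gamma>)" using openin_subset[OF openin_curr_top_Curr] .
  show "topspace (curr_top \<Gamma>) \<subseteq> Curr \<Gamma>"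
    unfolding curr_top_def topology_generated_by_topspace by auto
qed

text \<open>Distances that agree up to the factors \<open>1 + \<delta>\<close>,
  \<open>1 - \<delta>\<close> and an additive constant have critical exponents with
  \<open>(1 - \<delta>) * d' \<le> d\<close> and \<open>d \<le> (1 + \<delta>) * d'\<close>, where
  \<open>d'\<close> belongs to the nearby current.\<close>

lemma continuous_map_crit:
  "continuous_map (subtopology (curr_top \<Gamma>) (Filling \<Gamma>)) euclidean (metric_crit \<Gamma> x0)"
proof -
  let ?T = "subtopology (curr_top \<Gamma>) (Filling \<Gamma>)"
  have ts: "topspace ?T = Filling \<Gamma>" by (auto simp: topspace_curr_top Filling_def)
  have loc: "\<exists>V. openin ?T V \<and> \<eta> \<in> V \<and> V \<subseteq> {\<mu>\<in>Filling \<Gamma>. metric_crit \<Gamma> x0 \<mu> \<in> U}"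
    if U: "open U" and \<eta>: "\<eta> \<in> Filling \<Gamma>" "metric_crit \<Gamma> x0 \<eta> \<in> U" for U \<eta>
  proof -
    have \<eta>C: "\<eta> \<in> Curr \<Gamma>" "filling \<eta>" using \<eta>(1) by (auto simp: Filling_def)
    obtain d where d: "crit_exp (ballA \<eta>) = ereal d" "d \<ge> 0" using filling_crit_real[OF \<eta>C] by blast
    have "ereal d \<in> U" using \<eta>(2) metric_crit_eq[OF \<eta>C(1)] d by simp
    moreover have "open (ereal -` U)" using U by (rule open_ereal_vimage)
    ultimately obtain e where e: "e > 0" "ball d e \<subseteq> ereal -` U" 
      unfolding open_contains_ball by (metis vimageI)
    \<comment> \<open>The bound 1/2 yields \<open>d' \<le> 2 * d\<close>, so the error
      \<open>\<delta> * d'\<close> is at most \<open>2 * d * \<delta> < e\<close>;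
      \<open>d + 1\<close> in place of \<open>d\<close> covers the case
      \<open>d = 0\<close>.\<close>
    define \<delta> where "\<delta> = min (1/2) (e / (4 * (d + 1)))"
    have \<delta>: "\<delta> > 0" "\<delta> \<le> 1/2" "2 * d * \<delta> < e"
    proof -
      show "\<delta> \<le> 1/2" unfolding \<delta>_def by (rule min.cobounded1)
      show "\<delta> > 0" using e d by (simp add: \<delta>_def)
      have "2 * d * \<delta> \<le> 2 * d * (e / (4 * (d + 1)))" using d by (intro mult_left_mono) (auto simp: \<delta>_def)
      also have "\<dots> < e"
      proof -
        have "2 * d * e < e * (4 * (d + 1))" using e d by (simp add: algebra_simps add_pos_nonneg)
        then show ?thesis using d by (simp add: pos_divide_less_eq)
      qed
      finally show "2 * d * \<delta> < e" .
    qed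
    obtain W C where W: "openin (curr_top \<Gamma>) W" "\<eta> \<in> W" "C \<ge> 0"
      "\<And>\<mu> g. \<mu> \<in> W \<Longrightarrow> g \<in> \<Gamma> \<Longrightarrow> \<mu> \<in> Curr \<Gamma> \<and>
       ds \<mu> (g *v x0) x0 \<le> (1 + \<delta>) * ds \<eta> (g *v x0) x0 + C \<and>
       (1 - \<delta>) * ds \<eta> (g *v x0) x0 \<le> ds \<mu> (g *v x0) x0 + C"
      using ds_continuity[OF \<eta>C \<delta>(1)] by blast
    have "metric_crit \<Gamma> x0 \<mu> \<in> U" if \<mu>: "\<mu> \<in> W" "\<mu> \<in> Filling \<Gamma>" for \<mu>
    proof -
      have \<mu>C: "\<mu> \<in> Curr \<Gamma>" "filling \<mu>" using \<mu>(2) by (auto simp: Filling_def)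
      obtain d' where d': "crit_exp (ballA \<mu>) = ereal d'" "d' \<ge> 0" using filling_crit_real[OF \<mu>C] by blast
      have "crit_exp (ballA \<eta>) \<le> ereal (1 + \<delta>) * crit_exp (ballA \<mu>)"
        by (rule crit_compare[where b = C]) (use W(4)[OF \<mu>(1)] \<delta> in auto)
      then have 1: "d \<le> (1 + \<delta>) * d'" by (simp add: d d')
      have "crit_exp (ballA \<mu>) \<le> ereal (1 / (1 - \<delta>)) * crit_exp (ballA \<eta>)"
      proof (rule crit_compare[where b = "C / (1 - \<delta>)"])
        show "1 / (1 - \<delta>) > 0" using \<delta> by simp
        fix g assume "g \<in> \<Gamma>"
        then have "(1 - \<delta>) * ds \<eta> (g *v x0) x0 \<le> ds \<mu> (g *v x0) x0 + C" using W(4)[OF \<mu>(1)] by blast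
        then have "ds \<eta> (g *v x0) x0 \<le> (ds \<mu> (g *v x0) x0 + C) / (1 - \<delta>)"
          using \<delta> by (simp add: pos_le_divide_eq mult.commute)
        then show "ds \<eta> (g *v x0) x0 \<le> 1 / (1 - \<delta>) * ds \<mu> (g *v x0) x0 + C / (1 - \<delta>)" by (simp add: add_divide_distrib)
      qed
      then have "d' \<le> 1 / (1 - \<delta>) * d" by (simp add: d d')
      then have 2: "(1 - \<delta>) * d' \<le> d" using \<delta> by (simp add: pos_le_divide_eq mult.commute)
      have "d' \<le> 2 * d"
      proof -
        have "1/2 * d' \<le> (1 - \<delta>) * d'" using \<delta> d' by (intro mult_right_mono) auto
        then show ?thesis using 2 by simp
      qed
      then have "\<delta> * d' \<le> \<delta> * (2 * d)" using \<delta> by (intro mult_left_mono) auto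
      then have "\<delta> * d' < e" using \<delta>(3) by (simp add: algebra_simps)
      then have "d - e < d'" "d' < d + e" using 1 2 by (simp_all add: algebra_simps)
      then have "ereal d' \<in> U" using e(2) by (auto simp: subset_iff dist_real_def)
      then show ?thesis using metric_crit_eq[OF \<mu>C(1)] d' by simp
    qed
    then show ?thesis
      using W \<eta>(1) by (intro exI[of _ "W \<inter> Filling \<Gamma>"]) (auto simp: openin_subtopology_Int)
  qed
  show ?thesis
    unfolding continuous_map_def ts
  proof (intro conjI allI impI)
    fix U :: "ereal set" assume "openin euclidean U"
    then have "open U" by simp
    then show "openin ?T {\<eta> \<in> Filling \<Gamma>. metric_crit \<Gamma> x0 \<eta> \<in> U}"
    proof (subst openin_subopen, intro ballI)
      fix \<eta> assume "\<eta> \<in> {\<eta> \<in> Filling \<Gamma>. metric_crit \<Gamma> x0 \<eta> \<in> U}"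
      then have "\<eta> \<in> Filling \<Gamma>" "metric_crit \<Gamma> x0 \<eta> \<in> U" by auto
      from loc[OF \<open>open U\<close> this] show "\<exists>V. openin ?T V \<and> \<eta> \<in> V \<and> V \<subseteq> {\<eta> \<in> Filling \<Gamma>. metric_crit \<Gamma> x0 \<eta> \<in> U}" .
    qed
  qed simp
qed

end

theorem mainTheorem9:
  fixes \<Gamma> :: "(real^3^3) set" and x0 :: "real^3"
  assumes "surface_group \<Gamma>" and "x0 \<in> Hyp"
  shows "(\<forall>\<eta>\<in>Curr \<Gamma>. metric_crit \<Gamma> x0 \<eta> = geod_crit \<Gamma> \<eta>)
       \<and> (\<forall>\<eta>\<in>Curr \<Gamma>. \<bar>metric_crit \<Gamma> x0 \<eta>\<bar> \<noteq> \<infinity> \<longleftrightarrow> filling \<eta>)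
       \<and> continuous_map (subtopology (curr_top \<Gamma>) (Filling \<Gamma>)) euclidean (metric_crit \<Gamma> x0)"
proof -
  interpret surface \<Gamma> x0 using assms by unfold_locales
  have "metric_crit \<Gamma> x0 \<eta> = geod_crit \<Gamma> \<eta>" if \<eta>: "\<eta> \<in> Curr \<Gamma>" for \<eta>
  proof (cases "filling \<eta>")
    case True
    then show ?thesis unfolding metric_crit_eq[OF \<eta>] geod_crit_eq[OF \<eta>]
      by (intro antisym crit_ballA_le_ballC crit_ballC_le_ballA \<eta>)
  next
    case False
    then show ?thesis unfolding metric_crit_eq[OF \<eta>] geod_crit_eq[OF \<eta>] by (simp add: not_filling_crit[OF \<eta>])
  qed
  moreover have "\<bar>metric_crit \<Gamma> x0 \<eta>\<bar> \<noteq> \<infinity> \<longleftrightarrow> filling \<eta>" if \<eta>: "\<eta> \<in> Curr \<Gamma>" for \<eta>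
  proof (cases "filling \<eta>")
    case True
    obtain d where "crit_exp (ballA \<eta>) = ereal d" using filling_crit_real[OF \<eta> True] by blast
    then show ?thesis unfolding metric_crit_eq[OF \<eta>] using True by simp
  next
    case False
    then show ?thesis unfolding metric_crit_eq[OF \<eta>] by (simp add: not_filling_crit[OF \<eta>])
  qed
  ultimately show ?thesis using continuous_map_crit by (intro conjI ballI)
qed

end
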